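(* Under the data assumption and smallness assumption stated in the context, the limiting loss $L(\theta)=\lim_{T\to\infty}\mathbb{E}[L_T(\theta)]$ satisfies, for every $\theta\in\Theta$, $$\nabla_\theta L(\theta)=\nabla_\theta\Big[\lim_{T\to\infty}\mathbb{E}[L_T(\theta)]\Big]=\lim_{T\to\infty}\nabla_\theta\mathbb{E}[L_T(\theta)]=\int g^\theta(h)\,\mu^\theta(dh),$$ $$\mathrm{Hess}_\theta L(\theta)=\mathrm{Hess}_\theta\Big[\lim_{T\to\infty}\mathbb{E}[L_T(\theta)]\Big]=\lim_{T\to\infty}\mathrm{Hess}_\theta\,\mathbb{E}[L_T(\theta)]=\int \mathrm{he}^\theta(h)\,\mu^\theta(dh).$$
   Context: Norms: $\|\cdot\|_{\max}$ is the largest absolute value of the entries of a vector/array; $\mathrm{Wass}_2$ is the 2-Wasserstein distance with respect to $\|\cdot\|_{\max}$. Data. Fix positive integers $d,N,d_Z$. $(X_t,Z_t)_{t\ge0}$ is a time-homogeneous Markov chain in $\mathbb{R}^d\times\mathbb{R}^{d_Z}$ with transition kernel $\wp$; $(\eta_t)_{t\ge0}$ are i.i.d. real random variables with law $\mu_\eta$, independent of $(X_t,Z_t)$; $Y_t=f(X_t,Z_t,\eta_t)$. Data assumption: (i) $\mathrm{Wass}_2(\wp(w,\cdot),\wp(\tilde w,\cdot))\le L_\wp\|w-\tilde w\|_{\max}$ for all $w,\tilde w\in\mathbb{R}^{d+d_Z}$, $L_\wp<1$; (ii) $|f(x,z,\eta)-f(\tilde x,\tilde z,\tilde\eta)|\le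 L_f\|(x,z,\eta)-(\tilde x,\tilde z,\tilde\eta)\|_{\max}$; (iii) $\|(X_t,Z_t)\|_{\max}\le1$ for all $t$, $|f|\le L_f$. Network. Parameters $\theta=(A,W,B,c)$, $A\in\mathbb{R}^{N\times d}$, $W\in\mathbb{R}^{N\times N}$, $B\in\mathbb{R}^N$, $c\in\mathbb{R}$, viewed as a vector in $\Theta=\mathbb{R}^{d_\theta}$, $d_\theta=Nd+N^2+N+1$. $\sigma(y)=1/(1+e^{-y})$. $\phi,\lambda:\mathbb{R}\to\mathbb{R}$ are infinitely differentiable, bounded, with all derivatives bounded, applied entrywise; $|\phi|\le C_\phi$, $|\phi'|\le C_{\phi'}$, $|\phi''|\le C_{\phi''}$. For fixed $\theta$: $S_0=0$, $S^k_{t+1}=\sigma\big(\frac1d\langle\phi(A^{k,:}),X_t\rangle+\frac1N\langle\phi(W^{k,:}),S_t\rangle\big)$, $f_t(\theta)=\langle\lambda(B),S_t\rangle+\lambda(c)$, $L_T(\theta)=\frac1{2T}\sum_{t=1}^T(Y_t-f_t(\theta))^2$. Smallness assumption. $C_\phi<4$; $M_\phi=1+\frac{C_\phi}{4-C_\phi}$, $m=\min(N,d)$, $L_0=\max\big(\frac{3C_{\phi'}}{m}(\frac{C_\phi M_\phi}{10}+\frac14),\frac{3C_\phi}{4}\big)$, $L_2=\max\big(\frac{C_{\phi''}}{m},\frac{C_{\phi'}^2}{Nd(4-C_\phi)}\big)$, $T_1=\frac{M_\phi C_{\phi'}^2}{5m^2}+\frac{C_\phi M_\phi^2C_{\phi'}^2}{8m^2}+\frac{C_{\phi''}}{4m}+\frac{C_\phi}{10}\Big(L_2+\frac{C_\phi}{1-C_\phi/4}\big(\frac{C_{\phi'}^2M_\phi^2}{10m^2}+\frac14L_2\big)\Big)$,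 $T_2=\frac{C_\phi M_\phi C_{\phi'}}{5m}+\frac{C_{\phi'}}{4N}$, $L_1=\max(4T_1,4T_2,C_\phi)$, $\bar L=\max(L_0,L_1)$; assume $0<\sqrt{\bar L^2+L_\wp^2}<1$. Joint process and stationary law. $\tilde S_t$ has entries $\tilde S_t^{\diamondsuit,k}=\partial S_t^k/\partial\diamondsuit$ and $\tilde{\tilde S}_t$ has entries $\tilde{\tilde S}_t^{\diamondsuit,\heartsuit,k}=\partial^2S_t^k/\partial\diamondsuit\partial\heartsuit$, where $\diamondsuit,\heartsuit$ range over the entries of $A$ and $W$. $\mu^\theta$ is the stationary distribution to which the law of $H_t=(X_t,Z_t,S_t,\tilde S_t,\tilde{\tilde S}_t,\eta_t)$ converges as $t\to\infty$. The functions $g^\theta$ and $\mathrm{he}^\theta$. For $h=(x,z,s,\tilde s,\tilde{\tilde s},\eta)$ let $e=f(x,z,\eta)-\langle\lambda(B),s\rangle-\lambda(c)$; let $D^\theta(h)\in\mathbb{R}^{d_\theta}$ have $\diamondsuit$-entry $\sum_k\lambda(B^k)\tilde s^{\diamondsuit,k}$ for $\diamondsuit$ an entry of $A$ or $W$, $B^k$-entry $\lambda'(B^k)s^k$, $c$-entry $\lambda'(c)$; let $K^\theta(h)$ be the symmetric $d_\theta\times d_\theta$ matrix with $(\diamondsuit,\heartsuit)$-entry $\sum_k\lambda(B^k)\tilde{\tilde s}^{\diamondsuit,\heartsuit,k}$ for $\diamondsuit,\heartsuit$ entries of $A$ or $W$, $(B^k,\diamondsuit)$-entry $\lambda'(B^k)\tilde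 s^{\diamondsuit,k}$, $(B^k,B^k)$-entry $\lambda''(B^k)s^k$, $(c,c)$-entry $\lambda''(c)$, all other entries $0$. Then $g^\theta(h)=-e\,D^\theta(h)$ and $\mathrm{he}^\theta(h)=D^\theta(h)D^\theta(h)^\top-e\,K^\theta(h)$. *)

theory Defs
  imports "HOL-Probability.Probability"
begin

text \<open>
  The norm \<open>\<parallel>\<cdot>\<parallel>\<^bsub>max\<^esub>\<close> is the library's \<^const>\<open>infnorm\<close>: on nested products of \<open>real\<close> and \<open>real ^ 'n\<close>
  the standard basis consists of the coordinate vectors, so it is the largest absolute value of an
  entry. The dimensions \<open>d\<close>, \<open>d\<^sub>Z\<close>, \<open>N\<close> are \<open>CARD('d)\<close>, \<open>CARD('z)\<close>, \<open>CARD('n)\<close>.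
\<close>

section \<open>Wasserstein distance, weak convergence, Markov chains\<close>

definition couplings :: "'a measure \<Rightarrow> 'a measure \<Rightarrow> ('a \<times> 'a) measure set" where
  "couplings P Q =
     {\<pi>. sets \<pi> = sets (P \<Otimes>\<^sub>M Q) \<and> distr \<pi> P fst = P \<and> distr \<pi> Q snd = Q}"

definition wass2 :: "'a::euclidean_space measure \<Rightarrow> 'a measure \<Rightarrow> ennreal" where
  "wass2 P Q =
     (let c = (INF \<pi>\<in>couplings P Q. \<integral>\<^sup>+ p. ennreal ((infnorm (fst p - snd p))\<^sup>2) \<partial>\<pi>)
      in if c = top then top else ennreal (sqrt (enn2real c)))"

definition weakly_converges :: "(nat \<Rightarrow> 'a::topological_space measure) \<Rightarrow> 'a measure \<Rightarrow> bool" where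
  "weakly_converges P Q \<longleftrightarrow>
     (\<forall>g::'a \<Rightarrow> real. continuous_on UNIV g \<and> bounded (range g) \<longrightarrow>
        (\<lambda>t. \<integral>x. g x \<partial>P t) \<longlonglongrightarrow> (\<integral>x. g x \<partial>Q))"

definition past :: "'w measure \<Rightarrow> (nat \<Rightarrow> 'w \<Rightarrow> 'a::topological_space) \<Rightarrow> nat \<Rightarrow> 'w measure" where
  "past M V t = sigma (space M) {V i -` A \<inter> space M |i A. i \<le> t \<and> A \<in> sets borel}"

definition markov_chain ::
  "'w measure \<Rightarrow> (nat \<Rightarrow> 'w \<Rightarrow> 'a::topological_space) \<Rightarrow> ('a \<Rightarrow> 'a measure) \<Rightarrow> bool" where
  "markov_chain M V \<kappa> \<longleftrightarrow>
     (\<forall>t. V t \<in> borel_measurable M) \<and>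
     \<kappa> \<in> borel \<rightarrow>\<^sub>M prob_algebra borel \<and>
     (\<forall>t. \<forall>A\<in>sets borel.
        AE \<omega> in M. real_cond_exp M (past M V t) (\<lambda>\<omega>. indicator A (V (Suc t) \<omega>)) \<omega>
                   = measure (\<kappa> (V t \<omega>)) A)"

section \<open>Data assumption\<close>

text \<open>
  The bound on the chain is only required almost surely. The explicit \<open>0 \<le> Lp\<close> is implied by the
  Lipschitz condition read in the reals; it is needed because \<^const>\<open>ennreal\<close> truncates at \<open>0\<close>.
\<close>

definition data_assumption ::
  "'w measure \<Rightarrow> (nat \<Rightarrow> 'w \<Rightarrow> real^'d) \<Rightarrow> (nat \<Rightarrow> 'w \<Rightarrow> real^'z) \<Rightarrow> (nat \<Rightarrow> 'w \<Rightarrow> real) \<Rightarrow>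
   ((real^'d) \<times> (real^'z) \<Rightarrow> ((real^'d) \<times> (real^'z)) measure) \<Rightarrow> real measure \<Rightarrow>
   (real^'d \<Rightarrow> real^'z \<Rightarrow> real \<Rightarrow> real) \<Rightarrow> real \<Rightarrow> real \<Rightarrow> bool" where
  "data_assumption M X Z \<eta> \<kappa> \<mu>\<eta> f Lp Lf \<longleftrightarrow>
     prob_space M \<and>
     markov_chain M (\<lambda>t \<omega>. (X t \<omega>, Z t \<omega>)) \<kappa> \<and>
     prob_space.indep_vars M (\<lambda>_. borel) \<eta> UNIV \<and>
     (\<forall>t. distr M borel (\<eta> t) = \<mu>\<eta>) \<and>
     prob_space.indep_set M
       (sets (vimage_algebra (space M) (\<lambda>\<omega> t. (X t \<omega>, Z t \<omega>)) (\<Pi>\<^sub>M t\<in>UNIV. borel)))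
       (sets (vimage_algebra (space M) (\<lambda>\<omega> t. \<eta> t \<omega>) (\<Pi>\<^sub>M t\<in>UNIV. borel))) \<and>
     0 \<le> Lp \<and> Lp < 1 \<and>
     (\<forall>w w'. wass2 (\<kappa> w) (\<kappa> w') \<le> ennreal (Lp * infnorm (w - w'))) \<and>
     (\<forall>x z y x' z' y'. \<bar>f x z y - f x' z' y'\<bar> \<le> Lf * infnorm ((x, z, y) - (x', z', y'))) \<and>
     (\<forall>t. AE \<omega> in M. infnorm (X t \<omega>, Z t \<omega>) \<le> 1) \<and>
     (\<forall>x z y. \<bar>f x z y\<bar> \<le> Lf)"

section \<open>Smallness assumption\<close>

text \<open>\<open>C0\<close>, \<open>C1\<close>, \<open>C2\<close> stand for \<open>C\<^sub>\<phi>\<close>, \<open>C\<^bsub>\<phi>'\<^esub>\<close>, \<open>C\<^bsub>\<phi>''\<^esub>\<close>.\<close>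

definition M_phi :: "real \<Rightarrow> real" where
  "M_phi C0 = 1 + C0 / (4 - C0)"

definition small_L0 :: "nat \<Rightarrow> nat \<Rightarrow> real \<Rightarrow> real \<Rightarrow> real" where
  "small_L0 N d C0 C1 =
     max (3 * C1 / real (min N d) * (C0 * M_phi C0 / 10 + 1/4)) (3 * C0 / 4)"

definition small_L2 :: "nat \<Rightarrow> nat \<Rightarrow> real \<Rightarrow> real \<Rightarrow> real \<Rightarrow> real" where
  "small_L2 N d C0 C1 C2 =
     max (C2 / real (min N d)) (C1\<^sup>2 / (real N * real d * (4 - C0)))"

definition small_T1 :: "nat \<Rightarrow> nat \<Rightarrow> real \<Rightarrow> real \<Rightarrow> real \<Rightarrow> real" where
  "small_T1 N d C0 C1 C2 =
     (let m = real (min N d); L2 = small_L2 N d C0 C1 C2 in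
        M_phi C0 * C1\<^sup>2 / (5 * m\<^sup>2)
      + C0 * (M_phi C0)\<^sup>2 * C1\<^sup>2 / (8 * m\<^sup>2)
      + C2 / (4 * m)
      + C0 / 10 * (L2 + C0 / (1 - C0 / 4) * (C1\<^sup>2 * (M_phi C0)\<^sup>2 / (10 * m\<^sup>2) + 1/4 * L2)))"

definition small_T2 :: "nat \<Rightarrow> nat \<Rightarrow> real \<Rightarrow> real \<Rightarrow> real" where
  "small_T2 N d C0 C1 =
     C0 * M_phi C0 * C1 / (5 * real (min N d)) + C1 / (4 * real N)"

definition small_L1 :: "nat \<Rightarrow> nat \<Rightarrow> real \<Rightarrow> real \<Rightarrow> real \<Rightarrow> real" where
  "small_L1 N d C0 C1 C2 =
     Max {4 * small_T1 N d C0 C1 C2, 4 * small_T2 N d C0 C1, C0}"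

definition small_Lbar :: "nat \<Rightarrow> nat \<Rightarrow> real \<Rightarrow> real \<Rightarrow> real \<Rightarrow> real" where
  "small_Lbar N d C0 C1 C2 = max (small_L0 N d C0 C1) (small_L1 N d C0 C1 C2)"

definition smallness_assumption ::
  "nat \<Rightarrow> nat \<Rightarrow> real \<Rightarrow> real \<Rightarrow> real \<Rightarrow> real \<Rightarrow> bool" where
  "smallness_assumption N d C0 C1 C2 Lp \<longleftrightarrow>
     C0 < 4 \<and>
     0 < sqrt ((small_Lbar N d C0 C1 C2)\<^sup>2 + Lp\<^sup>2) \<and>
     sqrt ((small_Lbar N d C0 C1 C2)\<^sup>2 + Lp\<^sup>2) < 1"

section \<open>Parameters and differential operators\<close>

text \<open>
  Entries of \<open>A\<close> and \<open>W\<close>, and then all coordinates of \<open>\<theta> = (A, W, B, c)\<close>; the parameter space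
  \<open>\<Theta> = \<real>\<^bsup>d\<^sub>\<theta>\<^esup>\<close> is \<open>real ^ ('d, 'n) coord\<close>.
\<close>

datatype ('d, 'n) entry = EntA 'n 'd | EntW 'n 'n

datatype ('d, 'n) coord = Rec "('d, 'n) entry" | CoB 'n | CoC

instance entry :: (finite, finite) finite
proof
  have "(UNIV :: ('a, 'b) entry set) = range (\<lambda>(k, j). EntA k j) \<union> range (\<lambda>(k, j). EntW k j)"
    by (auto simp: image_iff) (metis entry.exhaust)
  then show "finite (UNIV :: ('a, 'b) entry set)"
    by (metis finite_Un finite_class.finite_UNIV finite_imageI)
qed

instance coord :: (finite, finite) finite
proof
  have "(UNIV :: ('a, 'b) coord set) = range Rec \<union> range CoB \<union> {CoC}"
    by (auto simp: image_iff) (metis coord.exhaust)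
  then show "finite (UNIV :: ('a, 'b) coord set)"
    by (metis finite_Un finite_class.finite_UNIV finite_imageI finite.emptyI finite_insert)
qed

type_synonym ('d, 'n) param = "real ^ ('d, 'n) coord"

abbreviation parA :: "('d::finite, 'n::finite) param \<Rightarrow> 'n \<Rightarrow> 'd \<Rightarrow> real" where
  "parA \<theta> k j \<equiv> \<theta> $ Rec (EntA k j)"

abbreviation parW :: "('d::finite, 'n::finite) param \<Rightarrow> 'n \<Rightarrow> 'n \<Rightarrow> real" where
  "parW \<theta> k j \<equiv> \<theta> $ Rec (EntW k j)"

abbreviation parB :: "('d::finite, 'n::finite) param \<Rightarrow> 'n \<Rightarrow> real" where
  "parB \<theta> k \<equiv> \<theta> $ CoB k"

abbreviation parC :: "('d::finite, 'n::finite) param \<Rightarrow> real" where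
  "parC \<theta> \<equiv> \<theta> $ CoC"

definition partial :: "'i \<Rightarrow> (real^'i \<Rightarrow> real) \<Rightarrow> real^'i \<Rightarrow> real" where
  "partial i F \<theta> = deriv (\<lambda>r. F (\<theta> + r *\<^sub>R axis i 1)) 0"

definition grad :: "(real^'i \<Rightarrow> real) \<Rightarrow> real^'i \<Rightarrow> real^'i" where
  "grad F \<theta> = (\<chi> i. partial i F \<theta>)"

definition hess :: "(real^'i \<Rightarrow> real) \<Rightarrow> real^'i \<Rightarrow> real^'i^'i" where
  "hess F \<theta> = (\<chi> i j. partial i (partial j F) \<theta>)"

definition smooth_bounded :: "(real \<Rightarrow> real) \<Rightarrow> bool" where
  "smooth_bounded u \<longleftrightarrow>
     (\<forall>n. (\<forall>y. (deriv ^^ n) u differentiable (at y)) \<and> bounded (range ((deriv ^^ n) u)))"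

section \<open>The network\<close>

definition sigmoid :: "real \<Rightarrow> real" where
  "sigmoid y = 1 / (1 + exp (- y))"

definition preact ::
  "(real \<Rightarrow> real) \<Rightarrow> ('d::finite, 'n::finite) param \<Rightarrow> real^'d \<Rightarrow> real^'n \<Rightarrow> 'n \<Rightarrow> real" where
  "preact \<phi> \<theta> x s k =
     1 / real CARD('d) * (\<Sum>j\<in>UNIV. \<phi> (parA \<theta> k j) * x $ j)
   + 1 / real CARD('n) * (\<Sum>j\<in>UNIV. \<phi> (parW \<theta> k j) * s $ j)"

primrec hidden ::
  "(real \<Rightarrow> real) \<Rightarrow> (nat \<Rightarrow> real^'d) \<Rightarrow> nat \<Rightarrow> ('d::finite, 'n::finite) param \<Rightarrow> real^'n" where
  "hidden \<phi> x 0 \<theta> = 0"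
| "hidden \<phi> x (Suc t) \<theta> = (\<chi> k. sigmoid (preact \<phi> \<theta> (x t) (hidden \<phi> x t \<theta>) k))"

definition readout ::
  "(real \<Rightarrow> real) \<Rightarrow> ('d::finite, 'n::finite) param \<Rightarrow> real^'n \<Rightarrow> real" where
  "readout lam \<theta> s = (\<Sum>k\<in>UNIV. lam (parB \<theta> k) * s $ k) + lam (parC \<theta>)"

definition loss ::
  "(real^'d \<Rightarrow> real^'z \<Rightarrow> real \<Rightarrow> real) \<Rightarrow> (real \<Rightarrow> real) \<Rightarrow> (real \<Rightarrow> real) \<Rightarrow>
   (nat \<Rightarrow> 'w \<Rightarrow> real^'d) \<Rightarrow> (nat \<Rightarrow> 'w \<Rightarrow> real^'z) \<Rightarrow> (nat \<Rightarrow> 'w \<Rightarrow> real) \<Rightarrow>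
   nat \<Rightarrow> ('d::finite, 'n::finite) param \<Rightarrow> 'w \<Rightarrow> real" where
  "loss f \<phi> lam X Z \<eta> T \<theta> \<omega> =
     1 / (2 * real T) *
     (\<Sum>t=1..T. (f (X t \<omega>) (Z t \<omega>) (\<eta> t \<omega>) - readout lam \<theta> (hidden \<phi> (\<lambda>i. X i \<omega>) t \<theta>))\<^sup>2)"

section \<open>The joint process and its stationary law\<close>

type_synonym ('d, 'z, 'n) jstate =
  "(real^'d) \<times> (real^'z) \<times> (real^'n) \<times> (real^'n^('d, 'n) entry) \<times>
   (real^'n^('d, 'n) entry^('d, 'n) entry) \<times> real"

definition joint ::
  "(real \<Rightarrow> real) \<Rightarrow>
   (nat \<Rightarrow> 'w \<Rightarrow> real^'d) \<Rightarrow> (nat \<Rightarrow> 'w \<Rightarrow> real^'z) \<Rightarrow> (nat \<Rightarrow> 'w \<Rightarrow> real) \<Rightarrow>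
   ('d::finite, 'n::finite) param \<Rightarrow> nat \<Rightarrow> 'w \<Rightarrow> ('d, 'z::finite, 'n) jstate" where
  "joint \<phi> X Z \<eta> \<theta> t \<omega> =
     (let S = (\<lambda>k p. hidden \<phi> (\<lambda>i. X i \<omega>) t p $ k) in
      (X t \<omega>, Z t \<omega>, \<chi> k. S k \<theta>,
       \<chi> a k. partial (Rec a) (S k) \<theta>,
       \<chi> a b k. partial (Rec a) (partial (Rec b) (S k)) \<theta>,
       \<eta> t \<omega>))"

text \<open>
  \<open>dpreact\<close> and \<open>ddpreact\<close> are the first and second derivatives of \<open>preact\<close> along entries \<open>a\<close>, \<open>b\<close> of
  \<open>A\<close>, \<open>W\<close>, when the hidden state has value \<open>s\<close>, first derivatives \<open>s1\<close> and second derivatives \<open>s2\<close>.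
  By the chain rule, differentiating the recursion for \<open>S\<close> therefore yields the transition below.
\<close>

definition dpreact ::
  "(real \<Rightarrow> real) \<Rightarrow> ('d::finite, 'n::finite) param \<Rightarrow> real^'d \<Rightarrow> real^'n \<Rightarrow>
   real^'n^('d, 'n) entry \<Rightarrow> ('d, 'n) entry \<Rightarrow> 'n \<Rightarrow> real" where
  "dpreact \<phi> \<theta> x s s1 a k =
     (case a of
        EntA i j \<Rightarrow> if i = k then 1 / real CARD('d) * deriv \<phi> (parA \<theta> k j) * x $ j else 0
      | EntW i j \<Rightarrow> if i = k then 1 / real CARD('n) * deriv \<phi> (parW \<theta> k j) * s $ j else 0)
   + 1 / real CARD('n) * (\<Sum>l\<in>UNIV. \<phi> (parW \<theta> k l) * s1 $ a $ l)"

definition ddpreact ::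
  "(real \<Rightarrow> real) \<Rightarrow> ('d::finite, 'n::finite) param \<Rightarrow> real^'d \<Rightarrow> real^'n \<Rightarrow>
   real^'n^('d, 'n) entry \<Rightarrow> real^'n^('d, 'n) entry^('d, 'n) entry \<Rightarrow>
   ('d, 'n) entry \<Rightarrow> ('d, 'n) entry \<Rightarrow> 'n \<Rightarrow> real" where
  "ddpreact \<phi> \<theta> x s s1 s2 a b k =
     (if a = b then
        (case a of
           EntA i j \<Rightarrow> if i = k then 1 / real CARD('d) * deriv (deriv \<phi>) (parA \<theta> k j) * x $ j else 0
         | EntW i j \<Rightarrow> if i = k then 1 / real CARD('n) * deriv (deriv \<phi>) (parW \<theta> k j) * s $ j else 0)
      else 0)
   + (case a of
        EntA i j \<Rightarrow> 0
      | EntW i j \<Rightarrow> if i = k then 1 / real CARD('n) * deriv \<phi> (parW \<theta> k j) * s1 $ b $ j else 0)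
   + (case b of
        EntA i j \<Rightarrow> 0
      | EntW i j \<Rightarrow> if i = k then 1 / real CARD('n) * deriv \<phi> (parW \<theta> k j) * s1 $ a $ j else 0)
   + 1 / real CARD('n) * (\<Sum>l\<in>UNIV. \<phi> (parW \<theta> k l) * s2 $ a $ b $ l)"

definition joint_kernel ::
  "((real^'d) \<times> (real^'z) \<Rightarrow> ((real^'d) \<times> (real^'z)) measure) \<Rightarrow> real measure \<Rightarrow> (real \<Rightarrow> real) \<Rightarrow>
   ('d::finite, 'n::finite) param \<Rightarrow> ('d, 'z::finite, 'n) jstate \<Rightarrow> ('d, 'z, 'n) jstate measure" where
  "joint_kernel \<kappa> \<mu>\<eta> \<phi> \<theta> = (\<lambda>(x, z, s, s1, s2, y).
     distr (\<kappa> (x, z) \<Otimes>\<^sub>M \<mu>\<eta>) borel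
       (\<lambda>((x', z'), y').
          (x', z',
           \<chi> k. sigmoid (preact \<phi> \<theta> x s k),
           \<chi> a k. deriv sigmoid (preact \<phi> \<theta> x s k) * dpreact \<phi> \<theta> x s s1 a k,
           \<chi> a b k. deriv (deriv sigmoid) (preact \<phi> \<theta> x s k)
                      * dpreact \<phi> \<theta> x s s1 a k * dpreact \<phi> \<theta> x s s1 b k
                    + deriv sigmoid (preact \<phi> \<theta> x s k) * ddpreact \<phi> \<theta> x s s1 s2 a b k,
           y')))"

definition is_stationary_law ::
  "'w measure \<Rightarrow> (nat \<Rightarrow> 'w \<Rightarrow> real^'d) \<Rightarrow> (nat \<Rightarrow> 'w \<Rightarrow> real^'z) \<Rightarrow> (nat \<Rightarrow> 'w \<Rightarrow> real) \<Rightarrow>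
   ((real^'d) \<times> (real^'z) \<Rightarrow> ((real^'d) \<times> (real^'z)) measure) \<Rightarrow> real measure \<Rightarrow> (real \<Rightarrow> real) \<Rightarrow>
   ('d::finite, 'n::finite) param \<Rightarrow> ('d, 'z::finite, 'n) jstate measure \<Rightarrow> bool" where
  "is_stationary_law M X Z \<eta> \<kappa> \<mu>\<eta> \<phi> \<theta> \<mu> \<longleftrightarrow>
     prob_space \<mu> \<and> sets \<mu> = sets borel \<and>
     (\<forall>E\<in>sets borel. emeasure \<mu> E = (\<integral>\<^sup>+ h. emeasure (joint_kernel \<kappa> \<mu>\<eta> \<phi> \<theta> h) E \<partial>\<mu>)) \<and>
     weakly_converges (\<lambda>t. distr M borel (joint \<phi> X Z \<eta> \<theta> t)) \<mu>"

definition stationary_law ::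
  "'w measure \<Rightarrow> (nat \<Rightarrow> 'w \<Rightarrow> real^'d) \<Rightarrow> (nat \<Rightarrow> 'w \<Rightarrow> real^'z) \<Rightarrow> (nat \<Rightarrow> 'w \<Rightarrow> real) \<Rightarrow>
   ((real^'d) \<times> (real^'z) \<Rightarrow> ((real^'d) \<times> (real^'z)) measure) \<Rightarrow> real measure \<Rightarrow> (real \<Rightarrow> real) \<Rightarrow>
   ('d::finite, 'n::finite) param \<Rightarrow> ('d, 'z::finite, 'n) jstate measure" where
  "stationary_law M X Z \<eta> \<kappa> \<mu>\<eta> \<phi> \<theta> = (THE \<mu>. is_stationary_law M X Z \<eta> \<kappa> \<mu>\<eta> \<phi> \<theta> \<mu>)"

section \<open>The functions \<open>g\<^sup>\<theta>\<close> and \<open>he\<^sup>\<theta>\<close>\<close>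

definition err_fun ::
  "(real^'d \<Rightarrow> real^'z \<Rightarrow> real \<Rightarrow> real) \<Rightarrow> (real \<Rightarrow> real) \<Rightarrow>
   ('d::finite, 'n::finite) param \<Rightarrow> ('d, 'z::finite, 'n) jstate \<Rightarrow> real" where
  "err_fun f lam \<theta> = (\<lambda>(x, z, s, s1, s2, y). f x z y - (\<Sum>k\<in>UNIV. lam (parB \<theta> k) * s $ k) - lam (parC \<theta>))"

definition D_fun ::
  "(real \<Rightarrow> real) \<Rightarrow> ('d::finite, 'n::finite) param \<Rightarrow> ('d, 'z::finite, 'n) jstate \<Rightarrow>
   ('d, 'n) param" where
  "D_fun lam \<theta> = (\<lambda>(x, z, s, s1, s2, y). \<chi> i.
     (case i of
        Rec a \<Rightarrow> (\<Sum>k\<in>UNIV. lam (parB \<theta> k) * s1 $ a $ k)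
      | CoB k \<Rightarrow> deriv lam (parB \<theta> k) * s $ k
      | CoC \<Rightarrow> deriv lam (parC \<theta>)))"

definition K_fun ::
  "(real \<Rightarrow> real) \<Rightarrow> ('d::finite, 'n::finite) param \<Rightarrow> ('d, 'z::finite, 'n) jstate \<Rightarrow>
   real ^ ('d, 'n) coord ^ ('d, 'n) coord" where
  "K_fun lam \<theta> = (\<lambda>(x, z, s, s1, s2, y). \<chi> i j.
     (case (i, j) of
        (Rec a, Rec b) \<Rightarrow> (\<Sum>k\<in>UNIV. lam (parB \<theta> k) * s2 $ a $ b $ k)
      | (CoB k, Rec a) \<Rightarrow> deriv lam (parB \<theta> k) * s1 $ a $ k
      | (Rec a, CoB k) \<Rightarrow> deriv lam (parB \<theta> k) * s1 $ a $ k
      | (CoB k, CoB l) \<Rightarrow> if k = l then deriv (deriv lam) (parB \<theta> k) * s $ k else 0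
      | (CoC, CoC) \<Rightarrow> deriv (deriv lam) (parC \<theta>)
      | _ \<Rightarrow> 0))"

definition g_fun ::
  "(real^'d \<Rightarrow> real^'z \<Rightarrow> real \<Rightarrow> real) \<Rightarrow> (real \<Rightarrow> real) \<Rightarrow>
   ('d::finite, 'n::finite) param \<Rightarrow> ('d, 'z::finite, 'n) jstate \<Rightarrow> ('d, 'n) param" where
  "g_fun f lam \<theta> h = (- err_fun f lam \<theta> h) *\<^sub>R D_fun lam \<theta> h"

definition he_fun ::
  "(real^'d \<Rightarrow> real^'z \<Rightarrow> real \<Rightarrow> real) \<Rightarrow> (real \<Rightarrow> real) \<Rightarrow>
   ('d::finite, 'n::finite) param \<Rightarrow> ('d, 'z::finite, 'n) jstate \<Rightarrow>
   real ^ ('d, 'n) coord ^ ('d, 'n) coord" where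
  "he_fun f lam \<theta> h =
     (\<chi> i j. D_fun lam \<theta> h $ i * D_fun lam \<theta> h $ j) - err_fun f lam \<theta> h *\<^sub>R K_fun lam \<theta> h"

end

theory Submission
  imports Defs
begin

text \<open>
  Differentiating the recursion for the hidden state once and twice shows that the triple
  \<open>u = (S, S', S'')\<close> of the state and its first two parameter derivatives is itself driven by the
  data, \<open>u\<^bsub>t+1\<^esub> = F(X\<^sub>t, u\<^sub>t)\<close>. The map \<open>F\<close> is block triangular in \<open>u\<close>, and every diagonal block
  contracts by the factor \<open>C\<^sub>\<phi>/4 < 1\<close> because \<open>\<sigma>' \<le> 1/4\<close>. In a suitably weighted distance \<open>F\<close> is
  therefore a contraction on a bounded invariant region, uniformly in the parameter. Together with
  the Wasserstein contraction of the data kernel, the joint transition operator contracts Lipschitz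
  seminorms, so expectations of Lipschitz observables converge geometrically, at a rate that does
  not depend on \<open>\<theta>\<close>. The limiting functional is a measure by weak compactness on bounded sets, and
  it is stationary because the joint kernel has the Feller property.

  The gradient and Hessian of the expected loss are Cesaro means of expectations of \<open>g\<^sup>\<theta>\<close> and
  \<open>he\<^sup>\<theta>\<close>. They converge uniformly in \<open>\<theta>\<close>, which allows the limit to be exchanged with
  differentiation.
\<close>

section \<open>Weak compactness on bounded sets\<close>

text \<open>Contraction is proved for the operator acting on observables, not for laws: a bound on
  \<open>wass2\<close> is used only through differences of integrals, so no coupling has to be
  chosen measurably in the starting point. The parameter space is not compact. Every constant must
  therefore come from the bounds on \<open>\<phi>\<close>, \<open>lam\<close> and their derivatives
  alone; the predicate \<open>ubl\<close> records that such bounds and Lipschitz constants exist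
  without computing them. The observables for gradient and Hessian are controlled only while the
  network state lies in the invariant region, and the recursion contracts globally only for clamped
  inputs. Both modifications agree almost surely with the original objects along the trajectory.
  Derivatives are taken inside expectations, so exceptional null sets must not depend on \<theta>;
  the pathwise bounds are stated for all parameters at once. The noise at time t is independent of
  the data and does not enter the recursion. It is integrated out first and does not affect the
  rate.\<close>

lemma ternary_series_digits_eq:
  fixes b b' :: "nat \<Rightarrow> real"
  assumes b: "\<And>m. b m \<in> {0, 1}" and b': "\<And>m. b' m \<in> {0, 1}"
    and close: "\<bar>(\<Sum>m. b m * (1/3) ^ m) - (\<Sum>m. b' m * (1/3) ^ m)\<bar> < 1/2 * (1/3) ^ k"
    and "m \<le> k"
  shows "b m = b' m"
proof (rule ccontr)
  assume ne: "b m \<noteq> b' m"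
  define d where "d m = b m - b' m" for m
  \<comment> \<open>At the first differing digit the sums part by \<open>(1/3) ^ m0\<close>, and the
    later digits can recover at most half of that, the tail of the geometric series. In base 2 the
    tail could cancel the leading term, which is why binary digits are read in base 3.\<close>
  define m0 where "m0 = (LEAST m. d m \<noteq> 0)"
  have dm: "d m \<noteq> 0" using ne by (simp add: d_def)
  have m0: "d m0 \<noteq> 0" "m0 \<le> m"
    unfolding m0_def using LeastI[of "\<lambda>m. d m \<noteq> 0", OF dm] Least_le[of "\<lambda>m. d m \<noteq> 0", OF dm] by auto
  have lt: "d i = 0" if "i < m0" for i
    using that not_less_Least unfolding m0_def by blast
  have dle: "\<bar>d i\<bar> \<le> 1" for i
    using b[of i] b'[of i] by (auto simp: d_def)
  have d0: "\<bar>d m0\<bar> = 1"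
    using m0(1) b[of m0] b'[of m0] by (auto simp: d_def)
  have geo: "summable (\<lambda>i. (1/3::real) ^ i)" by (simp add: summable_geometric)
  have summ: "summable (\<lambda>i. a i * (1/3::real) ^ i)" if "\<And>i. \<bar>a i\<bar> \<le> 1" for a :: "nat \<Rightarrow> real"
    by (rule summable_comparison_test'[OF geo, of 0]) (use that in \<open>auto simp: abs_mult intro!: mult_left_le_one_le\<close>)
  have sb: "summable (\<lambda>i. b i * (1/3::real) ^ i)" "summable (\<lambda>i. b' i * (1/3::real) ^ i)"
    using b b' by (auto intro!: summ) (metis abs_0 abs_1 insertE order_refl singletonD zero_le_one)+
  have sd: "summable (\<lambda>i. d i * (1/3::real) ^ i)" by (rule summ[OF dle])
  have eq: "(\<Sum>m. b m * (1/3) ^ m) - (\<Sum>m. b' m * (1/3) ^ m) = (\<Sum>m. d m * (1/3) ^ m)"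
    by (simp add: suminf_diff[OF sb] d_def left_diff_distrib)
  have "(\<Sum>m. d m * (1/3) ^ m) = (\<Sum>i. d (i + Suc m0) * (1/3) ^ (i + Suc m0)) + (\<Sum>i<Suc m0. d i * (1/3)^i)"
    by (rule suminf_split_initial_segment[OF sd])
  also have "(\<Sum>i<Suc m0. d i * (1/3)^i) = d m0 * (1/3) ^ m0"
    using lt by simp
  finally have split: "(\<Sum>m. d m * (1/3) ^ m)
      = (\<Sum>i. d (i + Suc m0) * (1/3) ^ (i + Suc m0)) + d m0 * (1/3) ^ m0" .
  have sd': "summable (\<lambda>i. \<bar>d (i + Suc m0) * (1/3::real) ^ (i + Suc m0)\<bar>)"
    by (rule summable_comparison_test'[where N=0 and g="\<lambda>i. (1/3::real) ^ i * (1/3) ^ Suc m0"])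
      (use dle in \<open>auto simp: abs_mult power_add summable_mult2 geo intro!: mult_left_le_one_le\<close>)
  have "\<bar>\<Sum>i. d (i + Suc m0) * (1/3) ^ (i + Suc m0)\<bar> \<le> (\<Sum>i. \<bar>d (i + Suc m0) * (1/3) ^ (i + Suc m0)\<bar>)"
    by (rule summable_rabs[OF sd'])
  also have "\<dots> \<le> (\<Sum>i. (1/3::real) ^ i * (1/3) ^ Suc m0)"
    by (intro suminf_le sd' summable_mult2 geo)
      (use dle in \<open>auto simp: abs_mult power_add intro!: mult_left_le_one_le\<close>)
  also have "\<dots> = 1/2 * (1/3) ^ m0"
    using suminf_mult2[OF geo, of "(1/3) ^ Suc m0"] suminf_geometric[of "1/3::real"] by simp
  finally have "\<bar>\<Sum>i. d (i + Suc m0) * (1/3) ^ (i + Suc m0)\<bar> \<le> 1/2 * (1/3) ^ m0" .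
  moreover have "\<bar>d m0 * (1/3) ^ m0\<bar> = (1/3::real) ^ m0" using d0 by (simp add: abs_mult)
  ultimately have "1/2 * (1/3) ^ m0 \<le> \<bar>\<Sum>m. d m * (1/3) ^ m\<bar>"
    using split by linarith
  moreover have "(1/3::real) ^ k \<le> (1/3) ^ m0"
    using m0(2) \<open>m \<le> k\<close> by (intro power_decreasing) auto
  ultimately show False using close unfolding eq by linarith
qed

lemma floor_binary_digits:
  fixes y y' :: real
  assumes "\<lfloor>y\<rfloor> = \<lfloor>y'\<rfloor>"
    and "\<And>j. j < J \<Longrightarrow> \<lfloor>2 ^ Suc j * y\<rfloor> mod 2 = \<lfloor>2 ^ Suc j * y'\<rfloor> mod 2"
  shows "\<lfloor>2 ^ J * y\<rfloor> = \<lfloor>2 ^ J * y'\<rfloor>"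
  using assms(2)
proof (induction J)
  case 0 then show ?case using assms(1) by simp
next
  case (Suc J)
  \<comment> \<open>The integer part of \<open>2 ^ J * y\<close> is the quotient by 2 of the next
    one, and the remainder is the known digit.\<close>
  have half: "\<lfloor>2 * a\<rfloor> div 2 = \<lfloor>a\<rfloor>" for a :: real
    by (simp add: floor_divide_real_eq_div[symmetric])
  have "\<lfloor>2 ^ J * y\<rfloor> = \<lfloor>2 ^ J * y'\<rfloor>" by (rule Suc.IH) (use Suc.prems in simp)
  then have "\<lfloor>2 ^ Suc J * y\<rfloor> div 2 = \<lfloor>2 ^ Suc J * y'\<rfloor> div 2"
    using half[of "2 ^ J * y"] half[of "2 ^ J * y'"] by (simp add: mult.assoc)
  then show ?case using Suc.prems[of J] by (metis div_mult_mod_eq lessI)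
qed

text \<open>Coding vectors by ternary expansions lets Helly's theorem on the line replace Prokhorov's theorem.\<close>

lemma real_coding_of_bounded_set:
  fixes R :: real
  assumes "R \<ge> 0"
  obtains c :: "'a::euclidean_space \<Rightarrow> real" and p :: "real \<Rightarrow> 'a"
  where "c \<in> borel_measurable borel" "\<And>x. 0 \<le> c x \<and> c x \<le> 2"
    "continuous_on UNIV p" "\<And>x. norm x \<le> R \<Longrightarrow> p (c x) = x"
proof -
  define n where "n = card (Basis :: 'a set)"
  have n: "n > 0" by (simp add: n_def)
  obtain e :: "nat \<Rightarrow> 'a" where e: "bij_betw e {0..<n} Basis"
    using ex_bij_betw_nat_finite[OF finite_Basis] unfolding n_def by blast
  \<comment> \<open>An affine chart sending the ball into \<open>[0, 1)\<close>; the denominator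
    \<open>2 * R + 1\<close> keeps values below 1 and is positive even for
    \<open>R = 0\<close>.\<close>
  define w where "w x i = (x \<bullet> i + R) / (2 * R + 1)" for x i :: 'a
  \<comment> \<open>Coordinates are interleaved: index \<open>m\<close> carries binary digit number
    \<open>m div n\<close> of coordinate \<open>e (m mod n)\<close>. Reduction modulo 2 keeps the
    digits in {0, 1} outside the ball too, so \<open>c\<close> is bounded everywhere.\<close>
  define dig :: "'a \<Rightarrow> nat \<Rightarrow> real" where
    "dig x m = of_int (\<lfloor>2 ^ Suc (m div n) * w x (e (m mod n))\<rfloor> mod 2)" for x m
  define c where "c x = (\<Sum>m. dig x m * (1/3) ^ m)" for x
  have dig01: "dig x m \<in> {0, 1}" for x m unfolding dig_def by auto
  have [measurable]: "(\<lambda>x. dig x m) \<in> borel_measurable borel" for m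
  proof -
    have "(\<lambda>k::int. real_of_int (k mod 2)) \<in> count_space UNIV \<rightarrow>\<^sub>M borel" by simp
    moreover have "(\<lambda>x::'a. \<lfloor>2 ^ Suc (m div n) * w x (e (m mod n))\<rfloor>) \<in> borel \<rightarrow>\<^sub>M count_space UNIV"
      unfolding w_def by measurable
    ultimately show ?thesis unfolding dig_def by measurable
  qed
  have cm: "c \<in> borel_measurable borel" unfolding c_def by measurable
  have geo: "summable (\<lambda>i. (1/3::real) ^ i)" by (simp add: summable_geometric)
  have sm: "summable (\<lambda>m. dig x m * (1/3) ^ m)" for x
    by (rule summable_comparison_test'[OF geo, of 0])
      (use dig01[of x] in \<open>auto simp: abs_mult\<close>, metis (no_types, lifting) abs_0 abs_1 insertE mult_left_le_one_le
        order_refl singletonD zero_le_divide_1_iff zero_le_numeral zero_le_one zero_le_power abs_ge_zero)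
  have c0: "0 \<le> c x" for x
    unfolding c_def
  proof (rule suminf_nonneg[OF sm])
    show "0 \<le> dig x m * (1/3) ^ m" for m using dig01[of x m] by auto
  qed
  have "c x \<le> (\<Sum>m. (1/3) ^ m)" for x
    unfolding c_def by (rule suminf_le[OF _ sm geo])
      (metis dig01 insertE mult.left_neutral mult_zero_left order_refl singletonD zero_le_divide_1_iff zero_le_numeral zero_le_power)
  then have c2: "c x \<le> 2" for x
  proof -
    have "(\<Sum>m. (1/3) ^ m) = (3/2::real)" using suminf_geometric[of "1/3::real"] by simp
    then show ?thesis using \<open>c x \<le> (\<Sum>m. (1/3) ^ m)\<close> by linarith
  qed
  \<comment> \<open>Codes that agree up to index \<open>J * n\<close> share the first
    \<open>J\<close> binary digits of every coordinate, so the integer parts of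
    \<open>2 ^ J * w\<close> coincide.\<close>
  have key: "\<bar>w x i - w x' i\<bar> \<le> (1/2) ^ J"
    if x: "norm x \<le> R" "norm x' \<le> R" and cl: "\<bar>c x - c x'\<bar> < 1/2 * (1/3) ^ (J * n)" and i: "i \<in> Basis" for x x' i J
  proof -
    obtain l where l: "l < n" "e l = i"
      using e i unfolding bij_betw_def by (metis atLeastLessThan_iff imageE)
    have w01: "0 \<le> w y i \<and> w y i < 1" if "norm y \<le> R" for y
      using Basis_le_norm[OF i, of y] that assms unfolding w_def by (auto simp: field_simps)
    have "\<lfloor>2 ^ J * w x i\<rfloor> = \<lfloor>2 ^ J * w x' i\<rfloor>"
    proof (rule floor_binary_digits)
      show "\<lfloor>w x i\<rfloor> = \<lfloor>w x' i\<rfloor>" using floor_unique[of 0 "w x i"] floor_unique[of 0 "w x' i"] w01[OF x(1)] w01[OF x(2)] by simp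
      fix j assume j: "j < J"
      define m where "m = j * n + l"
      have mm: "m div n = j" "m mod n = l" using l n by (auto simp: m_def)
      have "m \<le> J * n"
        using j l unfolding m_def
        by (metis Suc_leI add.commute add_le_cancel_right less_or_eq_imp_le mult_Suc mult_le_mono1 order_trans)
      then have "dig x m = dig x' m"
        using ternary_series_digits_eq[of "dig x" "dig x'" "J * n" m] dig01 cl unfolding c_def by blast
      then show "\<lfloor>2 ^ Suc j * w x i\<rfloor> mod 2 = \<lfloor>2 ^ Suc j * w x' i\<rfloor> mod 2"
        unfolding dig_def mm l(2) by simp
    qed
    then have "\<bar>2 ^ J * w x i - 2 ^ J * w x' i\<bar> \<le> 1" by linarith
    then have "2 ^ J * \<bar>w x i - w x' i\<bar> \<le> 1" by (simp add: abs_mult right_diff_distrib[symmetric])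
    then show ?thesis by (simp add: field_simps power_one_over)
  qed
  define K where "K = {x::'a. norm x \<le> R}"
  have unif: "\<exists>\<delta>>0. \<forall>x\<in>K. \<forall>x'\<in>K. \<bar>c x - c x'\<bar> < \<delta> \<longrightarrow> norm (x - x') < \<epsilon>" if eps: "\<epsilon> > 0" for \<epsilon>
  proof -
    have pos: "(2 * R + 1) * n > 0" using assms n by simp
    obtain J where J: "(1/2::real) ^ J < \<epsilon> / ((2 * R + 1) * n)"
      using real_arch_pow_inv[OF divide_pos_pos[OF eps pos], of "1/2"] by auto
    have "norm (x - x') < \<epsilon>" if "x \<in> K" "x' \<in> K" "\<bar>c x - c x'\<bar> < 1/2 * (1/3) ^ (J * n)" for x x'
    proof -
      have "\<bar>(x - x') \<bullet> i\<bar> \<le> (2 * R + 1) * (1/2) ^ J" if i: "i \<in> Basis" for i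
      proof -
        have "w x i - w x' i = ((x - x') \<bullet> i) / (2 * R + 1)"
          using assms by (simp add: w_def inner_diff_left diff_divide_distrib[symmetric])
        then show ?thesis using key[of x x' J i] i that \<open>x \<in> K\<close> \<open>x' \<in> K\<close> \<open>\<bar>c x - c x'\<bar> < _\<close> assms
          by (simp add: K_def abs_divide divide_le_eq mult.commute)
      qed
      then have "norm (x - x') \<le> (\<Sum>i\<in>(Basis::'a set). (2 * R + 1) * (1/2) ^ J)"
        by (intro order_trans[OF norm_le_l1] sum_mono)
      also have "\<dots> = (2 * R + 1) * n * (1/2) ^ J" by (simp add: n_def)
      also have "\<dots> < \<epsilon>" using J pos by (simp add: less_divide_eq mult.commute)
      finally show ?thesis .
    qed
    then show ?thesis by (intro exI[of _ "1/2 * (1/3) ^ (J * n)"]) auto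
  qed
  have inj: "inj_on c K"
  proof (rule inj_onI, rule ccontr)
    fix x y assume xy: "x \<in> K" "y \<in> K" "c x = c y" "x \<noteq> y"
    have "norm (x - y) > 0" using xy(4) by simp
    from unif[OF this] obtain \<delta> where "\<delta> > 0"
      "\<forall>u\<in>K. \<forall>v\<in>K. \<bar>c u - c v\<bar> < \<delta> \<longrightarrow> norm (u - v) < norm (x - y)"
      by (elim exE conjE) (rule that)
    then show False using xy(1-3) by (metis abs_zero diff_self order_less_irrefl)
  qed
  \<comment> \<open>The code is discontinuous, but its inverse on the image of \<open>K\<close> is
    uniformly continuous. It extends to the closure of the image and then, by Tietze, to the whole
    line.\<close>
  define q where "q = inv_into K c"
  have q: "q (c x) = x" if "x \<in> K" for x unfolding q_def by (rule inv_into_f_f[OF inj that])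
  have "uniformly_continuous_on (c ` K) q"
    unfolding uniformly_continuous_on_def
  proof (intro allI impI)
    fix \<epsilon> :: real assume "\<epsilon> > 0"
    from unif[OF this] obtain \<delta> where "\<delta> > 0"
      "\<forall>x\<in>K. \<forall>x'\<in>K. \<bar>c x - c x'\<bar> < \<delta> \<longrightarrow> norm (x - x') < \<epsilon>"
      by (elim exE conjE) (rule that)
    then show "\<exists>d>0. \<forall>x\<in>c ` K. \<forall>x'\<in>c ` K. dist x' x < d \<longrightarrow> dist (q x') (q x) < \<epsilon>"
      by (intro exI[of _ \<delta>]) (simp add: q dist_norm dist_real_def)
  qed
  then obtain g where g: "uniformly_continuous_on (closure (c ` K)) g" "\<And>x. x \<in> c ` K \<Longrightarrow> q x = g x"
    by (rule uniformly_continuous_on_extension_on_closure) (rule that)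
  have "continuous_on (closure (c ` K)) g" using g(1) by (rule uniformly_continuous_imp_continuous)
  then obtain p where p: "continuous_on UNIV p" "\<And>x. x \<in> closure (c ` K) \<Longrightarrow> p x = g x"
    by (rule Tietze_unbounded[where U=UNIV]) (simp, rule that)
  have "p (c x) = x" if "norm x \<le> R" for x
  proof -
    have xK: "x \<in> K" using that by (simp add: K_def)
    then have "c x \<in> c ` K" by (rule imageI)
    then show ?thesis using p(2)[OF subsetD[OF closure_subset]] g(2) q[OF xK] by metis
  qed
  then show ?thesis by (intro that[of c p] cm p(1)) (simp_all add: c0 c2)
qed

text \<open>Transport by \<open>c\<close> to the line, extract a limit there, transport back by
  \<open>p\<close>. Only \<open>p\<close> has to be continuous: test functions are composed with
  \<open>p\<close>, and \<open>p (c x) = x\<close> holds almost surely.\<close>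

lemma weakly_converges_prob_compact:
  fixes \<nu> :: "nat \<Rightarrow> 'a::euclidean_space measure"
  assumes prob: "\<And>n. prob_space (\<nu> n)" and sets: "\<And>n. sets (\<nu> n) = sets borel"
    and bdd: "\<And>n. AE x in \<nu> n. norm x \<le> R"
  obtains r \<nu>' where "strict_mono (r :: nat \<Rightarrow> nat)" "prob_space \<nu>'" "sets \<nu>' = sets borel"
    "weakly_converges (\<nu> \<circ> r) \<nu>'"
proof -
  \<comment> \<open>A probability measure is not concentrated on the empty set, so the ball is
    nonempty and \<open>R\<close> is nonnegative.\<close>
  have "\<exists>x::'a. norm x \<le> R"
    using prob_space.AE_contr[OF prob[of 0]] bdd[of 0] by (rule_tac ccontr) (auto elim!: eventually_mono)
  then have "R \<ge> 0" using norm_ge_zero order_trans by blast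
  then obtain c :: "'a \<Rightarrow> real" and p where c[measurable]: "c \<in> borel_measurable borel"
    and c02: "\<And>x. 0 \<le> c x \<and> c x \<le> 2"
    and p: "continuous_on UNIV p" and pc: "\<And>x. norm x \<le> R \<Longrightarrow> p (c x) = x"
    using real_coding_of_bounded_set by metis
  have [measurable]: "p \<in> borel_measurable borel" using p by (rule borel_measurable_continuous_onI)
  have [measurable_cong]: "sets (\<nu> n) = sets borel" for n by (rule sets)
  define m where "m n = distr (\<nu> n) borel c" for n
  have rd: "real_distribution (m n)" for n
    unfolding m_def by (rule prob_space.real_distribution_distr[OF prob]) simp
  \<comment> \<open>One half-open interval around the range \<open>[0, 2]\<close> of the code
    witnesses tightness for every accuracy.\<close>
  have "measure (m n) {-1<..3} = 1" for n
  proof -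
    interpret prob_space "\<nu> n" by (rule prob)
    have "c -` {-1<..3} \<inter> space (\<nu> n) = space (\<nu> n)"
      using c02 by (auto simp: less_le_trans[of "-1" 0]) (smt (verit) c02)+
    then show ?thesis unfolding m_def by (subst measure_distr) (auto simp: prob_space)
  qed
  then have "tight m"
    unfolding tight_def using rd by (intro conjI allI impI exI[of _ "-1"] exI[of _ 3]) simp_all
  then obtain r N where r: "strict_mono (r :: nat \<Rightarrow> nat)" and N: "real_distribution N"
    and wc: "weak_conv_m (m \<circ> id \<circ> r) N"
    using tight_imp_convergent_subsubsequence[of m id] by (auto simp: strict_mono_def)
  interpret N: real_distribution N by (rule N)
  have [measurable]: "p \<in> borel_measurable N" using N.M_is_borel by (simp cong: measurable_cong_sets)
  have "weakly_converges (\<nu> \<circ> r) (distr N borel p)"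
    unfolding weakly_converges_def
  proof (intro allI impI)
    fix g :: "'a \<Rightarrow> real" assume g: "continuous_on UNIV g \<and> bounded (range g)"
    then have [measurable]: "g \<in> borel_measurable borel" by (intro borel_measurable_continuous_onI) auto
    obtain B where B: "\<And>x. norm (g x) \<le> B" using g by (auto simp: bounded_iff)
    have gp: "continuous_on UNIV (\<lambda>x. g (p x))"
      using continuous_on_compose2[of UNIV g UNIV p] g p by auto
    have "(\<lambda>n. integral\<^sup>L ((m \<circ> id \<circ> r) n) (\<lambda>x. g (p x))) \<longlonglongrightarrow> integral\<^sup>L N (\<lambda>x. g (p x))"
      by (rule weak_conv_imp_integral_bdd_continuous_conv[where B=B])
        (use rd N wc B gp in \<open>simp_all add: continuous_on_eq_continuous_at o_def\<close>)
    moreover have "integral\<^sup>L ((m \<circ> id \<circ> r) n) (\<lambda>x. g (p x)) = (\<integral>x. g x \<partial>(\<nu> \<circ> r) n)" for n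
    proof -
      have "integral\<^sup>L ((m \<circ> id \<circ> r) n) (\<lambda>x. g (p x)) = (\<integral>x. g (p (c x)) \<partial>\<nu> (r n))"
        by (simp add: m_def integral_distr)
      also have "\<dots> = (\<integral>x. g x \<partial>\<nu> (r n))"
        by (rule integral_cong_AE) (use bdd[of "r n"] pc in \<open>auto elim!: eventually_mono\<close>)
      finally show ?thesis by simp
    qed
    ultimately show "(\<lambda>n. \<integral>x. g x \<partial>(\<nu> \<circ> r) n) \<longlonglongrightarrow> (\<integral>x. g x \<partial>distr N borel p)"
      by (simp add: integral_distr)
  qed
  moreover have "prob_space (distr N borel p)" by (rule N.prob_space_distr) simp
  ultimately show ?thesis using that r by force
qed

text \<open>The indicator of a nonempty closed set is the pointwise limit of the Lipschitz bumps
  \<open>max 0 (1 - n * infdist x C)\<close>, and the closed sets form an intersection-stable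
  generator of the Borel sets.\<close>

lemma prob_space_eq_if_lipschitz_integrals_eq:
  fixes P Q :: "'a::euclidean_space measure"
  assumes P: "prob_space P" "sets P = sets borel" and Q: "prob_space Q" "sets Q = sets borel"
    and eq: "\<And>g K. bounded (range g) \<Longrightarrow> (\<And>x y. \<bar>g x - g y\<bar> \<le> K * dist x y)
               \<Longrightarrow> (\<integral>x. g x \<partial>P) = (\<integral>x. (g x :: real) \<partial>Q)"
  shows "P = Q"
proof -
  interpret P: prob_space P by (rule P)
  interpret Q: prob_space Q by (rule Q)
  have closed_eq: "emeasure P C = emeasure Q C" if C: "closed C" "C \<noteq> {}" for C
  proof -
    define g where "g n x = max 0 (1 - real n * infdist x C)" for n x
    have gb: "0 \<le> g n x" "g n x \<le> 1" for n x by (auto simp: g_def infdist_nonneg)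
    have gl: "\<bar>g n x - g n y\<bar> \<le> real n * dist x y" for n x y
    proof -
      have "\<bar>real n * infdist x C - real n * infdist y C\<bar> \<le> real n * dist x y"
        using infdist_triangle_abs[of x C y] by (simp add: right_diff_distrib[symmetric] abs_mult mult_left_mono)
      then show ?thesis unfolding g_def by linarith
    qed
    have lim: "(\<lambda>n. g n x) \<longlonglongrightarrow> indicator C x" for x
    proof (cases "x \<in> C")
      case False
      then have pos: "infdist x C > 0" using C by (simp add: infdist_pos_not_in_closed)
      obtain N :: nat where N: "1 / infdist x C < N" using reals_Archimedean2 by blast
      have "g n x = 0" if "n \<ge> N" for n
      proof -
        have "1 \<le> real n * infdist x C"
          using N that pos by (smt (verit, best) divide_less_eq mult_right_mono of_nat_mono)
        then show ?thesis by (simp add: g_def)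
      qed
      then show ?thesis using False by (intro tendsto_eventually) (auto simp: eventually_sequentially)
    qed (simp add: g_def)
    have int: "(\<lambda>n. \<integral>x. g n x \<partial>R) \<longlonglongrightarrow> measure R C" if R: "prob_space R" "sets R = sets borel" for R
    proof -
      interpret R: prob_space R by (rule R)
      have [measurable_cong]: "sets R = sets borel" by (rule R)
      have [measurable]: "C \<in> sets R" using C R by simp
      have [measurable]: "g n \<in> borel_measurable borel" for n
        unfolding g_def by (intro borel_measurable_continuous_onI continuous_intros)
      have "(\<lambda>n. \<integral>x. g n x \<partial>R) \<longlonglongrightarrow> (\<integral>x. indicator C x \<partial>R)"
        by (rule integral_dominated_convergence[where w="\<lambda>_. 1"]) (use lim gb in auto)
      then show ?thesis by simp
    qed
    have "(\<integral>x. g n x \<partial>P) = (\<integral>x. g n x \<partial>Q)" for n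
      by (rule eq[where K="real n"]) (use gb gl in \<open>auto simp: bounded_iff intro!: exI[of _ 1]\<close>)
    then have "measure P C = measure Q C"
      using int[OF P] int[OF Q] LIMSEQ_unique by auto
    then show ?thesis by (simp add: P.emeasure_eq_measure Q.emeasure_eq_measure)
  qed
  show ?thesis
  proof (rule measure_eqI_generator_eq[where E="Collect closed" and \<Omega>=UNIV and A="\<lambda>_. UNIV"])
    show "Int_stable (Collect closed :: 'a set set)" by (auto simp: Int_stable_def)
    show "sets P = sigma_sets UNIV (Collect closed)" "sets Q = sigma_sets UNIV (Collect closed)"
      using P(2) Q(2) by (simp_all add: borel_eq_closed)
    show "emeasure P X = emeasure Q X" if "X \<in> Collect closed" for X
      using closed_eq[of X] that by (cases "X = {}") auto
  qed auto
qed

lemma lipschitz_continuous_on_UNIV: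
  fixes g :: "'a::metric_space \<Rightarrow> real"
  assumes K: "\<And>x y. \<bar>g x - g y\<bar> \<le> K * dist x y"
  shows "continuous_on UNIV g"
proof -
  have "\<bar>g x - g y\<bar> \<le> max K 0 * dist x y" for x y
    using K[of x y] by (smt (verit) mult_right_mono zero_le_dist)
  then have "(max K 0)-lipschitz_on UNIV g" by (auto intro!: lipschitz_onI simp: dist_real_def)
  then show ?thesis by (rule lipschitz_on_continuous_on)
qed

lemma weakly_converges_unique:
  fixes \<nu> :: "nat \<Rightarrow> 'a::euclidean_space measure"
  assumes "prob_space P" "sets P = sets borel" "prob_space Q" "sets Q = sets borel"
    and "weakly_converges \<nu> P" "weakly_converges \<nu> Q"
  shows "P = Q"
proof (rule prob_space_eq_if_lipschitz_integrals_eq[OF assms(1-4)])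
  fix g :: "'a \<Rightarrow> real" and K
  assume "bounded (range g)" and K: "\<And>x y. \<bar>g x - g y\<bar> \<le> K * dist x y"
  moreover have "continuous_on UNIV g" by (rule lipschitz_continuous_on_UNIV[OF K])
  ultimately show "(\<integral>x. g x \<partial>P) = (\<integral>x. g x \<partial>Q)"
    using assms(5,6) LIMSEQ_unique unfolding weakly_converges_def by blast
qed

text \<open>Lipschitz functions are what a mixing estimate controls; bounded continuous functions
  are what weak convergence demands. Compactness bridges the gap: a continuous test function for
  which convergence failed would produce a subsequential limit different from \<open>\<nu>'\<close>,
  although Lipschitz functions already force all subsequential limits to agree.\<close>

lemma weakly_converges_if_lipschitz_integrals_converge:
  fixes \<nu> :: "nat \<Rightarrow> 'a::euclidean_space measure"
  assumes prob: "\<And>n. prob_space (\<nu> n)" and sets: "\<And>n. sets (\<nu> n) = sets borel"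
    and bdd: "\<And>n. AE x in \<nu> n. norm x \<le> R"
    and conv: "\<And>g K. bounded (range g) \<Longrightarrow> (\<And>x y. \<bar>g x - g y\<bar> \<le> K * dist x y)
               \<Longrightarrow> convergent (\<lambda>n. \<integral>x. (g x :: real) \<partial>\<nu> n)"
  obtains \<nu>' where "prob_space \<nu>'" "sets \<nu>' = sets borel" "weakly_converges \<nu> \<nu>'"
proof -
  obtain r \<nu>' where r: "strict_mono (r :: nat \<Rightarrow> nat)" and \<nu>': "prob_space \<nu>'" "sets \<nu>' = sets borel"
    and w: "weakly_converges (\<nu> \<circ> r) \<nu>'"
    by (rule weakly_converges_prob_compact[OF prob sets bdd]) (rule that)
  \<comment> \<open>The full sequence of integrals converges by assumption, so its limit can be read
    off along any weakly convergent subsequence.\<close>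
  have lip: "(\<lambda>n. \<integral>x. g x \<partial>\<nu> n) \<longlonglongrightarrow> (\<integral>x. g x \<partial>\<nu>'')"
    if s: "strict_mono (s :: nat \<Rightarrow> nat)" and ws: "weakly_converges (\<nu> \<circ> s) \<nu>''"
      and gb: "bounded (range g)" and gl: "\<And>x y. \<bar>g x - g y\<bar> \<le> K * dist x y" for s \<nu>'' K and g :: "'a \<Rightarrow> real"
  proof -
    obtain l where l: "(\<lambda>n. \<integral>x. g x \<partial>\<nu> n) \<longlonglongrightarrow> l"
      using conv[OF gb gl] by (auto simp: convergent_def)
    have "(\<lambda>n. \<integral>x. g x \<partial>\<nu> (s n)) \<longlonglongrightarrow> (\<integral>x. g x \<partial>\<nu>'')"
      using gb ws lipschitz_continuous_on_UNIV[OF gl] by (auto simp: weakly_converges_def)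
    moreover have "(\<lambda>n. \<integral>x. g x \<partial>\<nu> (s n)) \<longlonglongrightarrow> l"
      using LIMSEQ_subseq_LIMSEQ[OF l s] by (simp add: o_def)
    ultimately show ?thesis using l LIMSEQ_unique by blast
  qed
  have "(\<lambda>n. \<integral>x. g x \<partial>\<nu> n) \<longlonglongrightarrow> (\<integral>x. g x \<partial>\<nu>')"
    if g: "continuous_on UNIV g \<and> bounded (range g)" for g :: "'a \<Rightarrow> real"
  proof (rule ccontr)
    assume "\<not> ?thesis"
    then obtain \<epsilon> where \<epsilon>: "\<epsilon> > 0"
      and far: "\<And>N. \<exists>n\<ge>N. \<epsilon> \<le> dist (\<integral>x. g x \<partial>\<nu> n) (\<integral>x. g x \<partial>\<nu>')"
      by (auto simp: lim_sequentially not_less)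
    then have "infinite {n. \<epsilon> \<le> dist (\<integral>x. g x \<partial>\<nu> n) (\<integral>x. g x \<partial>\<nu>')}"
      by (auto simp: infinite_nat_iff_unbounded_le)
    then obtain s where s: "strict_mono (s :: nat \<Rightarrow> nat)"
      and sfar: "\<And>n. \<epsilon> \<le> dist (\<integral>x. g x \<partial>\<nu> (s n)) (\<integral>x. g x \<partial>\<nu>')"
      using infinite_enumerate by blast
    obtain q \<nu>'' where q: "strict_mono (q :: nat \<Rightarrow> nat)" and \<nu>'': "prob_space \<nu>''" "sets \<nu>'' = sets borel"
      and w'': "weakly_converges ((\<nu> \<circ> s) \<circ> q) \<nu>''"
      by (rule weakly_converges_prob_compact[of "\<nu> \<circ> s" R]) (simp add: prob, simp add: sets, simp only: o_apply bdd, rule that)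
    have sq: "strict_mono (s \<circ> q)" using s q by (rule strict_mono_o)
    have "\<nu>'' = \<nu>'"
    proof (rule prob_space_eq_if_lipschitz_integrals_eq[OF \<nu>'' \<nu>'])
      fix h :: "'a \<Rightarrow> real" and K assume h: "bounded (range h)" "\<And>x y. \<bar>h x - h y\<bar> \<le> K * dist x y"
      have "weakly_converges (\<nu> \<circ> (s \<circ> q)) \<nu>''" using w'' by (simp add: comp_assoc)
      from lip[OF sq this h] lip[OF r w h] show "(\<integral>x. h x \<partial>\<nu>'') = (\<integral>x. h x \<partial>\<nu>')"
        by (rule LIMSEQ_unique)
    qed
    then have "(\<lambda>n. \<integral>x. g x \<partial>\<nu> (s (q n))) \<longlonglongrightarrow> (\<integral>x. g x \<partial>\<nu>')"
      using w'' g unfolding weakly_converges_def o_def by blast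
    then obtain N where "dist (\<integral>x. g x \<partial>\<nu> (s (q N))) (\<integral>x. g x \<partial>\<nu>') < \<epsilon>"
      using \<epsilon> by (meson lim_sequentially order_refl)
    then show False using sfar[of "q N"] by simp
  qed
  then have "weakly_converges \<nu> \<nu>'" by (simp add: weakly_converges_def)
  then show ?thesis using that \<nu>' by blast
qed

text \<open>The truncated distance \<open>min 1 (infdist x S)\<close> is bounded and continuous,
  vanishes exactly on \<open>S\<close>, and has integral 0 along the sequence, hence also in the
  limit.\<close>

lemma weakly_converges_AE_closed:
  fixes \<nu> :: "nat \<Rightarrow> 'a::euclidean_space measure"
  assumes w: "weakly_converges \<nu> \<nu>'" and \<nu>': "prob_space \<nu>'" "sets \<nu>' = sets borel"
    and sets: "\<And>n. sets (\<nu> n) = sets borel"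
    and S: "closed S" and AE: "\<And>n. AE x in \<nu> n. x \<in> S" and ne: "S \<noteq> {}"
  shows "AE x in \<nu>'. x \<in> S"
proof -
  interpret prob_space \<nu>' by (rule \<nu>')
  have [measurable_cong]: "sets \<nu>' = sets borel" "\<And>n. sets (\<nu> n) = sets borel" using \<nu>' sets by auto
  define g where "g x = min 1 (infdist x S)" for x
  have cont: "continuous_on UNIV g" unfolding g_def by (intro continuous_intros)
  then have [measurable]: "g \<in> borel_measurable borel" by (rule borel_measurable_continuous_onI)
  have g01: "0 \<le> g x" "g x \<le> 1" for x by (auto simp: g_def infdist_nonneg)
  have zero: "(\<integral>x. g x \<partial>\<nu> n) = 0" for n
  proof -
    have "(\<integral>x. g x \<partial>\<nu> n) = (\<integral>x. 0 \<partial>\<nu> n)"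
    proof (rule integral_cong_AE)
      show "AE x in \<nu> n. g x = 0" using AE[of n] by eventually_elim (simp add: g_def)
    qed simp_all
    then show ?thesis by simp
  qed
  have "bounded (range g)" using g01 by (auto simp: bounded_iff intro!: exI[of _ 1])
  with w cont have "(\<lambda>n. \<integral>x. g x \<partial>\<nu> n) \<longlonglongrightarrow> (\<integral>x. g x \<partial>\<nu>')"
    unfolding weakly_converges_def by blast
  then have "(\<integral>x. g x \<partial>\<nu>') = 0" by (simp add: zero LIMSEQ_const_iff)
  moreover have "integrable \<nu>' g"
    by (rule integrable_const_bound[where B=1]) (use g01 in auto)
  ultimately have "AE x in \<nu>'. g x = 0"
    using g01 by (subst (asm) integral_nonneg_eq_0_iff_AE) auto
  then show ?thesis
  proof (rule eventually_mono)
    fix x assume "g x = 0"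
    then have "infdist x S = 0" by (auto simp: g_def min_def split: if_splits)
    then show "x \<in> S" using in_closed_iff_infdist_zero[OF S ne] by blast
  qed
qed

section \<open>Wasserstein couplings and one step of the chain\<close>

lemma infnorm_le_iff: "infnorm (x::'a::euclidean_space) \<le> c \<longleftrightarrow> (\<forall>b\<in>Basis. \<bar>x \<bullet> b\<bar> \<le> c)"
  by (simp add: infnorm_Max)

lemma infnorm_Pair_le_iff: "infnorm (a, b) \<le> c \<longleftrightarrow> infnorm a \<le> c \<and> infnorm b \<le> c"
  by (simp add: infnorm_le_iff Basis_prod_def ball_Un)

lemma infnorm_vec_le_iff:
  "infnorm (x::'a::euclidean_space^'n) \<le> c \<longleftrightarrow> (\<forall>i. infnorm (x $ i) \<le> c)"
  by (auto simp: infnorm_le_iff Basis_vec_def inner_axis)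

lemma infnorm_real [simp]: "infnorm (r::real) = \<bar>r\<bar>"
  by (simp add: infnorm_Max)

text \<open>The easy half of Kantorovich duality, combined with the bound of a first moment by a
  second one. The infimum over couplings is not assumed to be attained, so for every
  \<open>s > D\<close> a coupling of cost below \<open>s^2\<close> is taken, and \<open>s\<close> is
  then lowered to \<open>D\<close>.\<close>

lemma abs_integral_diff_le_wass2:
  fixes P Q :: "'a::euclidean_space measure" and \<psi> :: "'a \<Rightarrow> real"
  assumes P: "prob_space P" "sets P = sets borel" and Q: "prob_space Q" "sets Q = sets borel"
    and W: "wass2 P Q \<le> ennreal D" and D: "0 \<le> D"
    and \<psi>[measurable]: "\<psi> \<in> borel_measurable borel" and B: "\<And>x. \<bar>\<psi> x\<bar> \<le> B"
    and lip: "\<And>x y. \<bar>\<psi> x - \<psi> y\<bar> \<le> A * infnorm (x - y)" and A: "0 \<le> A"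
  shows "\<bar>(\<integral>x. \<psi> x \<partial>P) - (\<integral>x. \<psi> x \<partial>Q)\<bar> \<le> A * D"
proof -
  interpret P: prob_space P by (rule P)
  interpret Q: prob_space Q by (rule Q)
  define c where "c = (INF \<pi>\<in>couplings P Q. \<integral>\<^sup>+ p. ennreal ((infnorm (fst p - snd p))\<^sup>2) \<partial>\<pi>)"
  have ctop: "c \<noteq> top"
    using W by (auto simp: wass2_def c_def[symmetric] top_unique)
  then have "ennreal (sqrt (enn2real c)) \<le> ennreal D"
    using W by (simp add: wass2_def c_def[symmetric])
  then have "sqrt (enn2real c) \<le> D" using D by simp
  then have "enn2real c \<le> D\<^sup>2" using D by (simp add: real_sqrt_le_iff' sqrt_le_D)
  then have cD: "c \<le> ennreal (D\<^sup>2)"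
    using ctop by (metis enn2real_nonneg ennreal_enn2real_if ennreal_leI)
  have main: "\<bar>(\<integral>x. \<psi> x \<partial>P) - (\<integral>x. \<psi> x \<partial>Q)\<bar> \<le> A * s" if s: "D < s" for s
  proof -
    have s0: "s > 0" using s D by linarith
    have "D\<^sup>2 < s\<^sup>2" using s D by (intro power_strict_mono) auto
    then have "c < ennreal (s\<^sup>2)" using cD s0 by (meson ennreal_lessI le_less_trans zero_less_power)
    then obtain \<pi> where \<pi>: "\<pi> \<in> couplings P Q"
      and small: "(\<integral>\<^sup>+ p. ennreal ((infnorm (fst p - snd p))\<^sup>2) \<partial>\<pi>) < ennreal (s\<^sup>2)"
      unfolding c_def by (auto simp: INF_less_iff)
    have sets: "sets \<pi> = sets (P \<Otimes>\<^sub>M Q)" and fst: "distr \<pi> P fst = P" and snd: "distr \<pi> Q snd = Q"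
      using \<pi> by (auto simp: couplings_def)
    have sets_b: "sets \<pi> = sets (borel :: ('a \<times> 'a) measure)"
      using sets sets_pair_measure_cong[OF P(2) Q(2)] by (simp only: borel_prod)
    note [measurable_cong] = sets_b P(2) Q(2)
    have fstm: "fst \<in> \<pi> \<rightarrow>\<^sub>M P" and sndm: "snd \<in> \<pi> \<rightarrow>\<^sub>M Q"
      using measurable_fst[of P Q] measurable_snd[of P Q] by (simp_all cong: measurable_cong_sets add: sets)
    have "emeasure \<pi> (space \<pi>) = emeasure (distr \<pi> P fst) (space P)"
      using fstm by (subst emeasure_distr) (auto simp: measurable_def intro!: arg_cong[where f="emeasure \<pi>"])
    then have "emeasure \<pi> (space \<pi>) = 1" unfolding fst by (simp add: P.emeasure_space_1)
    then interpret \<pi>: prob_space \<pi> by (rule prob_spaceI)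
    define d where "d p = infnorm (fst p - snd p)" for p :: "'a \<times> 'a"
    have "continuous_on UNIV d" unfolding d_def by (intro continuous_intros)
    then have [measurable]: "d \<in> borel_measurable borel" by (rule borel_measurable_continuous_onI)
    have d0: "0 \<le> d p" for p by (simp add: d_def infnorm_pos_le)
    have d2: "integrable \<pi> (\<lambda>p. (d p)\<^sup>2)"
      by (rule integrableI_nonneg)
        (simp_all, use small in \<open>simp add: d_def order_less_trans[OF _ ennreal_less_top]\<close>)
    have "ennreal (\<integral>p. (d p)\<^sup>2 \<partial>\<pi>) < ennreal (s\<^sup>2)"
      using small by (subst nn_integral_eq_integral[symmetric, OF d2]) (auto simp: d_def)
    then have d2s: "(\<integral>p. (d p)\<^sup>2 \<partial>\<pi>) \<le> s\<^sup>2"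
      by (simp add: ennreal_less_iff)
    \<comment> \<open>Young's inequality in place of Cauchy-Schwarz: integrating it against a second
      moment of at most \<open>s^2\<close> gives a first moment of at most \<open>s\<close>.\<close>
    have amgm: "d p \<le> (d p)\<^sup>2 / (2 * s) + s / 2" for p
    proof -
      have "d p * (2 * s) \<le> (d p)\<^sup>2 + s\<^sup>2"
        using zero_le_power2[of "d p - s"] by (simp add: power2_diff algebra_simps)
      then have "d p \<le> ((d p)\<^sup>2 + s\<^sup>2) / (2 * s)" using s0 by (simp add: pos_le_divide_eq)
      also have "\<dots> = (d p)\<^sup>2 / (2 * s) + s / 2" using s0 by (simp add: add_divide_distrib power2_eq_square)
      finally show ?thesis .
    qed
    have idx: "integrable \<pi> (\<lambda>p. (d p)\<^sup>2 / (2 * s) + s / 2)" using d2 by simp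
    have id: "integrable \<pi> d"
      by (rule Bochner_Integration.integrable_bound[OF idx])
        (use amgm d0 in \<open>auto intro!: AE_I2 order_trans[OF _ abs_ge_self]\<close>)
    have "(\<integral>p. d p \<partial>\<pi>) \<le> (\<integral>p. (d p)\<^sup>2 / (2 * s) + s / 2 \<partial>\<pi>)"
      by (rule integral_mono[OF id idx amgm])
    also have "\<dots> = (\<integral>p. (d p)\<^sup>2 \<partial>\<pi>) / (2 * s) + s / 2"
      using d2 by (simp add: \<pi>.prob_space)
    also have "\<dots> \<le> s\<^sup>2 / (2 * s) + s / 2" using d2s s0 by (simp add: divide_right_mono)
    also have "\<dots> = s" using s0 by (simp add: power2_eq_square)
    finally have ds: "(\<integral>p. d p \<partial>\<pi>) \<le> s" .
    have i1: "integrable \<pi> (\<lambda>p. \<psi> (h p))" if [measurable]: "h \<in> borel \<rightarrow>\<^sub>M borel" for h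
      by (rule \<pi>.integrable_const_bound[where B=B]) (use B in simp_all)
    have i1: "integrable \<pi> (\<lambda>p. \<psi> (fst p))" "integrable \<pi> (\<lambda>p. \<psi> (snd p))"
      by (simp_all add: i1 borel_prod[symmetric])
    have "(\<integral>x. \<psi> x \<partial>P) = (\<integral>p. \<psi> (fst p) \<partial>\<pi>)"
      by (subst fst[symmetric], subst integral_distr[OF fstm]) simp_all
    moreover have "(\<integral>x. \<psi> x \<partial>Q) = (\<integral>p. \<psi> (snd p) \<partial>\<pi>)"
      by (subst snd[symmetric], subst integral_distr[OF sndm]) simp_all
    ultimately have "\<bar>(\<integral>x. \<psi> x \<partial>P) - (\<integral>x. \<psi> x \<partial>Q)\<bar> = \<bar>\<integral>p. \<psi> (fst p) - \<psi> (snd p) \<partial>\<pi>\<bar>"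
      using i1 by simp
    also have "\<dots> \<le> (\<integral>p. \<bar>\<psi> (fst p) - \<psi> (snd p)\<bar> \<partial>\<pi>)" by (rule integral_abs_bound)
    also have "\<dots> \<le> (\<integral>p. A * d p \<partial>\<pi>)"
    proof (rule integral_mono)
      show "\<bar>\<psi> (fst p) - \<psi> (snd p)\<bar> \<le> A * d p" for p by (simp add: d_def lip)
    qed (use i1 id in simp_all)
    also have "\<dots> \<le> A * s" using ds A by (simp add: mult_left_mono)
    finally show ?thesis .
  qed
  show ?thesis
  proof (rule field_le_epsilon)
    fix e :: real assume "e > 0"
    \<comment> \<open>Dividing by \<open>A + 1\<close> instead of \<open>A\<close> covers the case
      \<open>A = 0\<close>.\<close>
    have "\<bar>(\<integral>x. \<psi> x \<partial>P) - (\<integral>x. \<psi> x \<partial>Q)\<bar> \<le> A * (D + e / (A + 1))"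
      by (rule main) (use \<open>e > 0\<close> A in simp)
    also have "\<dots> \<le> A * D + e"
      using \<open>e > 0\<close> A by (simp add: distrib_left divide_le_eq mult.commute mult_left_mono)
    finally show "\<bar>(\<integral>x. \<psi> x \<partial>P) - (\<integral>x. \<psi> x \<partial>Q)\<bar> \<le> A * D + e" .
  qed
qed

section \<open>The Markov property for functions of the next value and the past\<close>

lemma
  assumes "\<And>t. V t \<in> borel_measurable M"
  shows subalgebra_past: "subalgebra M (past M V t)"
    and measurable_past: "i \<le> t \<Longrightarrow> V i \<in> past M V t \<rightarrow>\<^sub>M borel"
    and subalgebra_past_Suc: "subalgebra (past M V (Suc t)) (past M V t)"
proof -
  let ?G = "\<lambda>t. {V i -` A \<inter> space M |i A. i \<le> t \<and> A \<in> sets borel}"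
  have G: "?G t \<subseteq> Pow (space M)" for t by auto
  have sp: "space (past M V t) = space M" for t
    by (simp add: past_def space_measure_of[OF G])
  have st: "sets (past M V t) = sigma_sets (space M) (?G t)" for t
    by (simp add: past_def sets_measure_of[OF G])
  have "?G t \<subseteq> sets M" using measurable_sets[OF assms] by auto
  then show "subalgebra M (past M V t)"
    by (auto simp: subalgebra_def sp st sets.sigma_sets_subset)
  have "sigma_sets (space M) (?G t) \<subseteq> sigma_sets (space M) (?G (Suc t))"
    by (rule sigma_sets_mono') (use le_SucI in blast)
  then show "subalgebra (past M V (Suc t)) (past M V t)"
    by (simp add: subalgebra_def sp st)
  assume i: "i \<le> t"
  show "V i \<in> past M V t \<rightarrow>\<^sub>M borel"
  proof (rule measurableI)
    show "V i -` A \<inter> space (past M V t) \<in> sets (past M V t)" if "A \<in> sets borel" for A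
      unfolding sp st using i that by (intro sigma_sets.Basic) blast
  qed simp
qed

text \<open>The definition of \<open>markov_chain\<close> concerns single events of the next value;
  here it becomes an identity of joint laws with a past-measurable \<open>\<xi>\<close>. Rectangles
  suffice, and on them the indicator of \<open>\<xi>\<close> is pulled into the conditional
  expectation.\<close>

lemma markov_chain_one_step:
  fixes V :: "nat \<Rightarrow> 'w \<Rightarrow> 'a::euclidean_space" and \<xi> :: "'w \<Rightarrow> 'b::euclidean_space"
    and g :: "'a \<times> 'b \<Rightarrow> real"
  assumes M: "prob_space M" and V: "markov_chain M V \<kappa>" and \<xi>: "\<xi> \<in> past M V t \<rightarrow>\<^sub>M borel"
    and g: "g \<in> borel_measurable borel" and B: "\<And>p. \<bar>g p\<bar> \<le> B"
  shows "(\<integral>\<omega>. g (V (Suc t) \<omega>, \<xi> \<omega>) \<partial>M) = (\<integral>\<omega>. (\<integral>w. g (w, \<xi> \<omega>) \<partial>\<kappa> (V t \<omega>)) \<partial>M)"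
proof -
  interpret prob_space M by (rule M)
  have Vm[measurable]: "V t \<in> borel_measurable M" for t using V by (auto simp: markov_chain_def)
  have \<kappa>P[measurable]: "\<kappa> \<in> borel \<rightarrow>\<^sub>M prob_algebra borel" using V by (auto simp: markov_chain_def)
  have \<kappa>[measurable]: "\<kappa> \<in> borel \<rightarrow>\<^sub>M subprob_algebra borel" by (rule measurable_prob_algebraD[OF \<kappa>P])
  have \<kappa>_prob: "prob_space (\<kappa> w)" and \<kappa>_sets: "sets (\<kappa> w) = sets borel" for w
    using measurable_space[OF \<kappa>P, of w] by (auto simp: space_prob_algebra)
  have sub: "subalgebra M (past M V t)" by (rule subalgebra_past[OF Vm])
  interpret sigma_finite_subalgebra M "past M V t"
    by (rule finite_measure_subalgebra_is_sigma_finite) (simp add: finite_measure_subalgebra_def finite_measure_axioms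
        finite_measure_subalgebra_axioms_def sub)
  have \<xi>m[measurable]: "\<xi> \<in> M \<rightarrow>\<^sub>M borel" using measurable_from_subalg[OF sub \<xi>] .
  let ?B = "borel \<Otimes>\<^sub>M borel :: ('a \<times> 'b) measure"
  \<comment> \<open>The conditional law of the pair given the past: the first component is drawn
    from \<open>\<kappa> (V t \<omega>)\<close>, the second is frozen at
    \<open>\<xi> \<omega>\<close>.\<close>
  define K where "K \<omega> = distr (\<kappa> (V t \<omega>)) ?B (\<lambda>w. (w, \<xi> \<omega>))" for \<omega>
  have K[measurable]: "K \<in> M \<rightarrow>\<^sub>M subprob_algebra ?B"
    unfolding K_def by (rule measurable_distr2[where M=borel]) measurable
  have inner[measurable]: "(\<lambda>w. (w, e)) \<in> \<kappa> v \<rightarrow>\<^sub>M ?B" for e v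
    using \<kappa>_sets by (simp cong: measurable_cong_sets)
  have "distr M ?B (\<lambda>\<omega>. (V (Suc t) \<omega>, \<xi> \<omega>)) = M \<bind> K"
  proof (rule measure_eqI_generator_eq[where \<Omega>="UNIV" and A="\<lambda>_. UNIV"
        and E="{a \<times> b |a b. a \<in> sets (borel::'a measure) \<and> b \<in> sets (borel::'b measure)}"])
    show "Int_stable {a \<times> b |a b. a \<in> sets (borel::'a measure) \<and> b \<in> sets (borel::'b measure)}"
      by (rule Int_stable_pair_measure_generator)
    show "sets (distr M ?B (\<lambda>\<omega>. (V (Suc t) \<omega>, \<xi> \<omega>))) =
        sigma_sets UNIV {a \<times> b |a b. a \<in> sets (borel::'a measure) \<and> b \<in> sets (borel::'b measure)}"
      by (simp add: sets_pair_measure)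
    show "sets (M \<bind> K) = sigma_sets UNIV {a \<times> b |a b. a \<in> sets (borel::'a measure) \<and> b \<in> sets (borel::'b measure)}"
      by (subst sets_bind[where N="?B"]) (auto simp: sets_kernel[OF K] not_empty sets_pair_measure)
    show "range (\<lambda>_. UNIV) \<subseteq> {a \<times> b |a b. a \<in> sets (borel::'a measure) \<and> b \<in> sets (borel::'b measure)}"
      by (auto intro!: exI[of _ UNIV])
    fix X assume "X \<in> {a \<times> b |a b. a \<in> sets (borel::'a measure) \<and> b \<in> sets (borel::'b measure)}"
    then obtain a b where X: "X = a \<times> b" and [measurable]: "a \<in> sets borel" "b \<in> sets borel" by auto
    have ind: "(\<lambda>\<omega>. indicat_real b (\<xi> \<omega>)) \<in> borel_measurable (past M V t)"
      using \<xi> by measurable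
    have [simp]: "integrable M (\<lambda>\<omega>. indicat_real b (\<xi> \<omega>) * indicat_real a (V (Suc t) \<omega>))"
      by (rule integrable_const_bound[where B=1]) (auto simp: indicator_def)
    have mk[measurable]: "(\<lambda>\<omega>. measure (\<kappa> (V t \<omega>)) a) \<in> borel_measurable M" by measurable
    have "emeasure (distr M ?B (\<lambda>\<omega>. (V (Suc t) \<omega>, \<xi> \<omega>))) X
        = (\<integral>\<^sup>+\<omega>. ennreal (indicat_real b (\<xi> \<omega>) * indicat_real a (V (Suc t) \<omega>)) \<partial>M)"
      unfolding X by (subst nn_integral_indicator[symmetric], simp, subst nn_integral_distr)
        (auto intro!: nn_integral_cong simp: indicator_def)
    also have "\<dots> = ennreal (\<integral>\<omega>. indicat_real b (\<xi> \<omega>) * indicat_real a (V (Suc t) \<omega>) \<partial>M)"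
      by (rule nn_integral_eq_integral) auto
    \<comment> \<open>The characteristic property of conditional expectation, tested against the
      past-measurable factor \<open>indicat_real b (\<xi> \<omega>)\<close>.\<close>
    also have "(\<integral>\<omega>. indicat_real b (\<xi> \<omega>) * indicat_real a (V (Suc t) \<omega>) \<partial>M)
        = (\<integral>\<omega>. indicat_real b (\<xi> \<omega>) * real_cond_exp M (past M V t) (\<lambda>\<omega>. indicat_real a (V (Suc t) \<omega>)) \<omega> \<partial>M)"
      by (rule real_cond_exp_intg(2)[symmetric]) (use ind in auto)
    also have "\<dots> = (\<integral>\<omega>. indicat_real b (\<xi> \<omega>) * measure (\<kappa> (V t \<omega>)) a \<partial>M)"
    proof (rule integral_cong_AE)
      have "AE \<omega> in M. real_cond_exp M (past M V t) (\<lambda>\<omega>. indicator a (V (Suc t) \<omega>)) \<omega> = measure (\<kappa> (V t \<omega>)) a"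
        using V by (auto simp: markov_chain_def)
      then show "AE \<omega> in M. indicat_real b (\<xi> \<omega>) * real_cond_exp M (past M V t) (\<lambda>\<omega>. indicat_real a (V (Suc t) \<omega>)) \<omega>
          = indicat_real b (\<xi> \<omega>) * measure (\<kappa> (V t \<omega>)) a" by eventually_elim simp
    qed measurable
    also have "ennreal \<dots> = (\<integral>\<^sup>+\<omega>. ennreal (indicat_real b (\<xi> \<omega>) * measure (\<kappa> (V t \<omega>)) a) \<partial>M)"
    proof (rule nn_integral_eq_integral[symmetric])
      show "integrable M (\<lambda>\<omega>. indicat_real b (\<xi> \<omega>) * measure (\<kappa> (V t \<omega>)) a)"
        by (rule integrable_const_bound[where B=1])
          (auto simp: indicator_def prob_space.prob_le_1[OF \<kappa>_prob])
    qed simp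
    also have "\<dots> = (\<integral>\<^sup>+\<omega>. emeasure (K \<omega>) X \<partial>M)"
    proof (rule nn_integral_cong)
      fix \<omega>
      have "(\<lambda>w. (w, \<xi> \<omega>)) -` (a \<times> b) \<inter> space (\<kappa> (V t \<omega>)) = (if \<xi> \<omega> \<in> b then a else {})"
        using sets_eq_imp_space_eq[OF \<kappa>_sets] by auto
      then have "emeasure (K \<omega>) X = (if \<xi> \<omega> \<in> b then emeasure (\<kappa> (V t \<omega>)) a else 0)"
        unfolding K_def X by (subst emeasure_distr) auto
      then show "ennreal (indicat_real b (\<xi> \<omega>) * measure (\<kappa> (V t \<omega>)) a) = emeasure (K \<omega>) X"
        using finite_measure.emeasure_eq_measure[OF prob_space.finite_measure[OF \<kappa>_prob]] by simp
    qed
    also have "\<dots> = emeasure (M \<bind> K) X"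
      by (rule emeasure_bind[OF not_empty K, symmetric]) (simp add: X)
    finally show "emeasure (distr M ?B (\<lambda>\<omega>. (V (Suc t) \<omega>, \<xi> \<omega>))) X = emeasure (M \<bind> K) X" .
  next
    show "emeasure (distr M ?B (\<lambda>\<omega>. (V (Suc t) \<omega>, \<xi> \<omega>))) UNIV \<noteq> \<infinity>"
    proof -
      have "prob_space (distr M ?B (\<lambda>\<omega>. (V (Suc t) \<omega>, \<xi> \<omega>)))" by (rule prob_space_distr) measurable
      then show ?thesis by (simp add: finite_measure.emeasure_finite prob_space.finite_measure)
    qed
  qed auto
  moreover have g'[measurable]: "g \<in> borel_measurable ?B" using g by (simp add: borel_prod)
  have "(\<integral>\<omega>. g (V (Suc t) \<omega>, \<xi> \<omega>) \<partial>M) = (\<integral>p. g p \<partial>distr M ?B (\<lambda>\<omega>. (V (Suc t) \<omega>, \<xi> \<omega>)))"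
    by (subst integral_distr) auto
  moreover have "(\<integral>p. g p \<partial>(M \<bind> K)) = (\<integral>\<omega>. (\<integral>p. g p \<partial>K \<omega>) \<partial>M)"
  proof (rule integral_bind[OF g' _ K finite_measure_axioms, of B 1])
    show "AE \<omega> in M. emeasure (K \<omega>) (space (K \<omega>)) \<le> ennreal 1"
      using subprob_space.emeasure_space_le_1[OF subprob_space_kernel[OF K]] by auto
  qed (use B in auto)
  moreover have "(\<integral>p. g p \<partial>K \<omega>) = (\<integral>w. g (w, \<xi> \<omega>) \<partial>\<kappa> (V t \<omega>))" for \<omega>
    unfolding K_def by (subst integral_distr) auto
  ultimately show ?thesis by simp
qed

section \<open>Contractive recursions driven by a Markov chain\<close>

text \<open>\<open>F\<close> is the true update. \<open>\<Phi>\<close> agrees with it for inputs in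
  the unit box and satisfies the contraction estimate for all inputs, because the kernel may put
  mass outside the box. The final inequality makes the combined distance
  \<open>A * infnorm (w - w') + Du e e'\<close> contract by \<open>r\<close>: the weight
  \<open>A\<close> is large enough to absorb the input sensitivity \<open>c\<close> next to the
  kernel constant \<open>Lp\<close>.\<close>

locale driven_chain = prob_space M for M :: "'w measure" +
  fixes V :: "nat \<Rightarrow> 'w \<Rightarrow> 'a::euclidean_space" and \<kappa> :: "'a \<Rightarrow> 'a measure" and Lp :: real
    and F :: "'a \<Rightarrow> 'b::euclidean_space \<Rightarrow> 'b" and u :: "nat \<Rightarrow> 'w \<Rightarrow> 'b" and u0 :: 'b
    and U :: "'b set" and Du :: "'b \<Rightarrow> 'b \<Rightarrow> real" and \<Phi> :: "'a \<Rightarrow> 'b \<Rightarrow> 'b"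
    and A r c \<Delta> \<delta> :: real
  assumes chain: "markov_chain M V \<kappa>"
    and Lp: "0 \<le> Lp" and W: "\<And>w w'. wass2 (\<kappa> w) (\<kappa> w') \<le> ennreal (Lp * infnorm (w - w'))"
    and V_bdd: "\<And>t. AE \<omega> in M. infnorm (V t \<omega>) \<le> 1"
    and F_cont: "continuous_on UNIV (\<lambda>p. F (fst p) (snd p))"
    and u_0: "\<And>\<omega>. u 0 \<omega> = u0" and u_Suc: "\<And>t \<omega>. u (Suc t) \<omega> = F (V t \<omega>) (u t \<omega>)"
    and U: "u0 \<in> U" "closed U"
    and \<Phi>_F: "\<And>w e. infnorm w \<le> 1 \<Longrightarrow> \<Phi> w e = F w e"
    and \<Phi>_U: "\<And>w e. e \<in> U \<Longrightarrow> \<Phi> w e \<in> U"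
    and \<Phi>_meas: "(\<lambda>p. \<Phi> (fst p) (snd p)) \<in> borel_measurable borel"
    and Du: "\<And>e e'. e \<in> U \<Longrightarrow> e' \<in> U \<Longrightarrow> Du e e' \<le> \<Delta>"
      "\<And>e e'. e \<in> U \<Longrightarrow> e' \<in> U \<Longrightarrow> \<delta> * dist e e' \<le> Du e e'" "0 < \<delta>" "\<And>e. Du e e = 0"
    and contr: "\<And>w w' e e'. e \<in> U \<Longrightarrow> e' \<in> U \<Longrightarrow>
      Du (\<Phi> w e) (\<Phi> w' e') \<le> r * Du e e' + c * infnorm (w - w')"
    and r: "0 < r" "r < 1" and A: "0 < A" "A * Lp + c \<le> r * A"
begin

lemma V_meas [measurable]: "V t \<in> borel_measurable M"
  using chain by (simp add: markov_chain_def)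

lemma kernel_meas: "\<kappa> \<in> borel \<rightarrow>\<^sub>M prob_algebra borel"
  using chain by (simp add: markov_chain_def)

lemma kernel_meas_subprob [measurable]: "\<kappa> \<in> borel \<rightarrow>\<^sub>M subprob_algebra borel"
  by (rule measurable_prob_algebraD[OF kernel_meas])

lemma kernel_prob: "prob_space (\<kappa> w)" and kernel_sets [measurable_cong]: "sets (\<kappa> w) = sets borel"
  using measurable_space[OF kernel_meas, of w] by (auto simp: space_prob_algebra)

lemma F_meas [measurable]: "(\<lambda>p. F (fst p) (snd p)) \<in> borel_measurable (borel \<Otimes>\<^sub>M borel)"
  using borel_measurable_continuous_onI[OF F_cont] by (simp add: borel_prod)

text \<open>The value at time \<open>Suc t\<close> uses the driving chain only up to time
  \<open>t\<close>. This shift allows the Markov property to be applied to \<open>V (Suc t)\<close>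
  with \<open>u (Suc t)\<close> frozen.\<close>

lemma u_past: "u (Suc t) \<in> past M V t \<rightarrow>\<^sub>M borel"
proof (induction t)
  case 0
  have "V 0 \<in> past M V 0 \<rightarrow>\<^sub>M borel" by (rule measurable_past[OF V_meas]) simp
  then have "(\<lambda>\<omega>. (V 0 \<omega>, u0)) \<in> past M V 0 \<rightarrow>\<^sub>M borel \<Otimes>\<^sub>M borel" by simp
  from measurable_compose[OF this F_meas] show ?case by (simp add: u_Suc u_0)
next
  case (Suc t)
  have "V (Suc t) \<in> past M V (Suc t) \<rightarrow>\<^sub>M borel" by (rule measurable_past[OF V_meas]) simp
  moreover have "u (Suc t) \<in> past M V (Suc t) \<rightarrow>\<^sub>M borel"
    by (rule measurable_from_subalg[OF subalgebra_past_Suc[OF V_meas] Suc])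
  ultimately have "(\<lambda>\<omega>. (V (Suc t) \<omega>, u (Suc t) \<omega>)) \<in> past M V (Suc t) \<rightarrow>\<^sub>M borel \<Otimes>\<^sub>M borel" by simp
  from measurable_compose[OF this F_meas] show ?case by (simp add: u_Suc)
qed

lemma u_meas [measurable]: "u t \<in> borel_measurable M"
proof (cases t)
  case 0 then show ?thesis by (simp add: u_0[abs_def])
next
  case (Suc s)
  then show ?thesis using measurable_from_subalg[OF subalgebra_past[OF V_meas] u_past] by blast
qed

lemma u_in_U: "AE \<omega> in M. u t \<omega> \<in> U"
proof (induction t)
  case 0 then show ?case by (simp add: u_0 U)
next
  case (Suc t)
  then show ?case using V_bdd[of t]
    by eventually_elim (metis u_Suc \<Phi>_F \<Phi>_U)
qed

lemma joint_meas [measurable]: "(\<lambda>\<omega>. (V t \<omega>, u t \<omega>)) \<in> borel_measurable M"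
  by (simp add: borel_prod[symmetric])

text \<open>Lipschitz in the combined distance of the locale. The driven component is restricted to
  the invariant set, whereas the driving component ranges over the whole space, since the kernel
  integrates over all of it.\<close>

definition lip_class :: "real \<Rightarrow> real \<Rightarrow> ('a \<times> 'b \<Rightarrow> real) set" where
  "lip_class B l = {g \<in> borel_measurable borel. (\<forall>p. \<bar>g p\<bar> \<le> B) \<and>
     (\<forall>w w' e e'. e \<in> U \<longrightarrow> e' \<in> U \<longrightarrow> \<bar>g (w, e) - g (w', e')\<bar> \<le> l * (A * infnorm (w - w') + Du e e'))}"

lemma transition_integral_meas:
  fixes g :: "'a \<times> 'b \<Rightarrow> real" and G :: "'a \<Rightarrow> 'b \<Rightarrow> 'b"
  assumes [measurable]: "(\<lambda>p. G (fst p) (snd p)) \<in> borel_measurable (borel \<Otimes>\<^sub>M borel)"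
    and g: "g \<in> borel_measurable borel"
  shows "(\<lambda>p. \<integral>w. g (w, G (fst p) (snd p)) \<partial>\<kappa> (fst p)) \<in> borel_measurable borel"
proof -
  have [measurable]: "g \<in> borel_measurable (borel \<Otimes>\<^sub>M borel)" using g by (simp add: borel_prod)
  let ?K = "\<lambda>p. distr (\<kappa> (fst p)) (borel \<Otimes>\<^sub>M borel) (\<lambda>w. (w, G (fst p) (snd p)))"
  have "?K \<in> (borel \<Otimes>\<^sub>M borel) \<rightarrow>\<^sub>M subprob_algebra (borel \<Otimes>\<^sub>M borel)"
    by (rule measurable_distr2[where M=borel]) measurable
  then have "(\<lambda>p. \<integral>q. g q \<partial>?K p) \<in> borel_measurable (borel \<Otimes>\<^sub>M borel)"
    by (rule measurable_compose[OF _ integral_measurable_subprob_algebra]) measurable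
  also have "(\<lambda>p. \<integral>q. g q \<partial>?K p) = (\<lambda>p. \<integral>w. g (w, G (fst p) (snd p)) \<partial>\<kappa> (fst p))"
    by (subst integral_distr) auto
  finally show ?thesis by (simp only: borel_prod)
qed

lemma one_step:
  fixes g :: "'a \<times> 'b \<Rightarrow> real"
  assumes g: "g \<in> borel_measurable borel" "\<And>p. \<bar>g p\<bar> \<le> B"
  shows "(\<integral>\<omega>. g (V (Suc t) \<omega>, u (Suc t) \<omega>) \<partial>M) = (\<integral>\<omega>. (\<integral>w. g (w, F (V t \<omega>) (u t \<omega>)) \<partial>\<kappa> (V t \<omega>)) \<partial>M)"
  using markov_chain_one_step[OF prob_space_axioms chain u_past g(1), where B=B] g(2) by (simp add: u_Suc)

lemma abs_kernel_integral_le: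
  fixes g :: "'a \<Rightarrow> real"
  assumes [measurable]: "g \<in> borel_measurable borel" and B: "\<And>p. \<bar>g p\<bar> \<le> B"
  shows "\<bar>\<integral>w. g w \<partial>\<kappa> v\<bar> \<le> B"
proof -
  interpret K: prob_space "\<kappa> v" by (rule kernel_prob)
  have "\<bar>\<integral>w. g w \<partial>\<kappa> v\<bar> \<le> (\<integral>w. \<bar>g w\<bar> \<partial>\<kappa> v)" by (rule integral_abs_bound)
  also have "\<dots> \<le> (\<integral>w. B \<partial>\<kappa> v)"
    by (rule integral_mono) (use B in \<open>auto intro!: K.integrable_const_bound[where B=B]\<close>)
  finally show ?thesis by (simp add: K.prob_space)
qed

text \<open>The starting point is changed in two moves. Exchanging the kernel costs
  \<open>l * A * Lp\<close> per unit of input distance, by the Wasserstein assumption; exchanging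
  the updated state costs \<open>l\<close> times the right-hand side of \<open>contr\<close>. The
  choice of \<open>A\<close> bounds the sum by \<open>l * r\<close> times the combined
  distance.\<close>

lemma lip_class_transition:
  assumes g: "g \<in> lip_class B l" and l: "0 \<le> l"
  shows "(\<lambda>p. \<integral>w. g (w, \<Phi> (fst p) (snd p)) \<partial>\<kappa> (fst p)) \<in> lip_class B (l * r)"
proof -
  have gm[measurable]: "g \<in> borel_measurable borel" and gB: "\<And>p. \<bar>g p\<bar> \<le> B"
    and gl: "\<And>w w' e e'. e \<in> U \<Longrightarrow> e' \<in> U \<Longrightarrow> \<bar>g (w, e) - g (w', e')\<bar> \<le> l * (A * infnorm (w - w') + Du e e')"
    using g by (auto simp: lip_class_def)
  have sec[measurable]: "(\<lambda>w. g (w, e)) \<in> borel_measurable borel" for e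
  proof -
    have "(\<lambda>w::'a. (w, e)) \<in> borel \<rightarrow>\<^sub>M borel" by (simp add: borel_prod[symmetric])
    from measurable_compose[OF this gm] show ?thesis .
  qed
  have "\<bar>(\<integral>w. g (w, \<Phi> v e) \<partial>\<kappa> v) - (\<integral>w. g (w, \<Phi> v' e') \<partial>\<kappa> v')\<bar> \<le> l * r * (A * infnorm (v - v') + Du e e')"
    if e: "e \<in> U" "e' \<in> U" for v v' e e'
  proof -
    note eU = \<Phi>_U[OF e(1), of v] \<Phi>_U[OF e(2), of v']
    interpret K: prob_space "\<kappa> v'" by (rule kernel_prob)
    have int: "integrable (\<kappa> v') (\<lambda>w. g (w, e))" for e
      by (rule K.integrable_const_bound[where B=B]) (use gB in auto)
    have "\<bar>(\<integral>w. g (w, \<Phi> v e) \<partial>\<kappa> v) - (\<integral>w. g (w, \<Phi> v e) \<partial>\<kappa> v')\<bar> \<le> (l * A) * (Lp * infnorm (v - v'))"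
      by (rule abs_integral_diff_le_wass2[OF kernel_prob kernel_sets kernel_prob kernel_sets W _ sec])
        (use gB gl[OF eU(1) eU(1)] Du(4) l A Lp in \<open>auto simp: infnorm_pos_le mult.assoc\<close>)
    moreover have "\<bar>(\<integral>w. g (w, \<Phi> v e) \<partial>\<kappa> v') - (\<integral>w. g (w, \<Phi> v' e') \<partial>\<kappa> v')\<bar> \<le> l * Du (\<Phi> v e) (\<Phi> v' e')"
    proof -
      have "\<bar>(\<integral>w. g (w, \<Phi> v e) \<partial>\<kappa> v') - (\<integral>w. g (w, \<Phi> v' e') \<partial>\<kappa> v')\<bar>
          = \<bar>\<integral>w. g (w, \<Phi> v e) - g (w, \<Phi> v' e') \<partial>\<kappa> v'\<bar>" using int by simp
      also have "\<dots> \<le> (\<integral>w. \<bar>g (w, \<Phi> v e) - g (w, \<Phi> v' e')\<bar> \<partial>\<kappa> v')" by (rule integral_abs_bound)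
      also have "\<dots> \<le> (\<integral>w. l * Du (\<Phi> v e) (\<Phi> v' e') \<partial>\<kappa> v')"
        by (rule integral_mono) (use int gl[OF eU] in \<open>auto simp: infnorm_0\<close>, metis (no_types) add_0 diff_self infnorm_0 mult_zero_right)
      finally show ?thesis by (simp add: K.prob_space)
    qed
    moreover have "l * Du (\<Phi> v e) (\<Phi> v' e') \<le> l * (r * Du e e' + c * infnorm (v - v'))"
      using contr[OF e] l by (intro mult_left_mono) auto
    moreover have "l * ((A * Lp + c) * infnorm (v - v')) \<le> l * (r * A * infnorm (v - v'))"
      using A l by (intro mult_left_mono mult_right_mono) (auto simp: infnorm_pos_le)
    ultimately show ?thesis by (simp add: algebra_simps)
  qed
  then show ?thesis
    unfolding lip_class_def using transition_integral_meas[of \<Phi> g] \<Phi>_meas gm gB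
    by (auto simp: borel_prod intro!: abs_kernel_integral_le)
qed

end

section \<open>Geometric mixing of Lipschitz observables\<close>

context driven_chain
begin

lemma lip_classD:
  assumes "g \<in> lip_class B l"
  shows "g \<in> borel_measurable borel" "\<bar>g p\<bar> \<le> B"
    "e \<in> U \<Longrightarrow> e' \<in> U \<Longrightarrow> \<bar>g (w, e) - g (w', e')\<bar> \<le> l * (A * infnorm (w - w') + Du e e')"
  using assms unfolding lip_class_def by blast+

text \<open>By time homogeneity one observable \<open>G\<close> serves every starting time
  \<open>t\<close>; the comparison of different times in the mixing estimate rests on this. Under
  the integral \<open>F\<close> may be exchanged for \<open>\<Phi>\<close>, as the trajectory is
  almost surely in the unit box.\<close>

lemma iterated_transition:
  assumes g: "g \<in> lip_class B l" and l: "0 \<le> l"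
  shows "\<exists>G\<in>lip_class B (l * r ^ n). \<forall>t.
    (\<integral>\<omega>. g (V (t + n) \<omega>, u (t + n) \<omega>) \<partial>M) = (\<integral>\<omega>. G (V t \<omega>, u t \<omega>) \<partial>M)"
proof (induction n)
  case 0 then show ?case using g by auto
next
  case (Suc n)
  then obtain G where G: "G \<in> lip_class B (l * r ^ n)"
    and eq: "\<And>t. (\<integral>\<omega>. g (V (t + n) \<omega>, u (t + n) \<omega>) \<partial>M) = (\<integral>\<omega>. G (V t \<omega>, u t \<omega>) \<partial>M)" by blast
  define H where "H = (\<lambda>p. \<integral>w. G (w, \<Phi> (fst p) (snd p)) \<partial>\<kappa> (fst p))"
  have H: "H \<in> lip_class B (l * r ^ Suc n)"
    using lip_class_transition[OF G] l r by (simp add: H_def mult.assoc mult.commute mult.left_commute)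
  have "(\<integral>\<omega>. g (V (t + Suc n) \<omega>, u (t + Suc n) \<omega>) \<partial>M) = (\<integral>\<omega>. H (V t \<omega>, u t \<omega>) \<partial>M)" for t
  proof -
    have "(\<integral>\<omega>. g (V (t + Suc n) \<omega>, u (t + Suc n) \<omega>) \<partial>M) = (\<integral>\<omega>. G (V (Suc t) \<omega>, u (Suc t) \<omega>) \<partial>M)"
      using eq[of "Suc t"] by (simp only: add_Suc_shift)
    also have "\<dots> = (\<integral>\<omega>. (\<integral>w. G (w, F (V t \<omega>) (u t \<omega>)) \<partial>\<kappa> (V t \<omega>)) \<partial>M)"
      by (rule one_step) (use lip_classD[OF G] in auto)
    also have "\<dots> = (\<integral>\<omega>. H (V t \<omega>, u t \<omega>) \<partial>M)"
    proof (rule integral_cong_AE)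
      have "(\<lambda>p. \<integral>w. G (w, F (fst p) (snd p)) \<partial>\<kappa> (fst p)) \<in> borel_measurable borel"
        using lip_classD(1)[OF G] by (intro transition_integral_meas) auto
      from measurable_compose[OF joint_meas this]
      show "(\<lambda>\<omega>. \<integral>w. G (w, F (V t \<omega>) (u t \<omega>)) \<partial>\<kappa> (V t \<omega>)) \<in> borel_measurable M" by simp
      show "(\<lambda>\<omega>. H (V t \<omega>, u t \<omega>)) \<in> borel_measurable M"
        using measurable_compose[OF joint_meas lip_classD(1)[OF H]] by simp
      show "AE \<omega> in M. (\<integral>w. G (w, F (V t \<omega>) (u t \<omega>)) \<partial>\<kappa> (V t \<omega>)) = H (V t \<omega>, u t \<omega>)"
        using V_bdd[of t] by eventually_elim (simp add: H_def \<Phi>_F)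
    qed
    finally show ?thesis .
  qed
  with H show ?case by blast
qed

lemma lip_class_integrable:
  assumes "g \<in> lip_class B l"
  shows "integrable M (\<lambda>\<omega>. g (V t \<omega>, u t \<omega>))"
  by (rule integrable_const_bound[where B=B])
    (use lip_classD[OF assms] measurable_compose[OF joint_meas lip_classD(1)[OF assms]] in auto)

text \<open>After \<open>n\<close> backward steps the observable deviates from its value at
  \<open>(0, u0)\<close> by at most \<open>l * r ^ n * (A + \<Delta>)\<close> on the states that
  occur. The expectations at times \<open>m + n\<close> and \<open>0 + n\<close> are both that close
  to one number, whence the factor 2.\<close>

lemma mixing:
  assumes g: "g \<in> lip_class B l" and l: "0 \<le> l"
  shows "\<bar>(\<integral>\<omega>. g (V (m + n) \<omega>, u (m + n) \<omega>) \<partial>M) - (\<integral>\<omega>. g (V n \<omega>, u n \<omega>) \<partial>M)\<bar> \<le> 2 * l * (A + \<Delta>) * r ^ n"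
proof -
  obtain G where G: "G \<in> lip_class B (l * r ^ n)"
    and eq: "\<And>t. (\<integral>\<omega>. g (V (t + n) \<omega>, u (t + n) \<omega>) \<partial>M) = (\<integral>\<omega>. G (V t \<omega>, u t \<omega>) \<partial>M)"
    using iterated_transition[OF g l] by blast
  have lr: "0 \<le> l * r ^ n" using l r by simp
  define a where "a = G (0, u0)"
  define b where "b = l * r ^ n * (A + \<Delta>)"
  have near: "\<bar>(\<integral>\<omega>. G (V t \<omega>, u t \<omega>) \<partial>M) - a\<bar> \<le> b" for t
  proof -
    have "AE \<omega> in M. \<bar>G (V t \<omega>, u t \<omega>) - a\<bar> \<le> b"
      using V_bdd[of t] u_in_U[of t]
    proof eventually_elim
      case (elim \<omega>)
      have "\<bar>G (V t \<omega>, u t \<omega>) - a\<bar> \<le> l * r ^ n * (A * infnorm (V t \<omega> - 0) + Du (u t \<omega>) u0)"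
        unfolding a_def by (rule lip_classD(3)[OF G elim(2) U(1)])
      also have "\<dots> \<le> l * r ^ n * (A * 1 + \<Delta>)"
        using elim A Du(1)[OF elim(2) U(1)] lr by (intro mult_left_mono add_mono) auto
      finally show ?case by (simp add: b_def)
    qed
    then have "\<bar>\<integral>\<omega>. G (V t \<omega>, u t \<omega>) - a \<partial>M\<bar> \<le> b"
      using lip_class_integrable[OF G, of t]
      by (intro order_trans[OF integral_abs_bound] integral_le_const) auto
    then show ?thesis using lip_class_integrable[OF G, of t] by (simp add: prob_space)
  qed
  show ?thesis using near[of m] near[of 0] eq[of m] eq[of 0] unfolding b_def
    by (simp add: algebra_simps)
qed

lemma mixing_limit:
  assumes g: "g \<in> lip_class B l" and l: "0 \<le> l"
    and lim: "(\<lambda>t. \<integral>\<omega>. g (V t \<omega>, u t \<omega>) \<partial>M) \<longlonglongrightarrow> L"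
  shows "\<bar>(\<integral>\<omega>. g (V n \<omega>, u n \<omega>) \<partial>M) - L\<bar> \<le> 2 * l * (A + \<Delta>) * r ^ n"
proof -
  have "(\<lambda>m. \<bar>(\<integral>\<omega>. g (V (m + n) \<omega>, u (m + n) \<omega>) \<partial>M) - (\<integral>\<omega>. g (V n \<omega>, u n \<omega>) \<partial>M)\<bar>)
      \<longlonglongrightarrow> \<bar>L - (\<integral>\<omega>. g (V n \<omega>, u n \<omega>) \<partial>M)\<bar>"
    by (intro tendsto_intros LIMSEQ_ignore_initial_segment[OF lim])
  then have "\<bar>L - (\<integral>\<omega>. g (V n \<omega>, u n \<omega>) \<partial>M)\<bar> \<le> 2 * l * (A + \<Delta>) * r ^ n"
    by (rule LIMSEQ_le_const2) (use mixing[OF g l] in blast)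
  then show ?thesis by (simp add: abs_minus_commute)
qed

lemma mixing_convergent:
  assumes g: "g \<in> lip_class B l" and l: "0 \<le> l"
  shows "convergent (\<lambda>t. \<integral>\<omega>. g (V t \<omega>, u t \<omega>) \<partial>M)"
proof (rule Cauchy_convergent, rule metric_CauchyI)
  fix e :: real assume e: "e > 0"
  define I where "I t = (\<integral>\<omega>. g (V t \<omega>, u t \<omega>) \<partial>M)" for t
  have "(\<lambda>n. 2 * l * (A + \<Delta>) * r ^ n) \<longlonglongrightarrow> 2 * l * (A + \<Delta>) * 0"
    using r by (intro tendsto_intros LIMSEQ_power_zero) auto
  then have "\<forall>\<^sub>F n in sequentially. 2 * l * (A + \<Delta>) * r ^ n < e / 2"
    by (rule order_tendstoD) (use e in simp)
  then obtain n where n: "2 * l * (A + \<Delta>) * r ^ n < e / 2"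
    by (auto simp: eventually_sequentially)
  have near: "\<bar>I m - I n\<bar> < e / 2" if "m \<ge> n" for m
    using mixing[OF g l, of "m - n" n] that n by (simp add: I_def)
  have "dist (I m) (I m') < e" if "m \<ge> n" "m' \<ge> n" for m m'
    using near[OF that(1)] near[OF that(2)] unfolding dist_real_def by linarith
  then show "\<exists>N. \<forall>m\<ge>N. \<forall>n\<ge>N. dist (\<integral>\<omega>. g (V m \<omega>, u m \<omega>) \<partial>M) (\<integral>\<omega>. g (V n \<omega>, u n \<omega>) \<partial>M) < e"
    unfolding I_def by blast
qed

text \<open>Translates Euclidean Lipschitz constants into the combined distance:
  \<open>sqrt DIM('a)\<close> compares the Euclidean with the maximum norm, and
  \<open>\<delta>\<close> compares \<open>Du\<close> with the Euclidean distance from below.\<close>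

lemma lip_class_lipschitz:
  fixes h :: "'a \<times> 'b \<Rightarrow> real"
  assumes B: "\<And>p. \<bar>h p\<bar> \<le> B" and K: "\<And>p q. \<bar>h p - h q\<bar> \<le> K * dist p q"
  shows "h \<in> lip_class B (\<bar>K\<bar> * (sqrt DIM('a) / A + 1 / \<delta>))"
proof -
  have "\<bar>h (w, e) - h (w', e')\<bar> \<le> \<bar>K\<bar> * (sqrt DIM('a) / A + 1 / \<delta>) * (A * infnorm (w - w') + Du e e')"
    if e: "e \<in> U" "e' \<in> U" for w w' e e'
  proof -
    have D0: "0 \<le> Du e e'" using Du(2)[OF e] Du(3) by (meson less_imp_le mult_nonneg_nonneg order_trans zero_le_dist)
    have "\<bar>h (w, e) - h (w', e')\<bar> \<le> \<bar>K\<bar> * dist (w, e) (w', e')"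
      using K[of "(w, e)" "(w', e')"] by (smt (verit) mult_right_mono zero_le_dist)
    also have "dist (w, e) (w', e') \<le> dist w w' + dist e e'"
      by (simp add: dist_Pair_Pair sqrt_sum_squares_le_sum)
    also have "dist w w' \<le> sqrt DIM('a) * infnorm (w - w')"
      using norm_le_infnorm[of "w - w'"] by (simp add: dist_norm)
    also have "dist e e' \<le> Du e e' / \<delta>" using Du(2)[OF e] Du(3) by (simp add: le_divide_eq mult.commute)
    also have "sqrt DIM('a) * infnorm (w - w') + Du e e' / \<delta>
        \<le> (sqrt DIM('a) / A + 1 / \<delta>) * (A * infnorm (w - w') + Du e e')"
    proof -
      have "(a + b) * (x + y) = (a * x + b * y) + (a * y + b * x)" for a b x y :: real
        by (simp add: algebra_simps)
      moreover have "0 \<le> sqrt DIM('a) / A * Du e e' + 1 / \<delta> * (A * infnorm (w - w'))"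
        using A Du(3) D0 by (simp add: infnorm_pos_le)
      moreover have "sqrt DIM('a) / A * (A * infnorm (w - w')) = sqrt DIM('a) * infnorm (w - w')"
        using A by simp
      ultimately show ?thesis by simp
    qed
    finally show ?thesis by (simp add: mult_left_mono mult.assoc)
  qed
  then show ?thesis
    unfolding lip_class_def using B borel_measurable_continuous_onI[OF lipschitz_continuous_on_UNIV[OF K]] by auto
qed

section \<open>The weak limit of the laws of chain and driven state\<close>

definition law :: "nat \<Rightarrow> ('a \<times> 'b) measure" where
  "law t = distr M borel (\<lambda>\<omega>. (V t \<omega>, u t \<omega>))"

lemma law_prob: "prob_space (law t)" and law_sets: "sets (law t) = sets borel"
  by (simp_all add: law_def prob_space_distr)

lemma law_integral:
  fixes g :: "'a \<times> 'b \<Rightarrow> real"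
  assumes "g \<in> borel_measurable borel"
  shows "(\<integral>p. g p \<partial>law t) = (\<integral>\<omega>. g (V t \<omega>, u t \<omega>) \<partial>M)"
  unfolding law_def by (rule integral_distr) (use assms in simp_all)

definition supp :: "('a \<times> 'b) set" where "supp = {w. infnorm w \<le> 1} \<times> U"

lemma closed_supp: "closed supp"
  unfolding supp_def by (intro closed_Times U(2) closed_Collect_le continuous_intros)

lemma law_supp: "AE p in law t. p \<in> supp"
proof -
  have "supp \<in> sets borel" using closed_supp by (rule borel_closed)
  then have "(AE p in law t. p \<in> supp) \<longleftrightarrow> (AE \<omega> in M. (V t \<omega>, u t \<omega>) \<in> supp)"
    unfolding law_def by (subst AE_distr_iff) (auto simp: Collect_mem_eq[of supp])
  moreover have "AE \<omega> in M. (V t \<omega>, u t \<omega>) \<in> supp"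
    using V_bdd[of t] u_in_U[of t] by eventually_elim (simp add: supp_def)
  ultimately show ?thesis by simp
qed

text \<open>Boundedness of \<open>U\<close> is implicit in the locale, through
  \<open>\<delta> * dist e e' \<le> Du e e'\<close> and
  \<open>Du e e' \<le> \<Delta>\<close>.\<close>

lemma bounded_supp: obtains R where "\<And>p. p \<in> supp \<Longrightarrow> norm p \<le> R"
proof -
  have "norm p \<le> sqrt DIM('a) + (norm u0 + \<Delta> / \<delta>)" if "p \<in> supp" for p
  proof -
    have p: "infnorm (fst p) \<le> 1" "snd p \<in> U" using that by (auto simp: supp_def)
    have "norm (fst p) \<le> sqrt DIM('a) * infnorm (fst p)" by (rule norm_le_infnorm)
    also have "\<dots> \<le> sqrt DIM('a) * 1" using p(1) by (intro mult_left_mono) auto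
    finally have "norm (fst p) \<le> sqrt DIM('a)" by simp
    moreover have "dist (snd p) u0 \<le> \<Delta> / \<delta>"
      using Du(1)[OF p(2) U(1)] Du(2)[OF p(2) U(1)] Du(3) by (simp add: le_divide_eq mult.commute)
    then have "norm (snd p) \<le> norm u0 + \<Delta> / \<delta>"
      by (smt (verit) dist_norm norm_triangle_ineq2)
    moreover have "norm p \<le> norm (fst p) + norm (snd p)"
      by (metis norm_Pair_le prod.collapse)
    ultimately show ?thesis by linarith
  qed
  then show ?thesis by (rule that)
qed

lemma limit_law_exists: "\<exists>\<nu>. prob_space \<nu> \<and> sets \<nu> = sets borel \<and> weakly_converges law \<nu>"
proof -
  obtain R where R: "\<And>p. p \<in> supp \<Longrightarrow> norm p \<le> R" using bounded_supp by blast
  have "AE p in law t. norm p \<le> R" for t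
    using law_supp[of t] by eventually_elim (rule R)
  moreover have "convergent (\<lambda>t. \<integral>p. g p \<partial>law t)"
    if b: "bounded (range g)" and K: "\<And>x y. \<bar>g x - g y\<bar> \<le> K * dist x y" for g K
  proof -
    obtain B where "\<And>p. \<bar>g p\<bar> \<le> B" using b by (auto simp: bounded_iff)
    from lip_class_lipschitz[OF this K]
    have g: "g \<in> lip_class B (\<bar>K\<bar> * (sqrt DIM('a) / A + 1 / \<delta>))" .
    have "0 \<le> \<bar>K\<bar> * (sqrt DIM('a) / A + 1 / \<delta>)" using A Du(3) by simp
    from mixing_convergent[OF g this] show ?thesis
      using law_integral[OF lip_classD(1)[OF g]] by simp
  qed
  ultimately show ?thesis
    by (rule weakly_converges_if_lipschitz_integrals_converge[OF law_prob law_sets]) blast+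
qed

definition limit_law :: "('a \<times> 'b) measure" where
  "limit_law = (SOME \<nu>. prob_space \<nu> \<and> sets \<nu> = sets borel \<and> weakly_converges law \<nu>)"

lemma limit_law_prob: "prob_space limit_law" and limit_law_sets [measurable_cong]: "sets limit_law = sets borel"
  and limit_law_weak: "weakly_converges law limit_law"
  using someI_ex[OF limit_law_exists] by (auto simp: limit_law_def)

lemma limit_law_supp: "AE p in limit_law. p \<in> supp"
proof (rule weakly_converges_AE_closed[OF limit_law_weak limit_law_prob limit_law_sets law_sets closed_supp law_supp])
  have "(0, u0) \<in> supp" by (simp add: supp_def infnorm_0 U)
  then show "supp \<noteq> {}" by blast
qed

text \<open>This is the Feller property. Averaging over the new driving value gives a Lipschitz
  function \<open>\<Psi>\<close>, by the Wasserstein assumption. Composition with \<open>F\<close>,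
  which is only assumed continuous, leaves \<open>Q\<close> bounded and continuous, as weak
  convergence requires. The identity between times \<open>t\<close> and \<open>Suc t\<close> then
  passes to the limit.\<close>

lemma limit_law_invariant:
  fixes h :: "'a \<times> 'b \<Rightarrow> real"
  assumes B: "\<And>p. \<bar>h p\<bar> \<le> B" and K: "\<And>p q. \<bar>h p - h q\<bar> \<le> K * dist p q"
  shows "(\<integral>p. (\<integral>w. h (w, F (fst p) (snd p)) \<partial>\<kappa> (fst p)) \<partial>limit_law) = (\<integral>p. h p \<partial>limit_law)"
proof -
  have K': "\<bar>h p - h q\<bar> \<le> \<bar>K\<bar> * dist p q" for p q
    using K[of p q] by (smt (verit) mult_right_mono zero_le_dist)
  have hc: "continuous_on UNIV h" by (rule lipschitz_continuous_on_UNIV[OF K])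
  have hm: "h \<in> borel_measurable borel" by (rule borel_measurable_continuous_onI[OF hc])
  have sec[measurable]: "(\<lambda>w. h (w, e)) \<in> borel_measurable borel" for e
  proof -
    have "(\<lambda>w::'a. (w, e)) \<in> borel \<rightarrow>\<^sub>M borel" by (simp add: borel_prod[symmetric])
    from measurable_compose[OF this hm] show ?thesis .
  qed
  define \<Psi> where "\<Psi> p = (\<integral>w. h (w, snd p) \<partial>\<kappa> (fst p))" for p
  define C where "C = \<bar>K\<bar> * sqrt DIM('a)"
  have C: "0 \<le> C" by (simp add: C_def)
  have "\<bar>\<Psi> p - \<Psi> q\<bar> \<le> (C * Lp + \<bar>K\<bar>) * dist p q" for p q
  proof -
    interpret K: prob_space "\<kappa> (fst q)" by (rule kernel_prob)
    have int: "integrable (\<kappa> (fst q)) (\<lambda>w. h (w, e))" for e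
      by (rule K.integrable_const_bound[where B=B]) (use B in auto)
    have "\<bar>(\<integral>w. h (w, snd p) \<partial>\<kappa> (fst p)) - (\<integral>w. h (w, snd p) \<partial>\<kappa> (fst q))\<bar> \<le> C * (Lp * infnorm (fst p - fst q))"
    proof (rule abs_integral_diff_le_wass2[OF kernel_prob kernel_sets kernel_prob kernel_sets W _ sec])
      show "\<bar>h (w, snd p) - h (w', snd p)\<bar> \<le> C * infnorm (w - w')" for w w'
      proof -
        have "\<bar>h (w, snd p) - h (w', snd p)\<bar> \<le> \<bar>K\<bar> * norm (w - w')"
          using K'[of "(w, snd p)" "(w', snd p)"] by (simp add: dist_Pair_Pair dist_norm)
        also have "\<dots> \<le> \<bar>K\<bar> * (sqrt DIM('a) * infnorm (w - w'))"
          by (intro mult_left_mono norm_le_infnorm) simp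
        finally show ?thesis by (simp add: C_def mult.assoc)
      qed
    qed (use Lp C B in \<open>auto simp: infnorm_pos_le\<close>)
    also have "\<dots> \<le> C * (Lp * dist p q)"
      using C Lp infnorm_le_norm[of "fst p - fst q"] dist_fst_le[of p q]
      by (intro mult_left_mono) (auto simp: dist_norm)
    finally have 1: "\<bar>(\<integral>w. h (w, snd p) \<partial>\<kappa> (fst p)) - (\<integral>w. h (w, snd p) \<partial>\<kappa> (fst q))\<bar> \<le> C * Lp * dist p q"
      by (simp add: mult.assoc)
    have "\<bar>(\<integral>w. h (w, snd p) \<partial>\<kappa> (fst q)) - (\<integral>w. h (w, snd q) \<partial>\<kappa> (fst q))\<bar>
        = \<bar>\<integral>w. h (w, snd p) - h (w, snd q) \<partial>\<kappa> (fst q)\<bar>" using int by simp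
    also have "\<dots> \<le> (\<integral>w. \<bar>h (w, snd p) - h (w, snd q)\<bar> \<partial>\<kappa> (fst q))" by (rule integral_abs_bound)
    also have "\<dots> \<le> (\<integral>w. \<bar>K\<bar> * dist (snd p) (snd q) \<partial>\<kappa> (fst q))"
    proof (rule integral_mono)
      show "\<bar>h (w, snd p) - h (w, snd q)\<bar> \<le> \<bar>K\<bar> * dist (snd p) (snd q)" for w
        using K'[of "(w, snd p)" "(w, snd q)"] by (simp add: dist_Pair_Pair)
    qed (use int in auto)
    also have "\<dots> \<le> \<bar>K\<bar> * dist p q"
      using dist_snd_le[of p q] by (simp add: K.prob_space mult_left_mono)
    finally show ?thesis using 1 unfolding \<Psi>_def by (simp add: distrib_right)
  qed
  then have \<Psi>c: "continuous_on UNIV \<Psi>" by (rule lipschitz_continuous_on_UNIV)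
  define Q where "Q p = (\<integral>w. h (w, F (fst p) (snd p)) \<partial>\<kappa> (fst p))" for p
  have "continuous_on UNIV (\<lambda>p. (fst p, F (fst p) (snd p)))"
    using F_cont by (intro continuous_intros) simp
  from continuous_on_compose2[OF \<Psi>c this] have Qc: "continuous_on UNIV Q"
    by (simp add: Q_def[abs_def] \<Psi>_def)
  have Qm: "Q \<in> borel_measurable borel" by (rule borel_measurable_continuous_onI[OF Qc])
  have "\<bar>Q p\<bar> \<le> B" for p
    unfolding Q_def by (rule abs_kernel_integral_le) (use B in auto)
  then have "bounded (range Q)" by (auto simp: bounded_iff)
  then have "(\<lambda>t. \<integral>p. Q p \<partial>law t) \<longlonglongrightarrow> (\<integral>p. Q p \<partial>limit_law)"
    using limit_law_weak Qc by (simp add: weakly_converges_def)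
  moreover have "(\<integral>p. Q p \<partial>law t) = (\<integral>p. h p \<partial>law (Suc t))" for t
    using one_step[OF hm B, of t] by (simp add: law_integral hm Qm) (simp add: Q_def)
  moreover have "(\<lambda>t. \<integral>p. h p \<partial>law (Suc t)) \<longlonglongrightarrow> (\<integral>p. h p \<partial>limit_law)"
  proof (rule LIMSEQ_Suc)
    have "bounded (range h)" using B by (auto simp: bounded_iff)
    then show "(\<lambda>t. \<integral>p. h p \<partial>law t) \<longlonglongrightarrow> (\<integral>p. h p \<partial>limit_law)"
      using limit_law_weak hc by (simp add: weakly_converges_def)
  qed
  ultimately have "(\<integral>p. Q p \<partial>limit_law) = (\<integral>p. h p \<partial>limit_law)"
    using LIMSEQ_unique by simp
  then show ?thesis by (simp add: Q_def)
qed

end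

section \<open>Adding independent noise\<close>

lemma prod_borel_measurable_section:
  fixes g :: "'a::euclidean_space \<times> 'b::euclidean_space \<Rightarrow> real"
  assumes g: "g \<in> borel_measurable borel"
  shows "(\<lambda>x. g (x, y)) \<in> borel_measurable borel" "(\<lambda>y. g (x, y)) \<in> borel_measurable borel"
proof -
  have "(\<lambda>x::'a. (x, y)) \<in> borel \<rightarrow>\<^sub>M borel" "(\<lambda>y::'b. (x, y)) \<in> borel \<rightarrow>\<^sub>M borel"
    by (simp_all add: borel_prod[symmetric])
  from this[THEN measurable_compose, OF g]
  show "(\<lambda>x. g (x, y)) \<in> borel_measurable borel" "(\<lambda>y. g (x, y)) \<in> borel_measurable borel" by auto
qed

text \<open>The noise never enters the recursion, so it is attached to a driven chain from outside.
  Convexity of \<open>U\<close> provides a continuous retraction onto \<open>U\<close>, the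
  nearest-point projection.\<close>

locale noisy_driven_chain = driven_chain M V \<kappa> Lp F u u0 U Du \<Phi> A r c \<Delta> \<delta>
  for M :: "'w measure" and V :: "nat \<Rightarrow> 'w \<Rightarrow> 'a::euclidean_space" and \<kappa> Lp
    and F :: "'a \<Rightarrow> 'b::euclidean_space \<Rightarrow> 'b" and u u0 U Du \<Phi> A r c \<Delta> \<delta> +
  fixes \<eta> :: "nat \<Rightarrow> 'w \<Rightarrow> real" and N :: "real measure"
  assumes \<eta>_meas [measurable]: "\<And>t. \<eta> t \<in> borel_measurable M"
    and \<eta>_law: "\<And>t. distr M borel (\<eta> t) = N"
    and indep: "indep_set (sets (vimage_algebra (space M) (\<lambda>\<omega> t. V t \<omega>) (\<Pi>\<^sub>M t\<in>UNIV. borel)))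
       (sets (vimage_algebra (space M) (\<lambda>\<omega> t. \<eta> t \<omega>) (\<Pi>\<^sub>M t\<in>UNIV. borel)))"
    and U_convex: "convex U"
begin

lemma N_prob: "prob_space N" and N_sets [measurable_cong]: "sets N = sets borel"
  unfolding \<eta>_law[of 0, symmetric] by (auto intro: prob_space_distr)

lemma vimage_algebra_component:
  fixes X :: "nat \<Rightarrow> 'w \<Rightarrow> 'c::topological_space"
  shows "X t \<in> vimage_algebra (space M) (\<lambda>\<omega> t. X t \<omega>) (\<Pi>\<^sub>M t\<in>UNIV. borel) \<rightarrow>\<^sub>M borel"
proof -
  have "(\<lambda>\<omega> t. X t \<omega>) \<in> vimage_algebra (space M) (\<lambda>\<omega> t. X t \<omega>) (\<Pi>\<^sub>M t\<in>UNIV. borel) \<rightarrow>\<^sub>M (\<Pi>\<^sub>M t\<in>UNIV. borel)"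
    by (rule measurable_vimage_algebra1) (auto simp: space_PiM)
  from measurable_compose[OF this measurable_component_singleton[of t UNIV]] show ?thesis by simp
qed

text \<open>The pair of \<open>V t\<close> and \<open>u t\<close> is a function of the whole path of
  \<open>V\<close>, hence measurable for the path sigma-algebra, which is independent of the noise.
  Therefore the joint law factorizes.\<close>

lemma joint_law: "distr M borel (\<lambda>\<omega>. ((V t \<omega>, u t \<omega>), \<eta> t \<omega>)) = law t \<Otimes>\<^sub>M N"
proof -
  interpret N: prob_space N by (rule N_prob)
  interpret L: prob_space "law t" by (rule law_prob)
  let ?S = "vimage_algebra (space M) (\<lambda>\<omega> t. V t \<omega>) (\<Pi>\<^sub>M t\<in>UNIV. borel)"
  let ?R = "vimage_algebra (space M) (\<lambda>\<omega> t. \<eta> t \<omega>) (\<Pi>\<^sub>M t\<in>UNIV. borel)"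
  note V[measurable] = vimage_algebra_component[of V]
  have u: "u t \<in> ?S \<rightarrow>\<^sub>M borel" for t
  proof (induction t)
    case 0 then show ?case by (simp add: u_0[abs_def])
  next
    case (Suc t)
    then have "(\<lambda>\<omega>. (V t \<omega>, u t \<omega>)) \<in> ?S \<rightarrow>\<^sub>M borel \<Otimes>\<^sub>M borel" by measurable
    from measurable_compose[OF this F_meas] show ?case by (simp add: u_Suc[abs_def])
  qed
  then have Vu: "(\<lambda>\<omega>. (V t \<omega>, u t \<omega>)) \<in> ?S \<rightarrow>\<^sub>M borel" by (simp add: borel_prod[symmetric])
  have H: "(\<lambda>\<omega>. ((V t \<omega>, u t \<omega>), \<eta> t \<omega>)) \<in> M \<rightarrow>\<^sub>M borel"
    using measurable_Pair[OF joint_meas \<eta>_meas] by (simp add: borel_prod)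
  have sets: "sets (law t \<Otimes>\<^sub>M N) = sets borel"
    using sets_pair_measure_cong[OF law_sets N_sets] by (simp only: borel_prod)
  show ?thesis
  proof (rule pair_measure_eqI[symmetric])
    show "sigma_finite_measure (law t)" "sigma_finite_measure N" ..
    show "sets (law t \<Otimes>\<^sub>M N) = sets (distr M borel (\<lambda>\<omega>. ((V t \<omega>, u t \<omega>), \<eta> t \<omega>)))"
      by (simp add: sets)
    fix A' B assume "A' \<in> sets (law t)" "B \<in> sets N"
    then have A': "A' \<in> sets borel" and B: "B \<in> sets borel" by (simp_all add: law_sets N_sets)
    let ?a = "(\<lambda>\<omega>. (V t \<omega>, u t \<omega>)) -` A' \<inter> space M" and ?b = "\<eta> t -` B \<inter> space M"
    have "?a \<in> sets ?S" "?b \<in> sets ?R"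
      using measurable_sets[OF Vu A'] measurable_sets[OF vimage_algebra_component[of \<eta> t] B] by simp_all
    then have "prob (?a \<inter> ?b) = prob ?a * prob ?b" using indep unfolding indep_sets2_eq by blast
    moreover have "A' \<times> B \<in> sets borel" using A' B by (simp add: borel_prod[symmetric])
    then have "emeasure (distr M borel (\<lambda>\<omega>. ((V t \<omega>, u t \<omega>), \<eta> t \<omega>))) (A' \<times> B) = emeasure M (?a \<inter> ?b)"
      by (subst emeasure_distr[OF H]) (auto intro!: arg_cong[where f="emeasure M"])
    moreover have "emeasure (law t) A' = emeasure M ?a"
      unfolding law_def by (rule emeasure_distr) (use A' in simp_all)
    moreover have "emeasure N B = emeasure M ?b"
      unfolding \<eta>_law[of t, symmetric] by (rule emeasure_distr) (use B in simp_all)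
    ultimately show "emeasure (law t) A' * emeasure N B
        = emeasure (distr M borel (\<lambda>\<omega>. ((V t \<omega>, u t \<omega>), \<eta> t \<omega>))) (A' \<times> B)"
      by (simp add: emeasure_eq_measure ennreal_mult)
  qed
qed

text \<open>Averaging over the noise preserves bounds and Lipschitz constants, so an observable of
  state and noise reduces to one of the state with the same constants.\<close>

lemma noise_average_in_lip_class:
  fixes g :: "('a \<times> 'b) \<times> real \<Rightarrow> real"
  assumes g: "g \<in> borel_measurable borel" and sec: "\<And>y. (\<lambda>p. g (p, y)) \<in> lip_class B l"
  shows "(\<lambda>p. \<integral>y. g (p, y) \<partial>N) \<in> lip_class B l"
proof -
  interpret N: prob_space N by (rule N_prob)
  have gm[measurable]: "g \<in> borel_measurable (borel \<Otimes>\<^sub>M borel)" using g by (simp add: borel_prod)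
  have [measurable]: "(\<lambda>y. g (p, y)) \<in> borel_measurable borel" for p
    by (rule prod_borel_measurable_section(2)[OF g])
  have int: "integrable N (\<lambda>y. g (p, y))" for p
    by (rule N.integrable_const_bound[where B=B]) (use lip_classD(2)[OF sec] in auto)
  have bound: "\<bar>\<integral>y. k y \<partial>N\<bar> \<le> b" if "integrable N k" "\<And>y. \<bar>k y\<bar> \<le> b" for k :: "real \<Rightarrow> real" and b
    by (rule order_trans[OF integral_abs_bound N.integral_le_const]) (use that in auto)
  have "(\<lambda>p. \<integral>y. g (p, y) \<partial>N) \<in> borel_measurable borel"
    by (rule N.borel_measurable_lebesgue_integral) (simp add: gm cong: measurable_cong_sets)
  moreover have "\<bar>(\<integral>y. g ((w, e), y) \<partial>N) - (\<integral>y. g ((w', e'), y) \<partial>N)\<bar> \<le> l * (A * infnorm (w - w') + Du e e')"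
    if "e \<in> U" "e' \<in> U" for w w' e e'
  proof -
    have "(\<integral>y. g ((w, e), y) \<partial>N) - (\<integral>y. g ((w', e'), y) \<partial>N) = (\<integral>y. g ((w, e), y) - g ((w', e'), y) \<partial>N)"
      using int by simp
    then show ?thesis using bound[of "\<lambda>y. g ((w, e), y) - g ((w', e'), y)"] lip_classD(3)[OF sec that] int by simp
  qed
  ultimately show ?thesis
    using bound int lip_classD(2)[OF sec] unfolding lip_class_def by blast
qed

lemma integral_pair_noise:
  fixes P :: "('a \<times> 'b) measure" and g :: "('a \<times> 'b) \<times> real \<Rightarrow> real"
  assumes P: "prob_space P" "sets P = sets borel"
    and g: "g \<in> borel_measurable borel" and B: "\<And>q. \<bar>g q\<bar> \<le> B"
  shows "(\<integral>q. g q \<partial>(P \<Otimes>\<^sub>M N)) = (\<integral>p. (\<integral>y. g (p, y) \<partial>N) \<partial>P)"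
proof -
  interpret N: prob_space N by (rule N_prob)
  interpret P: prob_space P by (rule P)
  interpret PN: pair_prob_space P N ..
  have "sets (P \<Otimes>\<^sub>M N) = sets borel"
    using sets_pair_measure_cong[OF P(2) N_sets] by (simp only: borel_prod)
  then have gm: "g \<in> borel_measurable (P \<Otimes>\<^sub>M N)" using g by (simp cong: measurable_cong_sets)
  have "integrable (P \<Otimes>\<^sub>M N) g" by (rule PN.integrable_const_bound[where B=B]) (use B gm in auto)
  from PN.integral_fst'[OF this] show ?thesis by simp
qed

lemma noise_average_continuous:
  fixes g :: "('a \<times> 'b) \<times> real \<Rightarrow> real"
  assumes g: "continuous_on UNIV g" and B: "\<And>q. \<bar>g q\<bar> \<le> B"
  shows "continuous_on UNIV (\<lambda>p. \<integral>y. g (p, y) \<partial>N)"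
proof -
  interpret N: prob_space N by (rule N_prob)
  have gm: "g \<in> borel_measurable borel" by (rule borel_measurable_continuous_onI[OF g])
  have [measurable]: "(\<lambda>y. g (p, y)) \<in> borel_measurable borel" for p
    by (rule prod_borel_measurable_section(2)[OF gm])
  show ?thesis
  proof (subst continuous_on_sequentially, intro allI ballI impI)
    fix x :: "nat \<Rightarrow> 'a \<times> 'b" and a assume x: "a \<in> UNIV" "(\<forall>n. x n \<in> UNIV) \<and> x \<longlonglongrightarrow> a"
    have "(\<lambda>n. g (x n, y)) \<longlonglongrightarrow> g (a, y)" for y
      by (rule continuous_on_tendsto_compose[OF g]) (use x in \<open>auto intro!: tendsto_intros\<close>)
    then have "(\<lambda>n. \<integral>y. g (x n, y) \<partial>N) \<longlonglongrightarrow> (\<integral>y. g (a, y) \<partial>N)"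
      by (intro integral_dominated_convergence[where w="\<lambda>_. B"]) (use B in auto)
    then show "((\<lambda>p. \<integral>y. g (p, y) \<partial>N) \<circ> x) \<longlonglongrightarrow> (\<integral>y. g (a, y) \<partial>N)" by (simp add: o_def)
  qed
qed

lemma noisy_integral:
  fixes g :: "('a \<times> 'b) \<times> real \<Rightarrow> real"
  assumes g: "g \<in> borel_measurable borel"
  shows "(\<integral>\<omega>. g ((V t \<omega>, u t \<omega>), \<eta> t \<omega>) \<partial>M) = (\<integral>q. g q \<partial>(law t \<Otimes>\<^sub>M N))"
proof -
  have "(\<lambda>\<omega>. ((V t \<omega>, u t \<omega>), \<eta> t \<omega>)) \<in> M \<rightarrow>\<^sub>M borel"
    using measurable_Pair[OF joint_meas \<eta>_meas] by (simp add: borel_prod)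
  from integral_distr[OF this g] show ?thesis by (simp add: joint_law)
qed

text \<open>At each time the joint law is a product with the fixed factor \<open>N\<close>.
  Integrating out the noise therefore reduces the claim to weak convergence of
  \<open>law\<close>.\<close>

lemma noisy_weak_limit:
  fixes g :: "('a \<times> 'b) \<times> real \<Rightarrow> real"
  assumes g: "continuous_on UNIV g" and B: "\<And>q. \<bar>g q\<bar> \<le> B"
  shows "(\<lambda>t. \<integral>\<omega>. g ((V t \<omega>, u t \<omega>), \<eta> t \<omega>) \<partial>M) \<longlonglongrightarrow> (\<integral>q. g q \<partial>(limit_law \<Otimes>\<^sub>M N))"
proof -
  interpret N: prob_space N by (rule N_prob)
  have gm: "g \<in> borel_measurable borel" by (rule borel_measurable_continuous_onI[OF g])
  have [measurable]: "(\<lambda>y. g (p, y)) \<in> borel_measurable borel" for p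
    by (rule prod_borel_measurable_section(2)[OF gm])
  have "\<bar>\<integral>y. g (p, y) \<partial>N\<bar> \<le> B" for p
  proof -
    have "integrable N (\<lambda>y. g (p, y))"
      by (rule N.integrable_const_bound[where B=B]) (use B in auto)
    then show ?thesis
      by (intro order_trans[OF integral_abs_bound N.integral_le_const]) (use B in auto)
  qed
  then have "bounded (range (\<lambda>p. \<integral>y. g (p, y) \<partial>N))" by (auto simp: bounded_iff)
  then have "(\<lambda>t. \<integral>p. (\<integral>y. g (p, y) \<partial>N) \<partial>law t) \<longlonglongrightarrow> (\<integral>p. (\<integral>y. g (p, y) \<partial>N) \<partial>limit_law)"
    using limit_law_weak noise_average_continuous[OF g B] by (simp add: weakly_converges_def)
  then show ?thesis
    by (simp add: noisy_integral[OF gm] integral_pair_noise[OF law_prob law_sets gm B]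
        integral_pair_noise[OF limit_law_prob limit_law_sets gm B])
qed

lemma noisy_limit_supp: "AE q in limit_law \<Otimes>\<^sub>M N. fst q \<in> supp"
proof -
  interpret N: prob_space N by (rule N_prob)
  interpret L: prob_space limit_law by (rule limit_law_prob)
  interpret LN: pair_prob_space limit_law N ..
  have [measurable]: "supp \<in> sets borel" using closed_supp by (rule borel_closed)
  have "{q \<in> space (limit_law \<Otimes>\<^sub>M N). fst q \<in> supp} \<in> sets (limit_law \<Otimes>\<^sub>M N)"
  proof -
    have [measurable]: "supp \<in> sets limit_law" by (simp add: limit_law_sets)
    show ?thesis by measurable
  qed
  then show ?thesis
    by (rule LN.AE_pair_measure) (use limit_law_supp in auto)
qed

text \<open>\<open>lip_class\<close> demands a global bound, whereas \<open>g\<close> is bounded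
  only for network states in \<open>U\<close>. Precomposition with the nearest-point projection
  \<open>\<rho>\<close> gives a globally bounded \<open>k\<close> that equals \<open>g\<close>
  almost surely, both along the trajectory and under the limit law.\<close>

theorem noisy_mixing:
  fixes g :: "('a \<times> 'b) \<times> real \<Rightarrow> real"
  assumes g: "continuous_on UNIV g"
    and B: "\<And>w e y. e \<in> U \<Longrightarrow> \<bar>g ((w, e), y)\<bar> \<le> B"
    and l: "\<And>w w' e e' y. e \<in> U \<Longrightarrow> e' \<in> U \<Longrightarrow>
      \<bar>g ((w, e), y) - g ((w', e'), y)\<bar> \<le> l * (A * infnorm (w - w') + Du e e')" "0 \<le> l"
  shows "integrable M (\<lambda>\<omega>. g ((V n \<omega>, u n \<omega>), \<eta> n \<omega>))"
    and "integrable (limit_law \<Otimes>\<^sub>M N) g"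
    and "\<bar>(\<integral>\<omega>. g ((V n \<omega>, u n \<omega>), \<eta> n \<omega>) \<partial>M) - (\<integral>q. g q \<partial>(limit_law \<Otimes>\<^sub>M N))\<bar> \<le> 2 * l * (A + \<Delta>) * r ^ n"
proof -
  interpret N: prob_space N by (rule N_prob)
  interpret L: prob_space limit_law by (rule limit_law_prob)
  interpret LN: pair_prob_space limit_law N ..
  have gm: "g \<in> borel_measurable borel" by (rule borel_measurable_continuous_onI[OF g])
  define \<rho> where "\<rho> = closest_point U"
  have ne: "U \<noteq> {}" using U(1) by blast
  have \<rho>: "continuous_on UNIV \<rho>" "\<And>e. \<rho> e \<in> U" "\<And>e. e \<in> U \<Longrightarrow> \<rho> e = e"
    unfolding \<rho>_def using continuous_on_closest_point[OF U_convex U(2) ne] closest_point_in_set[OF U(2) ne]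
      closest_point_self by auto
  define k where "k q = g ((fst (fst q), \<rho> (snd (fst q))), snd q)" for q
  have kc: "continuous_on UNIV k"
    unfolding k_def
    by (rule continuous_on_compose2[OF g])
      (auto intro!: continuous_intros continuous_on_compose2[OF \<rho>(1)])
  have km: "k \<in> borel_measurable borel" by (rule borel_measurable_continuous_onI[OF kc])
  have kB: "\<bar>k q\<bar> \<le> B" for q unfolding k_def by (rule B) (rule \<rho>(2))
  have ksec: "(\<lambda>p. k (p, y)) \<in> lip_class B l" for y
    unfolding lip_class_def using kB l(1) \<rho>(3) prod_borel_measurable_section(1)[OF km]
    by (auto simp: k_def)
  have kg: "k ((w, e), y) = g ((w, e), y)" if "e \<in> U" for w e y by (simp add: k_def \<rho>(3)[OF that])
  have H: "(\<lambda>\<omega>. ((V t \<omega>, u t \<omega>), \<eta> t \<omega>)) \<in> M \<rightarrow>\<^sub>M borel" for t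
    using measurable_Pair[OF joint_meas \<eta>_meas] by (simp add: borel_prod)
  have AE_kg: "AE \<omega> in M. k ((V t \<omega>, u t \<omega>), \<eta> t \<omega>) = g ((V t \<omega>, u t \<omega>), \<eta> t \<omega>)" for t
    using u_in_U[of t] by eventually_elim (rule kg)
  have meas: "(\<lambda>\<omega>. g ((V t \<omega>, u t \<omega>), \<eta> t \<omega>)) \<in> borel_measurable M"
    "(\<lambda>\<omega>. k ((V t \<omega>, u t \<omega>), \<eta> t \<omega>)) \<in> borel_measurable M" for t
    using measurable_compose[OF H gm] measurable_compose[OF H km] by auto
  have "integrable M (\<lambda>\<omega>. k ((V n \<omega>, u n \<omega>), \<eta> n \<omega>))"
    by (rule integrable_const_bound[where B=B]) (use kB meas in auto)
  then show "integrable M (\<lambda>\<omega>. g ((V n \<omega>, u n \<omega>), \<eta> n \<omega>))"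
    using integrable_cong_AE[OF meas(2) meas(1) AE_kg] by blast
  have sets: "sets (limit_law \<Otimes>\<^sub>M N) = sets borel"
    using sets_pair_measure_cong[OF limit_law_sets N_sets] by (simp only: borel_prod)
  have AE2: "AE q in limit_law \<Otimes>\<^sub>M N. k q = g q"
    using noisy_limit_supp by eventually_elim (auto simp: supp_def kg)
  have meas2: "g \<in> borel_measurable (limit_law \<Otimes>\<^sub>M N)" "k \<in> borel_measurable (limit_law \<Otimes>\<^sub>M N)"
    using gm km by (simp_all add: sets cong: measurable_cong_sets)
  have "integrable (limit_law \<Otimes>\<^sub>M N) k"
    by (rule LN.integrable_const_bound[where B=B]) (use kB meas2 in auto)
  then show "integrable (limit_law \<Otimes>\<^sub>M N) g"
    using integrable_cong_AE[OF meas2(2) meas2(1) AE2] by blast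
  have eq: "(\<integral>\<omega>. g ((V t \<omega>, u t \<omega>), \<eta> t \<omega>) \<partial>M) = (\<integral>\<omega>. (\<integral>y. k ((V t \<omega>, u t \<omega>), y) \<partial>N) \<partial>M)" for t
  proof -
    have "(\<integral>\<omega>. g ((V t \<omega>, u t \<omega>), \<eta> t \<omega>) \<partial>M) = (\<integral>\<omega>. k ((V t \<omega>, u t \<omega>), \<eta> t \<omega>) \<partial>M)"
      by (rule integral_cong_AE[symmetric]) (use AE_kg meas in auto)
    also have "\<dots> = (\<integral>p. (\<integral>y. k (p, y) \<partial>N) \<partial>law t)"
      using noisy_integral[OF km] integral_pair_noise[OF law_prob law_sets km kB] by simp
    also have "\<dots> = (\<integral>\<omega>. (\<integral>y. k ((V t \<omega>, u t \<omega>), y) \<partial>N) \<partial>M)"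
      by (rule law_integral) (rule lip_classD(1)[OF noise_average_in_lip_class[OF km ksec]])
    finally show ?thesis .
  qed
  have "(\<lambda>t. \<integral>\<omega>. (\<integral>y. k ((V t \<omega>, u t \<omega>), y) \<partial>N) \<partial>M) \<longlonglongrightarrow> (\<integral>q. k q \<partial>(limit_law \<Otimes>\<^sub>M N))"
    using noisy_weak_limit[OF kc kB] integral_cong_AE[OF meas AE_kg[THEN AE_symmetric]]
    by (simp add: eq[symmetric])
  also have "(\<integral>q. k q \<partial>(limit_law \<Otimes>\<^sub>M N)) = (\<integral>q. g q \<partial>(limit_law \<Otimes>\<^sub>M N))"
    by (rule integral_cong_AE[OF meas2(2) meas2(1) AE2])
  finally show "\<bar>(\<integral>\<omega>. g ((V n \<omega>, u n \<omega>), \<eta> n \<omega>) \<partial>M) - (\<integral>q. g q \<partial>(limit_law \<Otimes>\<^sub>M N))\<bar> \<le> 2 * l * (A + \<Delta>) * r ^ n"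
    using mixing_limit[OF noise_average_in_lip_class[OF km ksec] l(2)] unfolding eq by blast
qed

end

section \<open>Stationarity under the kernel that includes the noise\<close>

context noisy_driven_chain
begin

text \<open>In the intended instance \<open>J\<close> and \<open>I\<close> merely rearrange
  components between nested pairs and the state type of the joint process. The new driving value and
  the new noise are drawn independently, while the network state is updated with the old driving
  value.\<close>

definition noisy_kernel ::
  "(('a \<times> 'b) \<times> real \<Rightarrow> 'h::euclidean_space) \<Rightarrow> ('h \<Rightarrow> ('a \<times> 'b) \<times> real) \<Rightarrow> 'h \<Rightarrow> 'h measure" where
  "noisy_kernel J I h = distr (\<kappa> (fst (fst (I h))) \<Otimes>\<^sub>M N) borel
     (\<lambda>(w, y). J ((w, F (fst (fst (I h))) (snd (fst (I h)))), y))"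

context
  fixes J :: "('a \<times> 'b) \<times> real \<Rightarrow> 'h::euclidean_space" and I :: "'h \<Rightarrow> ('a \<times> 'b) \<times> real" and KJ :: real
  assumes J_lip: "\<And>p q. dist (J p) (J q) \<le> KJ * dist p q"
    and I_meas: "I \<in> borel_measurable borel" and IJ: "\<And>q. I (J q) = q"
begin

lemma J_cont: "continuous_on UNIV J"
proof -
  have "dist (J p) (J q) \<le> \<bar>KJ\<bar> * dist p q" for p q
    using J_lip[of p q] by (smt (verit) mult_right_mono zero_le_dist)
  then have "\<bar>KJ\<bar>-lipschitz_on UNIV J" by (intro lipschitz_onI) auto
  then show ?thesis by (rule lipschitz_on_continuous_on)
qed

lemma J_meas [measurable]: "J \<in> borel_measurable ((borel \<Otimes>\<^sub>M borel) \<Otimes>\<^sub>M borel)"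
  using borel_measurable_continuous_onI[OF J_cont] by (simp add: borel_prod)

lemma I_meas' [measurable]: "I \<in> borel \<rightarrow>\<^sub>M ((borel \<Otimes>\<^sub>M borel) \<Otimes>\<^sub>M borel)"
  using I_meas by (simp add: borel_prod)

lemma noisy_kernel_meas: "noisy_kernel J I \<in> borel \<rightarrow>\<^sub>M subprob_algebra borel"
proof -
  interpret N: prob_space N by (rule N_prob)
  have "N \<in> space (subprob_algebra borel)"
    using N_prob N_sets by (simp add: space_subprob_algebra prob_space_imp_subprob_space)
  then have "(\<lambda>h. \<kappa> (fst (fst (I h))) \<Otimes>\<^sub>M N) \<in> borel \<rightarrow>\<^sub>M subprob_algebra (borel \<Otimes>\<^sub>M borel)"
    by (intro measurable_pair_measure measurable_const) measurable
  then show ?thesis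
    unfolding noisy_kernel_def by (intro measurable_distr2[where M="borel \<Otimes>\<^sub>M borel"]) measurable
qed

lemma noisy_kernel_prob: "prob_space (noisy_kernel J I h)"
proof -
  interpret N: prob_space N by (rule N_prob)
  interpret K: prob_space "\<kappa> (fst (fst (I h)))" by (rule kernel_prob)
  interpret KN: pair_prob_space "\<kappa> (fst (fst (I h)))" N ..
  show ?thesis unfolding noisy_kernel_def by (rule KN.P.prob_space_distr) measurable
qed

definition noisy_limit :: "'h measure" where
  "noisy_limit = distr (limit_law \<Otimes>\<^sub>M N) borel J"

lemma pair_sets [measurable_cong]: "sets (limit_law \<Otimes>\<^sub>M N) = sets ((borel \<Otimes>\<^sub>M borel) \<Otimes>\<^sub>M borel)"
  using sets_pair_measure_cong[OF limit_law_sets N_sets] by (simp only: borel_prod)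

lemma J_meas_limit [measurable]: "J \<in> borel_measurable (limit_law \<Otimes>\<^sub>M N)"
  by measurable

lemma noisy_limit_prob: "prob_space noisy_limit"
proof -
  interpret N: prob_space N by (rule N_prob)
  interpret L: prob_space limit_law by (rule limit_law_prob)
  interpret LN: pair_prob_space limit_law N ..
  show ?thesis unfolding noisy_limit_def by (rule LN.P.prob_space_distr) simp
qed

lemma noisy_limit_sets: "sets noisy_limit = sets borel"
  by (simp add: noisy_limit_def)

lemma noisy_limit_weak:
  "weakly_converges (\<lambda>t. distr M borel (\<lambda>\<omega>. J ((V t \<omega>, u t \<omega>), \<eta> t \<omega>))) noisy_limit"
  unfolding weakly_converges_def
proof (intro allI impI)
  fix g :: "'h \<Rightarrow> real" assume g: "continuous_on UNIV g \<and> bounded (range g)"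
  then obtain B where B: "\<And>x. \<bar>g x\<bar> \<le> B" by (auto simp: bounded_iff)
  have gm[measurable]: "g \<in> borel_measurable borel" using g by (intro borel_measurable_continuous_onI) simp
  have "continuous_on UNIV (\<lambda>q. g (J q))" using continuous_on_compose2[of UNIV g UNIV J] g J_cont by simp
  then have "(\<lambda>t. \<integral>\<omega>. g (J ((V t \<omega>, u t \<omega>), \<eta> t \<omega>)) \<partial>M) \<longlonglongrightarrow> (\<integral>q. g (J q) \<partial>(limit_law \<Otimes>\<^sub>M N))"
    by (rule noisy_weak_limit) (rule B)
  moreover have "(\<integral>x. g x \<partial>distr M borel (\<lambda>\<omega>. J ((V t \<omega>, u t \<omega>), \<eta> t \<omega>)))
      = (\<integral>\<omega>. g (J ((V t \<omega>, u t \<omega>), \<eta> t \<omega>)) \<partial>M)" for t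
    by (rule integral_distr) measurable
  moreover have "(\<integral>x. g x \<partial>noisy_limit) = (\<integral>q. g (J q) \<partial>(limit_law \<Otimes>\<^sub>M N))"
    unfolding noisy_limit_def by (rule integral_distr) measurable
  ultimately show "(\<lambda>t. \<integral>x. g x \<partial>distr M borel (\<lambda>\<omega>. J ((V t \<omega>, u t \<omega>), \<eta> t \<omega>))) \<longlonglongrightarrow> (\<integral>x. g x \<partial>noisy_limit)"
    by simp
qed

text \<open>Both sides are compared on bounded Lipschitz functions. Integrating out the new noise
  leaves a bounded Lipschitz function \<open>k\<close> of the state, the old noise does not
  influence the transition, and the invariance of \<open>limit_law\<close> applies to
  \<open>k\<close>.\<close>

lemma noisy_limit_bind: "noisy_limit \<bind> noisy_kernel J I = noisy_limit"
proof -
  interpret N: prob_space N by (rule N_prob)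
  interpret L: prob_space limit_law by (rule limit_law_prob)
  interpret LN: pair_prob_space limit_law N ..
  interpret NL: prob_space noisy_limit by (rule noisy_limit_prob)
  have Km: "noisy_kernel J I \<in> noisy_limit \<rightarrow>\<^sub>M subprob_algebra borel"
    using noisy_kernel_meas by (simp add: noisy_limit_sets cong: measurable_cong_sets)
  have Kp: "noisy_kernel J I \<in> noisy_limit \<rightarrow>\<^sub>M prob_algebra borel"
    by (rule measurable_prob_algebraI[OF noisy_kernel_prob Km])
  have sets: "sets (noisy_limit \<bind> noisy_kernel J I) = sets borel"
    by (rule sets_bind) (auto simp: sets_kernel[OF Km] NL.not_empty)
  show ?thesis
  proof (rule prob_space_eq_if_lipschitz_integrals_eq[OF _ sets noisy_limit_prob noisy_limit_sets])
    show "prob_space (noisy_limit \<bind> noisy_kernel J I)"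
      by (rule prob_space_bind'[OF _ Kp]) (simp add: space_prob_algebra noisy_limit_prob) 
    fix g :: "'h \<Rightarrow> real" and K
    assume "bounded (range g)" and K: "\<And>x y. \<bar>g x - g y\<bar> \<le> K * dist x y"
    then obtain B where B: "\<And>x. \<bar>g x\<bar> \<le> B" by (auto simp: bounded_iff)
    have gm[measurable]: "g \<in> borel_measurable borel"
      by (rule borel_measurable_continuous_onI[OF lipschitz_continuous_on_UNIV[OF K]])
    define h where "h q = g (J q)" for q
    have hB: "\<bar>h q\<bar> \<le> B" for q by (simp add: h_def B)
    have h_lip: "\<bar>h p - h q\<bar> \<le> (\<bar>K\<bar> * \<bar>KJ\<bar>) * dist p q" for p q
    proof -
      have "\<bar>h p - h q\<bar> \<le> \<bar>K\<bar> * dist (J p) (J q)"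
        unfolding h_def using K[of "J p" "J q"] by (smt (verit) mult_right_mono zero_le_dist)
      also have "\<dots> \<le> \<bar>K\<bar> * (\<bar>KJ\<bar> * dist p q)"
        using J_lip[of p q] by (intro mult_left_mono) (smt (verit) mult_right_mono zero_le_dist, simp)
      finally show ?thesis by (simp add: mult.assoc)
    qed
    have hm: "h \<in> borel_measurable borel"
      by (rule borel_measurable_continuous_onI[OF lipschitz_continuous_on_UNIV[OF h_lip]])
    define k where "k p = (\<integral>y. h (p, y) \<partial>N)" for p
    have int: "integrable N (\<lambda>y. h (p, y))" for p
      by (rule N.integrable_const_bound[where B=B])
        (use hB prod_borel_measurable_section(2)[OF hm] in \<open>auto simp: N_sets cong: measurable_cong_sets\<close>)
    have bound: "\<bar>\<integral>y. f y \<partial>N\<bar> \<le> b" if "integrable N f" "\<And>y. \<bar>f y\<bar> \<le> b" for f :: "real \<Rightarrow> real" and b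
      by (rule order_trans[OF integral_abs_bound N.integral_le_const]) (use that in auto)
    have kB: "\<bar>k p\<bar> \<le> B" for p unfolding k_def by (rule bound[OF int hB])
    have k_lip: "\<bar>k p - k q\<bar> \<le> (\<bar>K\<bar> * \<bar>KJ\<bar>) * dist p q" for p q
    proof -
      have "k p - k q = (\<integral>y. h (p, y) - h (q, y) \<partial>N)" unfolding k_def using int by simp
      then show ?thesis
        using bound[of "\<lambda>y. h (p, y) - h (q, y)"] h_lip[of "(p, y)" "(q, y)" for y] int by (simp add: dist_Pair_Pair)
    qed
    have inner: "(\<integral>x. g x \<partial>noisy_kernel J I (J q)) = (\<integral>w. k (w, F (fst (fst q)) (snd (fst q))) \<partial>\<kappa> (fst (fst q)))" for q
    proof -
      let ?v = "fst (fst q)" and ?e = "F (fst (fst q)) (snd (fst q))"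
      interpret K: prob_space "\<kappa> ?v" by (rule kernel_prob)
      interpret KN: pair_prob_space "\<kappa> ?v" N ..
      have "(\<integral>x. g x \<partial>noisy_kernel J I (J q)) = (\<integral>p. h ((fst p, ?e), snd p) \<partial>(\<kappa> ?v \<Otimes>\<^sub>M N))"
        unfolding noisy_kernel_def IJ by (subst integral_distr) (auto simp: h_def split_beta)
      also have "\<dots> = (\<integral>w. (\<integral>y. h ((w, ?e), y) \<partial>N) \<partial>\<kappa> ?v)"
      proof -
        have "integrable (\<kappa> ?v \<Otimes>\<^sub>M N) (\<lambda>p. h ((fst p, ?e), snd p))"
        proof (rule KN.integrable_const_bound[where B=B])
          have [measurable]: "h \<in> borel_measurable ((borel \<Otimes>\<^sub>M borel) \<Otimes>\<^sub>M borel)" using hm by (simp add: borel_prod)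
          show "(\<lambda>p. h ((fst p, ?e), snd p)) \<in> borel_measurable (\<kappa> ?v \<Otimes>\<^sub>M N)" by measurable
        qed (use hB in auto)
        from KN.integral_fst'[OF this] show ?thesis by simp
      qed
      finally show ?thesis by (simp add: k_def)
    qed
    have "(\<integral>x. g x \<partial>(noisy_limit \<bind> noisy_kernel J I)) = (\<integral>x. (\<integral>z. g z \<partial>noisy_kernel J I x) \<partial>noisy_limit)"
    proof (rule integral_bind[OF gm _ Km NL.finite_measure_axioms, of B 1])
      show "AE x in noisy_limit. emeasure (noisy_kernel J I x) (space (noisy_kernel J I x)) \<le> ennreal 1"
        using prob_space.emeasure_space_1[OF noisy_kernel_prob] by simp
    qed (rule B)
    also have "\<dots> = (\<integral>q. (\<integral>z. g z \<partial>noisy_kernel J I (J q)) \<partial>(limit_law \<Otimes>\<^sub>M N))"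
      unfolding noisy_limit_def
      by (rule integral_distr[OF J_meas_limit])
        (rule measurable_compose[OF noisy_kernel_meas integral_measurable_subprob_algebra[OF gm]])
    also have "\<dots> = (\<integral>q. (\<lambda>q. \<integral>w. k (w, F (fst (fst q)) (snd (fst q))) \<partial>\<kappa> (fst (fst q))) q \<partial>(limit_law \<Otimes>\<^sub>M N))"
      by (simp add: inner)
    also have "\<dots> = (\<integral>p. (\<integral>w. k (w, F (fst p) (snd p)) \<partial>\<kappa> (fst p)) \<partial>limit_law)"
    proof -
      have km: "k \<in> borel_measurable borel"
        by (rule borel_measurable_continuous_onI[OF lipschitz_continuous_on_UNIV[OF k_lip]])
      have "(\<lambda>p. \<integral>w. k (w, F (fst p) (snd p)) \<partial>\<kappa> (fst p)) \<in> borel_measurable borel"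
        by (rule transition_integral_meas[OF F_meas km])
      moreover have "(fst :: ('a \<times> 'b) \<times> real \<Rightarrow> _) \<in> borel \<rightarrow>\<^sub>M borel"
        by (simp add: borel_prod[symmetric])
      ultimately have "(\<lambda>q. \<integral>w. k (w, F (fst (fst q)) (snd (fst q))) \<partial>\<kappa> (fst (fst q))) \<in> borel_measurable (borel :: (('a \<times> 'b) \<times> real) measure)"
        by (rule measurable_compose[rotated])
      moreover have "\<bar>\<integral>w. k (w, F (fst (fst q)) (snd (fst q))) \<partial>\<kappa> (fst (fst q))\<bar> \<le> B" for q :: "('a \<times> 'b) \<times> real"
        by (rule abs_kernel_integral_le) (use kB prod_borel_measurable_section(1)[OF km] in auto)
      ultimately show ?thesis
        by (subst integral_pair_noise[OF limit_law_prob limit_law_sets]) (simp_all add: N.prob_space)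
    qed
    also have "\<dots> = (\<integral>p. k p \<partial>limit_law)" by (rule limit_law_invariant[OF kB k_lip])
    also have "\<dots> = (\<integral>q. h q \<partial>(limit_law \<Otimes>\<^sub>M N))"
      unfolding k_def by (rule integral_pair_noise[OF limit_law_prob limit_law_sets hm hB, symmetric])
    also have "\<dots> = (\<integral>x. g x \<partial>noisy_limit)"
      unfolding noisy_limit_def h_def by (rule integral_distr[symmetric]) measurable
    finally show "(\<integral>x. g x \<partial>(noisy_limit \<bind> noisy_kernel J I)) = (\<integral>x. g x \<partial>noisy_limit)" .
  qed
qed

lemma noisy_limit_stationary:
  assumes "E \<in> sets borel"
  shows "emeasure noisy_limit E = (\<integral>\<^sup>+h. emeasure (noisy_kernel J I h) E \<partial>noisy_limit)"
proof -
  have "noisy_kernel J I \<in> noisy_limit \<rightarrow>\<^sub>M subprob_algebra borel"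
    using noisy_kernel_meas by (simp add: noisy_limit_sets cong: measurable_cong_sets)
  from emeasure_bind[OF _ this assms] show ?thesis
    using prob_space.not_empty[OF noisy_limit_prob] by (simp add: noisy_limit_bind)
qed

end

end

section \<open>Partial derivatives, integrals and limits\<close>

lemma partial_eqI:
  "((\<lambda>s. F (\<theta> + s *\<^sub>R axis i 1)) has_real_derivative D) (at 0) \<Longrightarrow> partial i F \<theta> = D"
  unfolding partial_def by (rule DERIV_imp_deriv)

lemma has_derivative_axis_line:
  fixes F :: "real^'i::finite \<Rightarrow> real"
  assumes "(F has_derivative F') (at \<theta>)"
  shows "((\<lambda>s. F (\<theta> + s *\<^sub>R axis i 1)) has_real_derivative F' (axis i 1)) (at 0)"
proof -
  have lin: "linear F'" using assms has_derivative_linear by blast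
  have "((\<lambda>s. \<theta> + s *\<^sub>R axis i 1) has_derivative (\<lambda>s. s *\<^sub>R axis i 1)) (at 0)"
    by (auto intro!: derivative_eq_intros)
  from has_derivative_compose[OF this, of F F'] assms
  have "((\<lambda>s. F (\<theta> + s *\<^sub>R axis i 1)) has_derivative (\<lambda>s. F' (s *\<^sub>R axis i 1))) (at 0)" by simp
  then show ?thesis
    by (simp add: has_field_derivative_def linear_scale[OF lin] mult_commute_abs)
qed

lemma partial_has_derivative:
  "(F has_derivative F') (at \<theta>) \<Longrightarrow> partial i F \<theta> = F' (axis i 1)"
  for F :: "real^'i::finite \<Rightarrow> real"
  by (rule partial_eqI[OF has_derivative_axis_line])

lemma differentiable_axis_line:
  fixes F :: "real^'i::finite \<Rightarrow> real"
  assumes "F differentiable (at \<theta>)"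
  shows "((\<lambda>s. F (\<theta> + s *\<^sub>R axis i 1)) has_real_derivative partial i F \<theta>) (at 0)"
  using assms has_derivative_axis_line partial_has_derivative unfolding differentiable_def by metis

lemma has_derivative_partials:
  fixes F :: "real^'i::finite \<Rightarrow> real"
  assumes "F differentiable (at \<theta>)"
  shows "(F has_derivative (\<lambda>h. \<Sum>i\<in>UNIV. partial i F \<theta> * h $ i)) (at \<theta>)"
proof -
  obtain F' where F': "(F has_derivative F') (at \<theta>)" using assms by (auto simp: differentiable_def)
  have lin: "linear F'" using F' has_derivative_linear by blast
  have "F' h = (\<Sum>i\<in>UNIV. partial i F \<theta> * h $ i)" for h
  proof -
    have "F' h = F' (\<Sum>i\<in>UNIV. h $ i *\<^sub>R axis i 1)" using basis_expansion[of h] by (simp add: scalar_mult_eq_scaleR)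
    also have "\<dots> = (\<Sum>i\<in>UNIV. h $ i * F' (axis i 1))"
      by (simp add: linear_sum[OF lin] linear_scale[OF lin])
    finally show ?thesis by (simp add: partial_has_derivative[OF F'] mult.commute)
  qed
  then have "F' = (\<lambda>h. \<Sum>i\<in>UNIV. partial i F \<theta> * h $ i)" by (rule ext)
  with F' show ?thesis by simp
qed

lemma abs_linear_form_le:
  fixes h :: "real^'i::finite"
  assumes "\<And>i. \<bar>p i\<bar> \<le> C"
  shows "\<bar>\<Sum>i\<in>UNIV. p i * h $ i\<bar> \<le> C * real CARD('i) * norm h"
proof -
  have C: "0 \<le> C" using assms[of undefined] by linarith
  have "\<bar>\<Sum>i\<in>UNIV. p i * h $ i\<bar> \<le> (\<Sum>i\<in>UNIV. \<bar>p i * h $ i\<bar>)" by (rule sum_abs)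
  also have "\<dots> \<le> (\<Sum>i\<in>(UNIV::'i set). C * norm h)"
    using assms component_le_norm_cart[of h] C by (intro sum_mono) (auto simp: abs_mult intro!: mult_mono)
  finally show ?thesis by (simp add: mult.commute mult.left_commute)
qed

lemma lipschitz_if_partials_bounded:
  fixes F :: "real^'i::finite \<Rightarrow> real"
  assumes "\<And>\<theta>. F differentiable (at \<theta>)" and C: "\<And>\<theta> i. \<bar>partial i F \<theta>\<bar> \<le> C"
  shows "\<bar>F \<theta> - F \<theta>'\<bar> \<le> C * real CARD('i) * norm (\<theta> - \<theta>')"
proof -
  have "norm (F \<theta> - F \<theta>') \<le> C * real CARD('i) * norm (\<theta> - \<theta>')"
  proof (rule differentiable_bound[of UNIV F "\<lambda>\<theta> h. \<Sum>i\<in>UNIV. partial i F \<theta> * h $ i"])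
    show "(F has_derivative (\<lambda>h. \<Sum>i\<in>UNIV. partial i F x * h $ i)) (at x within UNIV)" for x
      using has_derivative_partials[OF assms(1)] by simp
    show "onorm (\<lambda>h. \<Sum>i\<in>UNIV. partial i F x * h $ i) \<le> C * real CARD('i)" for x
      by (rule onorm_le) (use abs_linear_form_le[OF C] in simp)
  qed auto
  then show ?thesis by simp
qed

text \<open>Frechet differentiation under the integral. By the mean value inequality the remainder
  quotient is at most \<open>2 * C * real CARD('i)\<close> off one null set common to all
  parameters, so dominated convergence applies along every sequence of nonzero increments tending to
  0.\<close>

lemma (in prob_space) has_derivative_integral_partials:
  fixes F :: "real^'i::finite \<Rightarrow> 'a \<Rightarrow> real"
  assumes int: "\<And>\<theta>. integrable M (F \<theta>)"
    and meas: "\<And>i. (\<lambda>\<omega>. partial i (\<lambda>\<theta>. F \<theta> \<omega>) \<theta>) \<in> borel_measurable M"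
    and diff: "\<And>\<omega> \<theta>. (\<lambda>\<theta>. F \<theta> \<omega>) differentiable (at \<theta>)"
    and bdd: "AE \<omega> in M. \<forall>\<theta> i. \<bar>partial i (\<lambda>\<theta>. F \<theta> \<omega>) \<theta>\<bar> \<le> C"
  shows "((\<lambda>\<theta>. \<integral>\<omega>. F \<theta> \<omega> \<partial>M) has_derivative
     (\<lambda>h. \<Sum>i\<in>UNIV. (\<integral>\<omega>. partial i (\<lambda>\<theta>. F \<theta> \<omega>) \<theta> \<partial>M) * h $ i)) (at \<theta>)"
proof -
  let ?P = "\<lambda>i \<omega>. partial i (\<lambda>\<theta>. F \<theta> \<omega>) \<theta>"
  note [measurable] = meas
  have intP: "integrable M (?P i)" for i
    by (rule integrable_const_bound[where B=C]) (use bdd in \<open>auto elim!: eventually_mono\<close>)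
  define R where "R h \<omega> = F (\<theta> + h) \<omega> - F \<theta> \<omega> - (\<Sum>i\<in>UNIV. ?P i \<omega> * h $ i)" for h \<omega>
  have intR: "integrable M (R h)" for h
    unfolding R_def by (intro Bochner_Integration.integrable_diff Bochner_Integration.integrable_sum int intP integrable_mult_left)
  have eqR: "(\<integral>\<omega>. R h \<omega> \<partial>M) = (\<integral>\<omega>. F (\<theta> + h) \<omega> \<partial>M) - (\<integral>\<omega>. F \<theta> \<omega> \<partial>M) - (\<Sum>i\<in>UNIV. (\<integral>\<omega>. ?P i \<omega> \<partial>M) * h $ i)" for h
    unfolding R_def by (simp add: int intP integrable_mult_left Bochner_Integration.integral_sum)
  have bound: "AE \<omega> in M. \<forall>h. \<bar>R h \<omega>\<bar> / norm h \<le> 2 * C * real CARD('i)"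
    using bdd
  proof eventually_elim
    case (elim \<omega>)
    show ?case
    proof
      fix h
      have "\<bar>F (\<theta> + h) \<omega> - F \<theta> \<omega>\<bar> \<le> C * real CARD('i) * norm (\<theta> + h - \<theta>)"
        by (rule lipschitz_if_partials_bounded) (use diff elim in auto)
      moreover have "\<bar>\<Sum>i\<in>UNIV. ?P i \<omega> * h $ i\<bar> \<le> C * real CARD('i) * norm h"
        by (rule abs_linear_form_le) (use elim in auto)
      ultimately have "\<bar>R h \<omega>\<bar> \<le> 2 * C * real CARD('i) * norm h" unfolding R_def by (simp add: abs_if split: if_splits)
      moreover have "0 \<le> C" using elim by (meson abs_ge_zero order_trans)
      ultimately show "\<bar>R h \<omega>\<bar> / norm h \<le> 2 * C * real CARD('i)"
        by (cases "h = 0") (auto simp: divide_le_eq)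
    qed
  qed
  have "(\<lambda>h. norm ((\<integral>\<omega>. F (\<theta> + h) \<omega> \<partial>M) - (\<integral>\<omega>. F \<theta> \<omega> \<partial>M) - (\<Sum>i\<in>UNIV. (\<integral>\<omega>. ?P i \<omega> \<partial>M) * h $ i)) / norm h) \<midarrow>0\<rightarrow> 0"
    unfolding eqR[symmetric]
  proof (rule LIMSEQ_SEQ_conv[THEN iffD1], intro allI impI)
    fix h :: "nat \<Rightarrow> real^'i" assume h: "(\<forall>n. h n \<noteq> 0) \<and> h \<longlonglongrightarrow> 0"
    have lim0: "(\<lambda>n. \<integral>\<omega>. \<bar>R (h n) \<omega>\<bar> / norm (h n) \<partial>M) \<longlonglongrightarrow> (\<integral>\<omega>. 0 \<partial>M)"
    proof (rule integral_dominated_convergence[where w="\<lambda>_. 2 * C * real CARD('i)"])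
      show "(\<lambda>\<omega>. \<bar>R (h n) \<omega>\<bar> / norm (h n)) \<in> borel_measurable M" for n
        using borel_measurable_integrable[OF intR] by measurable
      show "AE \<omega> in M. (\<lambda>n. \<bar>R (h n) \<omega>\<bar> / norm (h n)) \<longlonglongrightarrow> 0"
      proof (rule AE_I2)
        fix \<omega>
        have "(\<lambda>h. norm (R h \<omega>) / norm h) \<midarrow>0\<rightarrow> 0"
          using has_derivative_partials[OF diff[of \<omega> \<theta>]] unfolding has_derivative_at R_def by simp
        then have "(\<lambda>n. norm (R (h n) \<omega>) / norm (h n)) \<longlonglongrightarrow> 0"
          using h LIMSEQ_SEQ_conv[of 0 "\<lambda>h. norm (R h \<omega>) / norm h" 0] by blast
        then show "(\<lambda>n. \<bar>R (h n) \<omega>\<bar> / norm (h n)) \<longlonglongrightarrow> 0" by simp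
      qed
      show "AE \<omega> in M. norm (\<bar>R (h n) \<omega>\<bar> / norm (h n)) \<le> 2 * C * real CARD('i)" for n
        using bound by eventually_elim simp
    qed auto
    show "(\<lambda>n. norm (\<integral>\<omega>. R (h n) \<omega> \<partial>M) / norm (h n)) \<longlonglongrightarrow> 0"
    proof (rule tendsto_sandwich[OF _ _ tendsto_const lim0[unfolded Bochner_Integration.integral_zero]])
      show "\<forall>\<^sub>F n in sequentially. norm (\<integral>\<omega>. R (h n) \<omega> \<partial>M) / norm (h n) \<le> (\<integral>\<omega>. \<bar>R (h n) \<omega>\<bar> / norm (h n) \<partial>M)"
        by (rule always_eventually) (auto intro!: divide_right_mono integral_abs_bound)
    qed auto
  qed
  moreover have "bounded_linear (\<lambda>h. \<Sum>i\<in>UNIV. (\<integral>\<omega>. ?P i \<omega> \<partial>M) * h $ i)"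
    by (intro bounded_linear_sum bounded_linear_mult_right[THEN bounded_linear_compose] bounded_linear_vec_nth)
  ultimately show ?thesis unfolding has_derivative_at by blast
qed

text \<open>A uniform error \<open>\<epsilon> n\<close> in all partials is an error of at most
  \<open>\<epsilon> n * real CARD('i)\<close> in the derivative as a linear map. The classical
  theorem on derivatives of sequences then applies, and the pointwise limits identify the limit
  function with \<open>L\<close>.\<close>

lemma has_derivative_uniform_limit:
  fixes F :: "nat \<Rightarrow> real^'i::finite \<Rightarrow> real"
  assumes diff: "\<And>n \<theta>. F n differentiable (at \<theta>)"
    and G: "\<And>n \<theta> i. \<bar>partial i (F n) \<theta> - G i \<theta>\<bar> \<le> \<epsilon> n" and \<epsilon>: "\<epsilon> \<longlonglongrightarrow> 0"
    and lim: "\<And>\<theta>. (\<lambda>n. F n \<theta>) \<longlonglongrightarrow> L \<theta>"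
  shows "(L has_derivative (\<lambda>h. \<Sum>i\<in>UNIV. G i \<theta> * h $ i)) (at \<theta>)"
proof -
  have "\<exists>g. \<forall>\<theta>\<in>UNIV. (\<lambda>n. F n \<theta>) \<longlonglongrightarrow> g \<theta> \<and>
      (g has_derivative (\<lambda>h. \<Sum>i\<in>UNIV. G i \<theta> * h $ i)) (at \<theta> within UNIV)"
  proof (rule has_derivative_sequence[where f'="\<lambda>n \<theta> h. \<Sum>i\<in>UNIV. partial i (F n) \<theta> * h $ i"])
    show "(F n has_derivative (\<lambda>h. \<Sum>i\<in>UNIV. partial i (F n) x * h $ i)) (at x within UNIV)" for n x
      using has_derivative_partials[OF diff] by simp
    show "(\<lambda>n. F n 0) \<longlonglongrightarrow> L 0" by (rule lim)
    fix e :: real assume e: "e > 0"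
    have "(\<lambda>n. \<epsilon> n * real CARD('i)) \<longlonglongrightarrow> 0 * real CARD('i)" by (intro tendsto_intros \<epsilon>)
    then have "\<forall>\<^sub>F n in sequentially. \<epsilon> n * real CARD('i) < e"
      by (rule order_tendstoD) (use e in simp)
    then show "\<forall>\<^sub>F n in sequentially. \<forall>x\<in>UNIV. \<forall>h. norm ((\<Sum>i\<in>UNIV. partial i (F n) x * h $ i) - (\<Sum>i\<in>UNIV. G i x * h $ i)) \<le> e * norm h"
    proof eventually_elim
      case (elim n)
      show ?case
      proof (intro ballI allI)
        fix x h
        have "(\<Sum>i\<in>UNIV. partial i (F n) x * h $ i) - (\<Sum>i\<in>UNIV. G i x * h $ i)
            = (\<Sum>i\<in>UNIV. (partial i (F n) x - G i x) * h $ i)"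
          by (simp add: sum_subtractf left_diff_distrib)
        also have "\<bar>\<dots>\<bar> \<le> \<epsilon> n * real CARD('i) * norm h" by (rule abs_linear_form_le) (rule G)
        also have "\<dots> \<le> e * norm h" using elim by (intro mult_right_mono) auto
        finally show "norm ((\<Sum>i\<in>UNIV. partial i (F n) x * h $ i) - (\<Sum>i\<in>UNIV. G i x * h $ i)) \<le> e * norm h" by simp
      qed
    qed
  qed auto
  then obtain g where g: "\<And>\<theta>. (\<lambda>n. F n \<theta>) \<longlonglongrightarrow> g \<theta>"
    "\<And>\<theta>. (g has_derivative (\<lambda>h. \<Sum>i\<in>UNIV. G i \<theta> * h $ i)) (at \<theta>)" by auto
  have "g = L" using LIMSEQ_unique[OF g(1) lim] by blast
  then show ?thesis using g(2) by simp
qed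

lemma partial_linear_form:
  fixes F :: "real^'i::finite \<Rightarrow> real"
  assumes "(F has_derivative (\<lambda>h. \<Sum>j\<in>UNIV. G j * h $ j)) (at \<theta>)"
  shows "partial i F \<theta> = G i"
  by (simp add: partial_has_derivative[OF assms] axis_def if_distrib cong: if_cong)

section \<open>Derivatives of the network\<close>

lemma sigmoid_bounds: "0 < sigmoid y" "sigmoid y < 1"
  by (auto simp: sigmoid_def field_simps add_pos_pos)

lemma sigmoid_has_derivative: "(sigmoid has_real_derivative sigmoid y * (1 - sigmoid y)) (at y)"
proof -
  have pos: "1 + exp (- y) > 0" by (simp add: add_pos_pos)
  have "((\<lambda>y. 1 / (1 + exp (- y))) has_real_derivative exp (- y) / (1 + exp (- y))\<^sup>2) (at y)"
    using pos by (auto intro!: derivative_eq_intros simp: power2_eq_square)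
  moreover have "exp (- y) / (1 + exp (- y))\<^sup>2 = sigmoid y * (1 - sigmoid y)"
    using pos by (simp add: sigmoid_def power2_eq_square divide_simps)
  ultimately show ?thesis by (simp add: sigmoid_def[abs_def])
qed

lemma deriv_sigmoid: "deriv sigmoid = (\<lambda>y. sigmoid y * (1 - sigmoid y))"
  using DERIV_imp_deriv[OF sigmoid_has_derivative] by blast

lemma deriv_sigmoid_has_derivative:
  "(deriv sigmoid has_real_derivative sigmoid y * (1 - sigmoid y) * (1 - 2 * sigmoid y)) (at y)"
  unfolding deriv_sigmoid
  by (auto intro!: derivative_eq_intros sigmoid_has_derivative simp: algebra_simps)

lemma deriv2_sigmoid: "deriv (deriv sigmoid) = (\<lambda>y. sigmoid y * (1 - sigmoid y) * (1 - 2 * sigmoid y))"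
  using DERIV_imp_deriv[OF deriv_sigmoid_has_derivative] by blast

text \<open>The product \<open>s * (1 - s)\<close> is largest at \<open>s = 1/2\<close>. This bound
  is the source of the contraction factor \<open>C0 / 4\<close>.\<close>

lemma deriv_sigmoid_bound: "\<bar>deriv sigmoid y\<bar> \<le> 1 / 4"
proof -
  have "0 \<le> (2 * sigmoid y - 1)\<^sup>2" by simp
  then have "sigmoid y * (1 - sigmoid y) \<le> 1 / 4" by (simp add: power2_eq_square algebra_simps)
  then show ?thesis using sigmoid_bounds[of y] by (simp add: deriv_sigmoid abs_mult)
qed

lemma smooth_bounded_has_derivative:
  assumes "smooth_bounded v"
  shows "(v has_real_derivative deriv v y) (at y)"
    "(deriv v has_real_derivative deriv (deriv v) y) (at y)"
    "(deriv (deriv v) has_real_derivative deriv (deriv (deriv v)) y) (at y)"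
proof -
  have d: "((deriv ^^ n) v) differentiable (at y)" for n using assms by (simp add: smooth_bounded_def)
  have "v differentiable (at y)" "deriv v differentiable (at y)" "deriv (deriv v) differentiable (at y)"
    using d[of 0] d[of 1] d[of 2] by (simp_all add: numeral_2_eq_2)
  then show "(v has_real_derivative deriv v y) (at y)"
    "(deriv v has_real_derivative deriv (deriv v) y) (at y)"
    "(deriv (deriv v) has_real_derivative deriv (deriv (deriv v)) y) (at y)"
    by (metis DERIV_imp_deriv real_differentiable_def)+
qed

lemma smooth_bounded_bounds:
  assumes "smooth_bounded v"
  obtains C where "0 \<le> C" "\<And>y. \<bar>v y\<bar> \<le> C" "\<And>y. \<bar>deriv v y\<bar> \<le> C" "\<And>y. \<bar>deriv (deriv v) y\<bar> \<le> C"
proof -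
  have b: "\<exists>C. \<forall>y. \<bar>(deriv ^^ n) v y\<bar> \<le> C" for n
    using assms unfolding smooth_bounded_def bounded_iff by auto
  obtain a b c where "\<And>y. \<bar>v y\<bar> \<le> a" "\<And>y. \<bar>deriv v y\<bar> \<le> b" "\<And>y. \<bar>deriv (deriv v) y\<bar> \<le> c"
    using b[of 0] b[of 1] b[of 2] by (auto simp: numeral_2_eq_2)
  then show ?thesis by (intro that[of "max 0 (max a (max b c))"]) (auto simp: le_max_iff_disj)
qed

lemma coordinate_line_has_derivative:
  fixes \<theta> :: "real^'i::finite"
  assumes "(v has_real_derivative d) (at (\<theta> $ c))"
  shows "((\<lambda>s. v ((\<theta> + s *\<^sub>R axis i 1) $ c)) has_real_derivative (if c = i then d else 0)) (at 0)"
proof (cases "c = i")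
  case True
  have "((\<lambda>s. \<theta> $ c + s) has_real_derivative 1) (at 0)" by (auto intro!: derivative_eq_intros)
  from DERIV_chain2[of v d "\<lambda>s. \<theta> $ c + s" 0, OF _ this] assms True
  show ?thesis by (simp add: axis_def)
qed (simp add: axis_def)

lemma coordinate_differentiable:
  fixes \<theta> :: "real^'i::finite"
  assumes "\<And>y. (v has_real_derivative v' y) (at y)"
  shows "(\<lambda>p. v (p $ c)) differentiable (at \<theta>)"
proof (rule differentiable_compose[where f=v and g="\<lambda>p. p $ c"])
  show "v differentiable (at (\<theta> $ c))" using assms real_differentiable_def by blast
  show "(\<lambda>p. p $ c) differentiable (at \<theta>)"
    by (rule bounded_linear_imp_differentiable[OF bounded_linear_vec_nth])
qed

section \<open>Derivatives of the pre-activation along an axis\<close>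

lemma preact_line:
  fixes \<theta> :: "('d::finite, 'n::finite) param"
  assumes \<phi>: "\<And>y. (\<phi> has_real_derivative deriv \<phi> y) (at y)"
    and s: "\<And>j. ((\<lambda>r. s r $ j) has_real_derivative s1 $ a $ j) (at 0)"
  shows "((\<lambda>r. preact \<phi> (\<theta> + r *\<^sub>R axis (Rec a) 1) x (s r) k) has_real_derivative
     dpreact \<phi> \<theta> x (s 0) s1 a k) (at 0)"
proof -
  note line = coordinate_line_has_derivative[OF \<phi>]
  have "((\<lambda>r. preact \<phi> (\<theta> + r *\<^sub>R axis (Rec a) 1) x (s r) k) has_real_derivative
     1 / real CARD('d) * (\<Sum>j\<in>UNIV. (if Rec (EntA k j) = Rec a then deriv \<phi> (parA \<theta> k j) else 0) * x $ j)
   + 1 / real CARD('n) * (\<Sum>j\<in>UNIV. (if Rec (EntW k j) = Rec a then deriv \<phi> (parW \<theta> k j) else 0) * s 0 $ j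
       + \<phi> (parW \<theta> k j) * s1 $ a $ j)) (at 0)"
    unfolding preact_def
    by (rule derivative_eq_intros line s refl | simp add: algebra_simps)+
  also have "1 / real CARD('d) * (\<Sum>j\<in>UNIV. (if Rec (EntA k j) = Rec a then deriv \<phi> (parA \<theta> k j) else 0) * x $ j)
   + 1 / real CARD('n) * (\<Sum>j\<in>UNIV. (if Rec (EntW k j) = Rec a then deriv \<phi> (parW \<theta> k j) else 0) * s 0 $ j
       + \<phi> (parW \<theta> k j) * s1 $ a $ j) = dpreact \<phi> \<theta> x (s 0) s1 a k"
    unfolding dpreact_def
    by (cases a) (auto simp: sum.distrib distrib_left if_distrib[of "\<lambda>c. c * _"] cong: if_cong)
  finally show ?thesis .
qed

text \<open>The direct term \<open>T\<close> yields the second derivative of \<open>\<phi>\<close>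
  when \<open>a = b\<close> and, if \<open>b\<close> is an entry of \<open>W\<close>, a product with
  the derivative of the state along \<open>a\<close>. The average over \<open>l\<close> yields the
  other mixed product and the part that is linear in \<open>s2\<close>.\<close>

lemma dpreact_line:
  fixes \<theta> :: "('d::finite, 'n::finite) param"
  assumes \<phi>: "\<And>y. (\<phi> has_real_derivative deriv \<phi> y) (at y)"
      "\<And>y. (deriv \<phi> has_real_derivative deriv (deriv \<phi>) y) (at y)"
    and s: "\<And>j. ((\<lambda>r. s r $ j) has_real_derivative s1 0 $ a $ j) (at 0)"
    and s1: "\<And>j. ((\<lambda>r. s1 r $ b $ j) has_real_derivative s2 $ a $ b $ j) (at 0)"
  shows "((\<lambda>r. dpreact \<phi> (\<theta> + r *\<^sub>R axis (Rec a) 1) x (s r) (s1 r) b k) has_real_derivative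
     ddpreact \<phi> \<theta> x (s 0) (s1 0) s2 a b k) (at 0)"
proof -
  note line = coordinate_line_has_derivative[OF \<phi>(1)] coordinate_line_has_derivative[OF \<phi>(2)]
  define T where "T r = (case b of
        EntA i j \<Rightarrow> if i = k then 1 / real CARD('d) * deriv \<phi> (parA (\<theta> + r *\<^sub>R axis (Rec a) 1) k j) * x $ j else 0
      | EntW i j \<Rightarrow> if i = k then 1 / real CARD('n) * deriv \<phi> (parW (\<theta> + r *\<^sub>R axis (Rec a) 1) k j) * s r $ j else 0)" for r
  define T' where "T' = (case b of
        EntA i j \<Rightarrow> if i = k then 1 / real CARD('d) * (if Rec (EntA k j) = Rec a then deriv (deriv \<phi>) (parA \<theta> k j) else 0) * x $ j else 0
      | EntW i j \<Rightarrow> if i = k then 1 / real CARD('n) *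
          ((if Rec (EntW k j) = Rec a then deriv (deriv \<phi>) (parW \<theta> k j) else 0) * s 0 $ j
            + deriv \<phi> (parW \<theta> k j) * s1 0 $ a $ j) else 0)"
  have T: "(T has_real_derivative T') (at 0)"
  proof (cases b)
    case (EntA i j)
    have "((\<lambda>r. 1 / real CARD('d) * deriv \<phi> (parA (\<theta> + r *\<^sub>R axis (Rec a) 1) k j) * x $ j) has_real_derivative
      1 / real CARD('d) * (if Rec (EntA k j) = Rec a then deriv (deriv \<phi>) (parA \<theta> k j) else 0) * x $ j) (at 0)"
      by (intro DERIV_cmult DERIV_cmult_right line)
    moreover have "T = (\<lambda>r. if i = k then 1 / real CARD('d) * deriv \<phi> (parA (\<theta> + r *\<^sub>R axis (Rec a) 1) k j) * x $ j else 0)"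
      by (rule ext) (simp only: T_def EntA entry.case)
    moreover have "T' = (if i = k then 1 / real CARD('d) * (if Rec (EntA k j) = Rec a then deriv (deriv \<phi>) (parA \<theta> k j) else 0) * x $ j else 0)"
      by (simp only: T'_def EntA entry.case)
    ultimately show ?thesis by (cases "i = k") simp_all
  next
    case (EntW i j)
    have "((\<lambda>r. deriv \<phi> (parW (\<theta> + r *\<^sub>R axis (Rec a) 1) k j) * s r $ j) has_real_derivative
      (if Rec (EntW k j) = Rec a then deriv (deriv \<phi>) (parW \<theta> k j) else 0) * s 0 $ j
            + s1 0 $ a $ j * deriv \<phi> (parW (\<theta> + 0 *\<^sub>R axis (Rec a) 1) k j)) (at 0)"
      by (rule DERIV_mult[OF line(2) s])
    from DERIV_cmult[OF this, of "1 / real CARD('n)"]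
    have "((\<lambda>r. 1 / real CARD('n) * deriv \<phi> (parW (\<theta> + r *\<^sub>R axis (Rec a) 1) k j) * s r $ j) has_real_derivative
      1 / real CARD('n) * ((if Rec (EntW k j) = Rec a then deriv (deriv \<phi>) (parW \<theta> k j) else 0) * s 0 $ j
            + deriv \<phi> (parW \<theta> k j) * s1 0 $ a $ j)) (at 0)"
      by (simp add: mult.assoc mult.commute)
    moreover have "T = (\<lambda>r. if i = k then 1 / real CARD('n) * deriv \<phi> (parW (\<theta> + r *\<^sub>R axis (Rec a) 1) k j) * s r $ j else 0)"
      by (rule ext) (simp only: T_def EntW entry.case)
    moreover have "T' = (if i = k then 1 / real CARD('n) *
          ((if Rec (EntW k j) = Rec a then deriv (deriv \<phi>) (parW \<theta> k j) else 0) * s 0 $ j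
            + deriv \<phi> (parW \<theta> k j) * s1 0 $ a $ j) else 0)"
      by (simp only: T'_def EntW entry.case)
    ultimately show ?thesis by (cases "i = k") simp_all
  qed
  have S: "((\<lambda>r. 1 / real CARD('n) * (\<Sum>l\<in>UNIV. \<phi> (parW (\<theta> + r *\<^sub>R axis (Rec a) 1) k l) * s1 r $ b $ l)) has_real_derivative
     1 / real CARD('n) * (\<Sum>l\<in>UNIV. (if Rec (EntW k l) = Rec a then deriv \<phi> (parW \<theta> k l) else 0) * s1 0 $ b $ l
       + \<phi> (parW \<theta> k l) * s2 $ a $ b $ l)) (at 0)"
    by (rule derivative_eq_intros line s1 refl | simp add: algebra_simps)+
  have "T' + 1 / real CARD('n) * (\<Sum>l\<in>UNIV. (if Rec (EntW k l) = Rec a then deriv \<phi> (parW \<theta> k l) else 0) * s1 0 $ b $ l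
       + \<phi> (parW \<theta> k l) * s2 $ a $ b $ l) = ddpreact \<phi> \<theta> x (s 0) (s1 0) s2 a b k"
    unfolding T'_def ddpreact_def
    by (cases a; cases b) (auto simp: sum.distrib distrib_left if_distrib[of "\<lambda>c. c * _"] cong: if_cong)
  then show ?thesis
    using DERIV_add[OF T S] by (simp add: dpreact_def T_def)
qed

lemma differentiable_sum_UNIV:
  fixes g :: "'i::finite \<Rightarrow> 'a::real_normed_vector \<Rightarrow> real"
  assumes "\<And>i. g i differentiable (at \<theta>)"
  shows "(\<lambda>p. \<Sum>i\<in>UNIV. g i p) differentiable (at \<theta>)"
  by (rule differentiable_sum) (use assms in auto)

lemma preact_differentiable:
  fixes \<theta> :: "('d::finite, 'n::finite) param"
  assumes \<phi>: "\<And>y. (\<phi> has_real_derivative deriv \<phi> y) (at y)"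
    and s: "\<And>j. (\<lambda>p. s p $ j) differentiable (at \<theta>)"
  shows "(\<lambda>p. preact \<phi> p x (s p) k) differentiable (at \<theta>)"
  unfolding preact_def
  by (intro differentiable_add differentiable_mult differentiable_sum_UNIV differentiable_const s
      coordinate_differentiable[OF \<phi>])

lemma dpreact_differentiable:
  fixes \<theta> :: "('d::finite, 'n::finite) param"
  assumes \<phi>: "\<And>y. (\<phi> has_real_derivative deriv \<phi> y) (at y)"
      "\<And>y. (deriv \<phi> has_real_derivative deriv (deriv \<phi>) y) (at y)"
    and s: "\<And>j. (\<lambda>p. s p $ j) differentiable (at \<theta>)"
    and s1: "\<And>j. (\<lambda>p. s1 p $ b $ j) differentiable (at \<theta>)"
  shows "(\<lambda>p. dpreact \<phi> p x (s p) (s1 p) b k) differentiable (at \<theta>)"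
proof -
  have "(\<lambda>p. case b of
        EntA i j \<Rightarrow> if i = k then 1 / real CARD('d) * deriv \<phi> (parA p k j) * x $ j else 0
      | EntW i j \<Rightarrow> if i = k then 1 / real CARD('n) * deriv \<phi> (parW p k j) * s p $ j else 0) differentiable (at \<theta>)"
  proof (cases b)
    case (EntA i j)
    have "(\<lambda>p. 1 / real CARD('d) * deriv \<phi> (parA p k j) * x $ j) differentiable (at \<theta>)"
      by (intro differentiable_mult differentiable_const coordinate_differentiable[OF \<phi>(2)])
    then show ?thesis by (cases "i = k") (simp_all add: EntA)
  next
    case (EntW i j)
    have "(\<lambda>p. 1 / real CARD('n) * deriv \<phi> (parW p k j) * s p $ j) differentiable (at \<theta>)"
      by (intro differentiable_mult differentiable_const s coordinate_differentiable[OF \<phi>(2)])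
    then show ?thesis by (cases "i = k") (simp_all add: EntW)
  qed
  then show ?thesis
    unfolding dpreact_def
    by (intro differentiable_add differentiable_mult differentiable_sum_UNIV differentiable_const s1
        coordinate_differentiable[OF \<phi>(1)])
qed

section \<open>The recursion for the first and second derivatives of the hidden state\<close>

definition hidden1 ::
  "(real \<Rightarrow> real) \<Rightarrow> (nat \<Rightarrow> real^'d) \<Rightarrow> nat \<Rightarrow> ('d::finite, 'n::finite) param \<Rightarrow> real^'n^('d, 'n) entry" where
  "hidden1 \<phi> x t \<theta> = (\<chi> a k. partial (Rec a) (\<lambda>p. hidden \<phi> x t p $ k) \<theta>)"

definition hidden2 ::
  "(real \<Rightarrow> real) \<Rightarrow> (nat \<Rightarrow> real^'d) \<Rightarrow> nat \<Rightarrow> ('d::finite, 'n::finite) param \<Rightarrow>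
   real^'n^('d, 'n) entry^('d, 'n) entry" where
  "hidden2 \<phi> x t \<theta> = (\<chi> a b k. partial (Rec a) (\<lambda>p. hidden1 \<phi> x t p $ b $ k) \<theta>)"

type_synonym ('d, 'n) ustate = "(real^'n) \<times> (real^'n^('d, 'n) entry) \<times> (real^'n^('d, 'n) entry^('d, 'n) entry)"

text \<open>The deterministic core of \<open>joint_kernel\<close>: with the input given, the triple
  of state and derivatives is a function of its predecessor.\<close>

definition net_step ::
  "(real \<Rightarrow> real) \<Rightarrow> ('d::finite, 'n::finite) param \<Rightarrow> real^'d \<Rightarrow>
   ('d, 'n) ustate \<Rightarrow>
   ('d, 'n) ustate" where
  "net_step \<phi> \<theta> x = (\<lambda>(s, s1, s2).
     (\<chi> k. sigmoid (preact \<phi> \<theta> x s k),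
      \<chi> a k. deriv sigmoid (preact \<phi> \<theta> x s k) * dpreact \<phi> \<theta> x s s1 a k,
      \<chi> a b k. deriv (deriv sigmoid) (preact \<phi> \<theta> x s k) * dpreact \<phi> \<theta> x s s1 a k * dpreact \<phi> \<theta> x s s1 b k
         + deriv sigmoid (preact \<phi> \<theta> x s k) * ddpreact \<phi> \<theta> x s s1 s2 a b k))"

context
  fixes \<phi> :: "real \<Rightarrow> real"
  assumes \<phi>: "\<And>y. (\<phi> has_real_derivative deriv \<phi> y) (at y)"
      "\<And>y. (deriv \<phi> has_real_derivative deriv (deriv \<phi>) y) (at y)"
begin

text \<open>\<open>partial\<close> has no meaningful value where the derivative does not exist, so
  differentiability must precede every identity about \<open>hidden1\<close>. The Frechet form is
  the one required later for differentiating expectations.\<close>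

lemma hidden_differentiable:
  fixes \<theta> :: "('d::finite, 'n::finite) param"
  shows "(\<lambda>p. hidden \<phi> x t p $ k) differentiable (at \<theta>)"
proof (induction t arbitrary: k)
  case (Suc t)
  have "sigmoid differentiable (at y)" for y using sigmoid_has_derivative real_differentiable_def by blast
  then have "(\<lambda>p. sigmoid (preact \<phi> p (x t) (hidden \<phi> x t p) k)) differentiable (at \<theta>)"
    by (rule differentiable_compose[where f=sigmoid and g="\<lambda>p. preact \<phi> p (x t) (hidden \<phi> x t p) k"])
      (rule preact_differentiable[OF \<phi>(1) Suc])
  then show ?case by simp
qed simp

lemma hidden_line:
  fixes \<theta> :: "('d::finite, 'n::finite) param"
  shows "((\<lambda>r. hidden \<phi> x t (\<theta> + r *\<^sub>R axis (Rec a) 1) $ k) has_real_derivative hidden1 \<phi> x t \<theta> $ a $ k) (at 0)"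
  unfolding hidden1_def by (simp add: differentiable_axis_line[OF hidden_differentiable])

lemma hidden1_Suc:
  fixes \<theta> :: "('d::finite, 'n::finite) param"
  shows "hidden1 \<phi> x (Suc t) \<theta> $ a $ k = deriv sigmoid (preact \<phi> \<theta> (x t) (hidden \<phi> x t \<theta>) k)
    * dpreact \<phi> \<theta> (x t) (hidden \<phi> x t \<theta>) (hidden1 \<phi> x t \<theta>) a k"
proof -
  have "((\<lambda>r. preact \<phi> (\<theta> + r *\<^sub>R axis (Rec a) 1) (x t) (hidden \<phi> x t (\<theta> + r *\<^sub>R axis (Rec a) 1)) k) has_real_derivative
     dpreact \<phi> \<theta> (x t) (hidden \<phi> x t (\<theta> + 0 *\<^sub>R axis (Rec a) 1)) (hidden1 \<phi> x t \<theta>) a k) (at 0)"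
    by (rule preact_line[OF \<phi>(1) hidden_line])
  from DERIV_chain2[OF sigmoid_has_derivative this]
  have "partial (Rec a) (\<lambda>p. hidden \<phi> x (Suc t) p $ k) \<theta> = deriv sigmoid (preact \<phi> \<theta> (x t) (hidden \<phi> x t \<theta>) k)
    * dpreact \<phi> \<theta> (x t) (hidden \<phi> x t \<theta>) (hidden1 \<phi> x t \<theta>) a k"
    by (intro partial_eqI) (simp only: hidden.simps vec_lambda_beta deriv_sigmoid scaleR_zero_left add_0_right)
  then show ?thesis by (simp only: hidden1_def vec_lambda_beta)
qed

lemma partial_zero: "partial i (\<lambda>p. 0) \<theta> = 0"
  by (simp add: partial_def)

lemma hidden1_0: "hidden1 \<phi> x 0 \<theta> = 0"
  by (simp add: hidden1_def vec_eq_iff partial_zero)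

lemma hidden2_0: "hidden2 \<phi> x 0 \<theta> = 0"
  by (simp add: hidden2_def vec_eq_iff hidden1_0 partial_zero)

lemma hidden1_differentiable:
  fixes \<theta> :: "('d::finite, 'n::finite) param"
  shows "(\<lambda>p. hidden1 \<phi> x t p $ b $ k) differentiable (at \<theta>)"
proof (induction t arbitrary: k)
  case 0 then show ?case by (simp add: hidden1_0)
next
  case (Suc t)
  have "deriv sigmoid differentiable (at y)" for y
    using deriv_sigmoid_has_derivative real_differentiable_def by blast
  then have "(\<lambda>p. deriv sigmoid (preact \<phi> p (x t) (hidden \<phi> x t p) k)) differentiable (at \<theta>)"
    by (rule differentiable_compose[where f="deriv sigmoid" and g="\<lambda>p. preact \<phi> p (x t) (hidden \<phi> x t p) k"])
      (rule preact_differentiable[OF \<phi>(1) hidden_differentiable])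
  moreover have "(\<lambda>p. dpreact \<phi> p (x t) (hidden \<phi> x t p) (hidden1 \<phi> x t p) b k) differentiable (at \<theta>)"
    by (rule dpreact_differentiable[OF \<phi> hidden_differentiable Suc])
  ultimately show ?case unfolding hidden1_Suc by (rule differentiable_mult)
qed

lemma hidden1_line:
  fixes \<theta> :: "('d::finite, 'n::finite) param"
  shows "((\<lambda>r. hidden1 \<phi> x t (\<theta> + r *\<^sub>R axis (Rec a) 1) $ b $ k) has_real_derivative hidden2 \<phi> x t \<theta> $ a $ b $ k) (at 0)"
  unfolding hidden2_def by (simp add: differentiable_axis_line[OF hidden1_differentiable])

text \<open>The product rule for the formula of \<open>hidden1_Suc\<close>: the factor
  \<open>deriv sigmoid\<close> gives the term that is quadratic in \<open>dpreact\<close>, the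
  factor \<open>dpreact\<close> gives \<open>ddpreact\<close>.\<close>

lemma hidden2_Suc:
  fixes \<theta> :: "('d::finite, 'n::finite) param" and x :: "nat \<Rightarrow> real^'d"
  defines "h \<equiv> \<lambda>t. hidden \<phi> x t \<theta>" and "h1 \<equiv> \<lambda>t. hidden1 \<phi> x t \<theta>"
  shows "hidden2 \<phi> x (Suc t) \<theta> $ a $ b $ k =
    deriv (deriv sigmoid) (preact \<phi> \<theta> (x t) (h t) k) * dpreact \<phi> \<theta> (x t) (h t) (h1 t) a k * dpreact \<phi> \<theta> (x t) (h t) (h1 t) b k
    + deriv sigmoid (preact \<phi> \<theta> (x t) (h t) k) * ddpreact \<phi> \<theta> (x t) (h t) (h1 t) (hidden2 \<phi> x t \<theta>) a b k"
proof -
  let ?L = "\<lambda>r. \<theta> + r *\<^sub>R axis (Rec a) 1"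
  have pre: "((\<lambda>r. preact \<phi> (?L r) (x t) (hidden \<phi> x t (?L r)) k) has_real_derivative
     dpreact \<phi> \<theta> (x t) (hidden \<phi> x t (?L 0)) (hidden1 \<phi> x t \<theta>) a k) (at 0)"
    by (rule preact_line[OF \<phi>(1) hidden_line])
  have dpre: "((\<lambda>r. dpreact \<phi> (?L r) (x t) (hidden \<phi> x t (?L r)) (hidden1 \<phi> x t (?L r)) b k) has_real_derivative
     ddpreact \<phi> \<theta> (x t) (hidden \<phi> x t (?L 0)) (hidden1 \<phi> x t (?L 0)) (hidden2 \<phi> x t \<theta>) a b k) (at 0)"
    by (rule dpreact_line[OF \<phi>]) (simp_all add: hidden_line hidden1_line)
  from DERIV_mult[OF DERIV_chain2[OF deriv_sigmoid_has_derivative pre] dpre]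
  have "partial (Rec a) (\<lambda>p. hidden1 \<phi> x (Suc t) p $ b $ k) \<theta> =
    deriv (deriv sigmoid) (preact \<phi> \<theta> (x t) (h t) k) * dpreact \<phi> \<theta> (x t) (h t) (h1 t) a k * dpreact \<phi> \<theta> (x t) (h t) (h1 t) b k
    + deriv sigmoid (preact \<phi> \<theta> (x t) (h t) k) * ddpreact \<phi> \<theta> (x t) (h t) (h1 t) (hidden2 \<phi> x t \<theta>) a b k"
    by (intro partial_eqI)
      (simp only: hidden1_Suc deriv2_sigmoid h_def h1_def scaleR_zero_left add_0_right add_0_left mult.commute add.commute)
  then show ?thesis by (simp only: hidden2_def vec_lambda_beta)
qed

lemma hidden_net_step:
  fixes \<theta> :: "('d::finite, 'n::finite) param"
  shows "(hidden \<phi> x (Suc t) \<theta>, hidden1 \<phi> x (Suc t) \<theta>, hidden2 \<phi> x (Suc t) \<theta>)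
    = net_step \<phi> \<theta> (x t) (hidden \<phi> x t \<theta>, hidden1 \<phi> x t \<theta>, hidden2 \<phi> x t \<theta>)"
  by (simp add: net_step_def vec_eq_iff hidden1_Suc hidden2_Suc)

lemma preact_cong:
  "(\<And>a. p $ Rec a = q $ Rec a) \<Longrightarrow> preact \<phi> p x s k = preact \<phi> q x s k"
  "(\<And>a. p $ Rec a = q $ Rec a) \<Longrightarrow> dpreact \<phi> p x s s1 a k = dpreact \<phi> q x s s1 a k"
  by (simp_all add: preact_def dpreact_def split: entry.split)

text \<open>The recursion sees only the entries of \<open>A\<close> and \<open>W\<close>.
  Consequently the derivatives of the hidden state along \<open>B\<close> and \<open>c\<close>
  vanish.\<close>

lemma hidden_cong:
  fixes p q :: "('d::finite, 'n::finite) param"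
  assumes "\<And>a. p $ Rec a = q $ Rec a"
  shows "hidden \<phi> x t p = hidden \<phi> x t q" "hidden1 \<phi> x t p = hidden1 \<phi> x t q"
proof -
  have h: "hidden \<phi> x t p = hidden \<phi> x t q" for t
    by (induction t) (simp_all add: preact_cong[of p q, OF assms])
  then show "hidden \<phi> x t p = hidden \<phi> x t q" .
  show "hidden1 \<phi> x t p = hidden1 \<phi> x t q"
  proof (induction t)
    case (Suc t)
    show ?case
      unfolding vec_eq_iff
      by (intro allI) (simp only: hidden1_Suc h Suc.IH preact_cong[of p q, OF assms])
  qed (simp add: hidden1_0)
qed

end

section \<open>Derivatives of the squared error along a fixed data path\<close>

definition path_state ::
  "(real \<Rightarrow> real) \<Rightarrow> (nat \<Rightarrow> real^'d) \<Rightarrow> nat \<Rightarrow> real^'d \<Rightarrow> real^'z \<Rightarrow> real \<Rightarrow>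
   ('d::finite, 'n::finite) param \<Rightarrow> ('d, 'z::finite, 'n) jstate" where
  "path_state \<phi> x t x' z' y p = (x', z', hidden \<phi> x t p, hidden1 \<phi> x t p, hidden2 \<phi> x t p, y)"

context
  fixes \<phi> lam :: "real \<Rightarrow> real"
  assumes \<phi>: "\<And>y. (\<phi> has_real_derivative deriv \<phi> y) (at y)"
      "\<And>y. (deriv \<phi> has_real_derivative deriv (deriv \<phi>) y) (at y)"
    and lam: "\<And>y. (lam has_real_derivative deriv lam y) (at y)"
      "\<And>y. (deriv lam has_real_derivative deriv (deriv lam) y) (at y)"
begin

lemma hidden_coord_line:
  fixes \<theta> :: "('d::finite, 'n::finite) param"
  shows "((\<lambda>r. hidden \<phi> x t (\<theta> + r *\<^sub>R axis i 1) $ k) has_real_derivative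
      (case i of Rec a \<Rightarrow> hidden1 \<phi> x t \<theta> $ a $ k | _ \<Rightarrow> 0)) (at 0)"
    "((\<lambda>r. hidden1 \<phi> x t (\<theta> + r *\<^sub>R axis i 1) $ b $ k) has_real_derivative
      (case i of Rec a \<Rightarrow> hidden2 \<phi> x t \<theta> $ a $ b $ k | _ \<Rightarrow> 0)) (at 0)"
proof -
  have const: "hidden \<phi> x t (\<theta> + r *\<^sub>R axis i 1) = hidden \<phi> x t \<theta>"
      "hidden1 \<phi> x t (\<theta> + r *\<^sub>R axis i 1) = hidden1 \<phi> x t \<theta>" if "\<forall>a. i \<noteq> Rec a" for r i
    using that by (auto intro!: hidden_cong[OF \<phi>] simp: axis_def)
  show "((\<lambda>r. hidden \<phi> x t (\<theta> + r *\<^sub>R axis i 1) $ k) has_real_derivative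
      (case i of Rec a \<Rightarrow> hidden1 \<phi> x t \<theta> $ a $ k | _ \<Rightarrow> 0)) (at 0)"
    by (cases i) (simp_all add: hidden_line[OF \<phi>] const)
  show "((\<lambda>r. hidden1 \<phi> x t (\<theta> + r *\<^sub>R axis i 1) $ b $ k) has_real_derivative
      (case i of Rec a \<Rightarrow> hidden2 \<phi> x t \<theta> $ a $ b $ k | _ \<Rightarrow> 0)) (at 0)"
    by (cases i) (simp_all add: hidden1_line[OF \<phi>] const)
qed

context
  fixes f :: "real^'d::finite \<Rightarrow> real^'z::finite \<Rightarrow> real \<Rightarrow> real" and x :: "nat \<Rightarrow> real^'d" and t :: nat
    and x' :: "real^'d" and z' :: "real^'z" and y :: real
begin

lemma err_line:
  fixes \<theta> :: "('d, 'n::finite) param"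
  shows "((\<lambda>r. err_fun f lam (\<theta> + r *\<^sub>R axis i 1) (path_state \<phi> x t x' z' y (\<theta> + r *\<^sub>R axis i 1))) has_real_derivative
    - D_fun lam \<theta> (path_state \<phi> x t x' z' y \<theta>) $ i) (at 0)"
proof -
  note line = coordinate_line_has_derivative[OF lam(1)]
  have "((\<lambda>r. err_fun f lam (\<theta> + r *\<^sub>R axis i 1) (path_state \<phi> x t x' z' y (\<theta> + r *\<^sub>R axis i 1))) has_real_derivative
      - (\<Sum>k\<in>UNIV. (if CoB k = i then deriv lam (parB \<theta> k) else 0) * hidden \<phi> x t (\<theta> + 0 *\<^sub>R axis i 1) $ k
         + (case i of Rec a \<Rightarrow> hidden1 \<phi> x t \<theta> $ a $ k | _ \<Rightarrow> 0) * lam (parB (\<theta> + 0 *\<^sub>R axis i 1) k))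
      - (if CoC = i then deriv lam (parC \<theta>) else 0)) (at 0)"
    unfolding err_fun_def path_state_def prod.case
    by (rule DERIV_cong[OF DERIV_diff[OF DERIV_diff[OF DERIV_const DERIV_sum[OF DERIV_mult[OF line hidden_coord_line(1)]]] line]]) simp
  also have "- (\<Sum>k\<in>UNIV. (if CoB k = i then deriv lam (parB \<theta> k) else 0) * hidden \<phi> x t (\<theta> + 0 *\<^sub>R axis i 1) $ k
         + (case i of Rec a \<Rightarrow> hidden1 \<phi> x t \<theta> $ a $ k | _ \<Rightarrow> 0) * lam (parB (\<theta> + 0 *\<^sub>R axis i 1) k))
      - (if CoC = i then deriv lam (parC \<theta>) else 0) = - D_fun lam \<theta> (path_state \<phi> x t x' z' y \<theta>) $ i"
    unfolding D_fun_def path_state_def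
    by (cases i; simp add: if_distrib[of "\<lambda>c. c * _"] cong: if_cong; simp add: mult.commute)
  finally show ?thesis .
qed

text \<open>The derivative runs along \<open>i\<close> and the component is \<open>j\<close>, the
  index order of \<open>hess\<close> and \<open>hidden2\<close>. Because this order is kept
  throughout, symmetry of second derivatives is never invoked.\<close>

lemma D_line:
  fixes \<theta> :: "('d, 'n::finite) param"
  shows "((\<lambda>r. D_fun lam (\<theta> + r *\<^sub>R axis i 1) (path_state \<phi> x t x' z' y (\<theta> + r *\<^sub>R axis i 1)) $ j) has_real_derivative
    K_fun lam \<theta> (path_state \<phi> x t x' z' y \<theta>) $ i $ j) (at 0)"
proof (cases j)
  case (Rec b)
  have "((\<lambda>r. \<Sum>k\<in>UNIV. lam (parB (\<theta> + r *\<^sub>R axis i 1) k) * hidden1 \<phi> x t (\<theta> + r *\<^sub>R axis i 1) $ b $ k) has_real_derivative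
      (\<Sum>k\<in>UNIV. (if CoB k = i then deriv lam (parB \<theta> k) else 0) * hidden1 \<phi> x t (\<theta> + 0 *\<^sub>R axis i 1) $ b $ k
         + (case i of Rec a \<Rightarrow> hidden2 \<phi> x t \<theta> $ a $ b $ k | _ \<Rightarrow> 0) * lam (parB (\<theta> + 0 *\<^sub>R axis i 1) k))) (at 0)"
    by (intro DERIV_sum DERIV_mult coordinate_line_has_derivative[OF lam(1)] hidden_coord_line(2))
  also have "(\<Sum>k\<in>UNIV. (if CoB k = i then deriv lam (parB \<theta> k) else 0) * hidden1 \<phi> x t (\<theta> + 0 *\<^sub>R axis i 1) $ b $ k
         + (case i of Rec a \<Rightarrow> hidden2 \<phi> x t \<theta> $ a $ b $ k | _ \<Rightarrow> 0) * lam (parB (\<theta> + 0 *\<^sub>R axis i 1) k))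
      = K_fun lam \<theta> (path_state \<phi> x t x' z' y \<theta>) $ i $ j"
    unfolding K_fun_def path_state_def Rec
    by (cases i; simp add: if_distrib[of "\<lambda>c. c * _"] cong: if_cong; simp add: mult.commute)
  finally show ?thesis by (simp only: D_fun_def path_state_def Rec prod.case coord.case vec_lambda_beta)
next
  case (CoB l)
  have "((\<lambda>r. deriv lam (parB (\<theta> + r *\<^sub>R axis i 1) l) * hidden \<phi> x t (\<theta> + r *\<^sub>R axis i 1) $ l) has_real_derivative
      (if CoB l = i then deriv (deriv lam) (parB \<theta> l) else 0) * hidden \<phi> x t (\<theta> + 0 *\<^sub>R axis i 1) $ l
         + (case i of Rec a \<Rightarrow> hidden1 \<phi> x t \<theta> $ a $ l | _ \<Rightarrow> 0) * deriv lam (parB (\<theta> + 0 *\<^sub>R axis i 1) l)) (at 0)"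
    by (intro DERIV_mult coordinate_line_has_derivative[OF lam(2)] hidden_coord_line(1))
  also have "(if CoB l = i then deriv (deriv lam) (parB \<theta> l) else 0) * hidden \<phi> x t (\<theta> + 0 *\<^sub>R axis i 1) $ l
         + (case i of Rec a \<Rightarrow> hidden1 \<phi> x t \<theta> $ a $ l | _ \<Rightarrow> 0) * deriv lam (parB (\<theta> + 0 *\<^sub>R axis i 1) l)
      = K_fun lam \<theta> (path_state \<phi> x t x' z' y \<theta>) $ i $ j"
    unfolding K_fun_def path_state_def CoB
    by (cases i) (auto simp: mult.commute)
  finally show ?thesis by (simp only: D_fun_def path_state_def CoB prod.case coord.case vec_lambda_beta)
next
  case CoC
  have "((\<lambda>r. deriv lam (parC (\<theta> + r *\<^sub>R axis i 1))) has_real_derivative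
      (if CoC = i then deriv (deriv lam) (parC \<theta>) else 0)) (at 0)"
    by (rule coordinate_line_has_derivative[OF lam(2)])
  also have "(if CoC = i then deriv (deriv lam) (parC \<theta>) else 0) = K_fun lam \<theta> (path_state \<phi> x t x' z' y \<theta>) $ i $ j"
    unfolding K_fun_def path_state_def CoC by (cases i) auto
  finally show ?thesis by (simp only: D_fun_def path_state_def CoC prod.case coord.case vec_lambda_beta)
qed

lemma err_differentiable:
  fixes \<theta> :: "('d, 'n::finite) param"
  shows "(\<lambda>p. err_fun f lam p (path_state \<phi> x t x' z' y p)) differentiable (at \<theta>)"
  unfolding err_fun_def path_state_def prod.case
  by (intro differentiable_diff differentiable_const differentiable_sum_UNIV differentiable_mult
      coordinate_differentiable[OF lam(1)] hidden_differentiable[OF \<phi>])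

lemma D_differentiable:
  fixes \<theta> :: "('d, 'n::finite) param"
  shows "(\<lambda>p. D_fun lam p (path_state \<phi> x t x' z' y p) $ j) differentiable (at \<theta>)"
  unfolding D_fun_def path_state_def prod.case vec_lambda_beta
  by (cases j; simp only: coord.case; intro differentiable_sum_UNIV differentiable_mult
      coordinate_differentiable[OF lam(1)] coordinate_differentiable[OF lam(2)]
      hidden_differentiable[OF \<phi>] hidden1_differentiable[OF \<phi>])

lemma square_err_partial:
  fixes \<theta> :: "('d, 'n::finite) param"
  shows "(\<lambda>p. (err_fun f lam p (path_state \<phi> x t x' z' y p))\<^sup>2 / 2) differentiable (at \<theta>)"
    "partial i (\<lambda>p. (err_fun f lam p (path_state \<phi> x t x' z' y p))\<^sup>2 / 2) \<theta> = g_fun f lam \<theta> (path_state \<phi> x t x' z' y \<theta>) $ i"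
proof -
  show "(\<lambda>p. (err_fun f lam p (path_state \<phi> x t x' z' y p))\<^sup>2 / 2) differentiable (at \<theta>)"
    unfolding power2_eq_square divide_inverse
    by (intro differentiable_mult differentiable_const err_differentiable)
  have "((\<lambda>r. (err_fun f lam (\<theta> + r *\<^sub>R axis i 1) (path_state \<phi> x t x' z' y (\<theta> + r *\<^sub>R axis i 1)))\<^sup>2 / 2) has_real_derivative
      g_fun f lam \<theta> (path_state \<phi> x t x' z' y \<theta>) $ i) (at 0)"
    by (rule DERIV_cong[OF DERIV_cdivide[OF DERIV_power[OF err_line]]]) (simp add: g_fun_def)
  then show "partial i (\<lambda>p. (err_fun f lam p (path_state \<phi> x t x' z' y p))\<^sup>2 / 2) \<theta> = g_fun f lam \<theta> (path_state \<phi> x t x' z' y \<theta>) $ i"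
    by (rule partial_eqI)
qed

lemma g_partial:
  fixes \<theta> :: "('d, 'n::finite) param"
  shows "(\<lambda>p. g_fun f lam p (path_state \<phi> x t x' z' y p) $ j) differentiable (at \<theta>)"
    "partial i (\<lambda>p. g_fun f lam p (path_state \<phi> x t x' z' y p) $ j) \<theta> = he_fun f lam \<theta> (path_state \<phi> x t x' z' y \<theta>) $ i $ j"
proof -
  show "(\<lambda>p. g_fun f lam p (path_state \<phi> x t x' z' y p) $ j) differentiable (at \<theta>)"
    unfolding g_fun_def vector_scaleR_component real_scaleR_def
    by (intro differentiable_mult differentiable_minus err_differentiable D_differentiable)
  have "((\<lambda>r. g_fun f lam (\<theta> + r *\<^sub>R axis i 1) (path_state \<phi> x t x' z' y (\<theta> + r *\<^sub>R axis i 1)) $ j) has_real_derivative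
      he_fun f lam \<theta> (path_state \<phi> x t x' z' y \<theta>) $ i $ j) (at 0)"
    unfolding g_fun_def vector_scaleR_component real_scaleR_def
    by (rule DERIV_cong[OF DERIV_mult[OF DERIV_minus[OF err_line] D_line]]) (simp add: he_fun_def algebra_simps)
  then show "partial i (\<lambda>p. g_fun f lam p (path_state \<phi> x t x' z' y p) $ j) \<theta> = he_fun f lam \<theta> (path_state \<phi> x t x' z' y \<theta>) $ i $ j"
    by (rule partial_eqI)
qed

end

end

lemma joint_eq_path_state:
  "joint \<phi> X Z \<eta> \<theta> t \<omega> = path_state \<phi> (\<lambda>i. X i \<omega>) t (X t \<omega>) (Z t \<omega>) (\<eta> t \<omega>) \<theta>"
  by (simp add: joint_def path_state_def hidden1_def hidden2_def Let_def vec_eq_iff)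

lemma loss_eq_err:
  "loss f \<phi> lam X Z \<eta> T \<theta> \<omega> = 1 / real T * (\<Sum>t=1..T. (err_fun f lam \<theta> (joint \<phi> X Z \<eta> \<theta> t \<omega>))\<^sup>2 / 2)"
  by (simp add: loss_def err_fun_def joint_def Let_def readout_def sum_divide_distrib[symmetric] diff_diff_eq)

section \<open>Uniform contraction of the derivative recursion\<close>

text \<open>Bounded and Lipschitz on \<open>S\<close>, with constants that do not depend on the parameter \<open>p\<close>.\<close>

definition ubl :: "'v set \<Rightarrow> ('v \<Rightarrow> 'v \<Rightarrow> real) \<Rightarrow> ('p \<Rightarrow> 'v \<Rightarrow> real) \<Rightarrow> bool" where
  "ubl S \<delta> G \<longleftrightarrow> (\<exists>C\<ge>0. \<forall>p. \<forall>v\<in>S. \<forall>v'\<in>S. \<bar>G p v\<bar> \<le> C \<and> \<bar>G p v - G p v'\<bar> \<le> C * \<delta> v v')"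

lemma sigmoid_lipschitz: "\<bar>sigmoid a - sigmoid b\<bar> \<le> 1/4 * \<bar>a - b\<bar>"
proof -
  have "norm (sigmoid a - sigmoid b) \<le> 1/4 * norm (a - b)"
    by (rule field_differentiable_bound[of UNIV sigmoid "deriv sigmoid"])
      (use sigmoid_has_derivative deriv_sigmoid deriv_sigmoid_bound in \<open>auto\<close>)
  then show ?thesis by simp
qed

context
  fixes S :: "'v set" and \<delta> :: "'v \<Rightarrow> 'v \<Rightarrow> real"
  assumes \<delta>: "\<And>v v'. 0 \<le> \<delta> v v'"
begin

lemma ubl_param: "(\<And>p. \<bar>h p\<bar> \<le> C) \<Longrightarrow> ubl S \<delta> (\<lambda>p v. h p)"
  unfolding ubl_def by (intro exI[of _ "\<bar>C\<bar>"]) (auto simp: \<delta> intro: order_trans[OF _ abs_ge_self])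

lemma ubl_add:
  assumes "ubl S \<delta> G" "ubl S \<delta> H"
  shows "ubl S \<delta> (\<lambda>p v. G p v + H p v)"
proof -
  obtain C D where C: "C \<ge> 0" "\<And>p v v'. v \<in> S \<Longrightarrow> v' \<in> S \<Longrightarrow> \<bar>G p v\<bar> \<le> C \<and> \<bar>G p v - G p v'\<bar> \<le> C * \<delta> v v'"
    and D: "D \<ge> 0" "\<And>p v v'. v \<in> S \<Longrightarrow> v' \<in> S \<Longrightarrow> \<bar>H p v\<bar> \<le> D \<and> \<bar>H p v - H p v'\<bar> \<le> D * \<delta> v v'"
    using assms unfolding ubl_def by blast
  have "\<bar>G p v + H p v\<bar> \<le> C + D \<and> \<bar>(G p v + H p v) - (G p v' + H p v')\<bar> \<le> (C + D) * \<delta> v v'"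
    if "v \<in> S" "v' \<in> S" for p v v'
    using C(2)[OF that, of p] D(2)[OF that, of p] by (simp add: distrib_right abs_le_iff)
  then show ?thesis unfolding ubl_def using C(1) D(1) by (intro exI[of _ "C + D"]) auto
qed

lemma ubl_mult:
  assumes "ubl S \<delta> G" "ubl S \<delta> H"
  shows "ubl S \<delta> (\<lambda>p v. G p v * H p v)"
proof -
  obtain C D where C: "C \<ge> 0" "\<And>p v v'. v \<in> S \<Longrightarrow> v' \<in> S \<Longrightarrow> \<bar>G p v\<bar> \<le> C \<and> \<bar>G p v - G p v'\<bar> \<le> C * \<delta> v v'"
    and D: "D \<ge> 0" "\<And>p v v'. v \<in> S \<Longrightarrow> v' \<in> S \<Longrightarrow> \<bar>H p v\<bar> \<le> D \<and> \<bar>H p v - H p v'\<bar> \<le> D * \<delta> v v'"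
    using assms unfolding ubl_def by blast
  \<comment> \<open>The Lipschitz constant of a product collects two cross terms
    \<open>C * D\<close>. The bound on the values is doubled as well, so that one constant serves
    both purposes.\<close>
  have "\<bar>G p v * H p v\<bar> \<le> 2 * (C * D) \<and> \<bar>G p v * H p v - G p v' * H p v'\<bar> \<le> 2 * (C * D) * \<delta> v v'"
    if v: "v \<in> S" "v' \<in> S" for p v v'
  proof
    have "\<bar>G p v * H p v\<bar> \<le> C * D"
      unfolding abs_mult using C(2)[OF v, of p] D(2)[OF v, of p] C(1) by (intro mult_mono) auto
    then show "\<bar>G p v * H p v\<bar> \<le> 2 * (C * D)" using C(1) D(1) by (smt (verit) mult_nonneg_nonneg)
    have "G p v * H p v - G p v' * H p v' = (G p v - G p v') * H p v + G p v' * (H p v - H p v')"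
      by (simp add: algebra_simps)
    also have "\<bar>\<dots>\<bar> \<le> \<bar>G p v - G p v'\<bar> * \<bar>H p v\<bar> + \<bar>G p v'\<bar> * \<bar>H p v - H p v'\<bar>"
      by (metis abs_mult abs_triangle_ineq)
    also have "\<dots> \<le> (C * \<delta> v v') * D + C * (D * \<delta> v v')"
      using C(2)[OF v, of p] D(2)[OF v, of p] C(2)[OF v(2,1), of p] C(1) \<delta>[of v v']
      by (intro add_mono mult_mono) auto
    finally show "\<bar>G p v * H p v - G p v' * H p v'\<bar> \<le> 2 * (C * D) * \<delta> v v'" by (simp add: algebra_simps)
  qed
  then show ?thesis unfolding ubl_def using C(1) D(1) by (intro exI[of _ "2 * (C * D)"]) auto
qed

lemma ubl_const: "ubl S \<delta> (\<lambda>p v. c)"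
  by (rule ubl_param[of "\<lambda>_. c" "\<bar>c\<bar>"]) simp

lemma ubl_minus: "ubl S \<delta> G \<Longrightarrow> ubl S \<delta> (\<lambda>p v. - G p v)"
  using ubl_mult[OF ubl_const[of "-1"]] by simp

lemma ubl_diff: "ubl S \<delta> G \<Longrightarrow> ubl S \<delta> H \<Longrightarrow> ubl S \<delta> (\<lambda>p v. G p v - H p v)"
  using ubl_add[of G "\<lambda>p v. - H p v"] ubl_minus[of H] by simp

lemma ubl_sum:
  assumes "finite I" "\<And>i. i \<in> I \<Longrightarrow> ubl S \<delta> (G i)"
  shows "ubl S \<delta> (\<lambda>p v. \<Sum>i\<in>I. G i p v)"
  using assms
proof (induction I rule: finite_induct)
  case empty then show ?case using ubl_const[of 0] by simp
next
  case (insert i I)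
  then show ?case using ubl_add[of "G i" "\<lambda>p v. \<Sum>i\<in>I. G i p v"] by simp
qed

lemma ubl_projection:
  "(\<And>v. v \<in> S \<Longrightarrow> \<bar>h v\<bar> \<le> R) \<Longrightarrow> (\<And>v v'. v \<in> S \<Longrightarrow> v' \<in> S \<Longrightarrow> \<bar>h v - h v'\<bar> \<le> \<delta> v v') \<Longrightarrow> ubl S \<delta> (\<lambda>p v. h v)"
  unfolding ubl_def
\<comment> \<open>One constant has to bound the values, by \<open>R\<close>, and to be a Lipschitz
  constant, for which 1 suffices.\<close>
proof (intro exI[of _ "max 1 \<bar>R\<bar>"] conjI allI ballI)
  fix v v' assume h: "\<And>v. v \<in> S \<Longrightarrow> \<bar>h v\<bar> \<le> R" "\<And>v v'. v \<in> S \<Longrightarrow> v' \<in> S \<Longrightarrow> \<bar>h v - h v'\<bar> \<le> \<delta> v v'" "v \<in> S" "v' \<in> S"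
  show "\<bar>h v\<bar> \<le> max 1 \<bar>R\<bar>" using h(1)[OF h(3)] by linarith
  have "1 * \<delta> v v' \<le> max 1 \<bar>R\<bar> * \<delta> v v'" by (intro mult_right_mono \<delta>) simp
  then show "\<bar>h v - h v'\<bar> \<le> max 1 \<bar>R\<bar> * \<delta> v v'" using h(2)[OF h(3,4)] by linarith
qed simp

lemma ubl_sigmoid:
  assumes "ubl S \<delta> G"
  shows "ubl S \<delta> (\<lambda>p v. sigmoid (G p v))"
proof -
  obtain C where C: "C \<ge> 0" "\<And>p v v'. v \<in> S \<Longrightarrow> v' \<in> S \<Longrightarrow> \<bar>G p v\<bar> \<le> C \<and> \<bar>G p v - G p v'\<bar> \<le> C * \<delta> v v'"
    using assms unfolding ubl_def by blast
  have "\<bar>sigmoid (G p v)\<bar> \<le> 1 + C \<and> \<bar>sigmoid (G p v) - sigmoid (G p v')\<bar> \<le> (1 + C) * \<delta> v v'"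
    if v: "v \<in> S" "v' \<in> S" for p v v'
  proof
    show "\<bar>sigmoid (G p v)\<bar> \<le> 1 + C" using sigmoid_bounds[of "G p v"] C(1) by linarith
    have "\<bar>sigmoid (G p v) - sigmoid (G p v')\<bar> \<le> 1/4 * \<bar>G p v - G p v'\<bar>" by (rule sigmoid_lipschitz)
    also have "\<dots> \<le> \<bar>G p v - G p v'\<bar>" by simp
    also have "\<dots> \<le> C * \<delta> v v'" using C(2)[OF v, of p] by simp
    also have "\<dots> \<le> (1 + C) * \<delta> v v'" by (intro mult_right_mono \<delta>) simp
    finally show "\<bar>sigmoid (G p v) - sigmoid (G p v')\<bar> \<le> (1 + C) * \<delta> v v'" .
  qed
  then show ?thesis unfolding ubl_def using C(1) by (intro exI[of _ "1 + C"]) auto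
qed

lemma ubl_deriv_sigmoid:
  assumes "ubl S \<delta> G"
  shows "ubl S \<delta> (\<lambda>p v. deriv sigmoid (G p v))" "ubl S \<delta> (\<lambda>p v. deriv (deriv sigmoid) (G p v))"
proof -
  show "ubl S \<delta> (\<lambda>p v. deriv sigmoid (G p v))"
    unfolding deriv_sigmoid by (intro ubl_mult ubl_diff ubl_const ubl_sigmoid assms)
  show "ubl S \<delta> (\<lambda>p v. deriv (deriv sigmoid) (G p v))"
    unfolding deriv2_sigmoid by (intro ubl_mult ubl_diff ubl_const ubl_sigmoid assms)
qed

end

lemma ubl_mono:
  assumes "ubl S \<delta> G" "S' \<subseteq> S" "\<And>v v'. \<delta> v v' \<le> \<delta>' v v'"
  shows "ubl S' \<delta>' G"
proof -
  obtain C where C: "C \<ge> 0" "\<And>p v v'. v \<in> S \<Longrightarrow> v' \<in> S \<Longrightarrow> \<bar>G p v\<bar> \<le> C \<and> \<bar>G p v - G p v'\<bar> \<le> C * \<delta> v v'"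
    using assms(1) unfolding ubl_def by blast
  have "\<bar>G p v\<bar> \<le> C \<and> \<bar>G p v - G p v'\<bar> \<le> C * \<delta>' v v'" if "v \<in> S'" "v' \<in> S'" for p v v'
    using C(2)[of v v' p] that assms(2) mult_left_mono[OF assms(3)[of v v'] C(1)] by (auto intro: order_trans)
  then show ?thesis unfolding ubl_def using C(1) by blast
qed

lemma infnorm_vec_component_le: "infnorm ((x::'a::euclidean_space^'n) $ i) \<le> infnorm x"
  using infnorm_vec_le_iff[of x "infnorm x"] by simp

text \<open>
  Only the trajectories of the chain stay in the unit box, whereas the kernels may charge its complement.
  Clamping the input makes the Lipschitz constants of the recursion global.
\<close>

definition clamp1 :: "real^'d \<Rightarrow> real^'d" where
  "clamp1 x = (\<chi> j. max (-1) (min 1 (x $ j)))"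

lemma clamp1_id: "infnorm x \<le> 1 \<Longrightarrow> clamp1 x = x"
  by (simp add: clamp1_def vec_eq_iff infnorm_vec_le_iff abs_le_iff min_def max_def) (metis antisym minus_le_iff)

lemma clamp1_bound: "\<bar>clamp1 x $ j\<bar> \<le> 1"
  by (auto simp: clamp1_def)

lemma clamp1_lipschitz: "\<bar>clamp1 x $ j - clamp1 y $ j\<bar> \<le> infnorm (x - y)"
proof -
  have "\<bar>clamp1 x $ j - clamp1 y $ j\<bar> \<le> \<bar>x $ j - y $ j\<bar>" by (auto simp: clamp1_def min_def max_def)
  also have "\<dots> \<le> infnorm (x - y)" using component_le_infnorm_cart[of "x - y" j] by simp
  finally show ?thesis .
qed

section \<open>Nested regions and distances for the state and its derivatives\<close>

type_synonym ('d, 'z, 'n) vstate =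
  "((real^'d) \<times> (real^'z)) \<times> ('d, 'n) ustate"

abbreviation (input) "vx v \<equiv> clamp1 (fst (fst v))"
abbreviation (input) "vs v \<equiv> fst (snd v)"
abbreviation (input) "vs1 v \<equiv> fst (snd (snd v))"
abbreviation (input) "vs2 v \<equiv> snd (snd (snd v))"

text \<open>The second derivatives are left free here: they enter the recursion linearly, and their
  coefficients as well as the remaining terms depend only on the parameter, the input, the state and
  the first derivatives.\<close>

definition region1 :: "real \<Rightarrow> ('d::finite, 'z::finite, 'n::finite) vstate set" where
  "region1 R1 = {v. infnorm (vs v) \<le> 1 \<and> infnorm (vs1 v) \<le> R1}"

definition region :: "real \<Rightarrow> real \<Rightarrow> ('d::finite, 'z::finite, 'n::finite) vstate set" where
  "region R1 R2 = {v \<in> region1 R1. infnorm (vs2 v) \<le> R2}"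

text \<open>\<open>dist0\<close>, \<open>dist1\<close> and \<open>dist2\<close> add one order of
  differentiation at a time. The lower-order terms in the recursion of a given order can then be
  estimated by the distance one step below.\<close>

definition dist0 :: "('d::finite, 'z::finite, 'n::finite) vstate \<Rightarrow> ('d, 'z, 'n) vstate \<Rightarrow> real" where
  "dist0 v v' = infnorm (fst v - fst v') + infnorm (vs v - vs v')"

definition dist1 :: "('d::finite, 'z::finite, 'n::finite) vstate \<Rightarrow> ('d, 'z, 'n) vstate \<Rightarrow> real" where
  "dist1 v v' = dist0 v v' + infnorm (vs1 v - vs1 v')"

definition dist2 :: "('d::finite, 'z::finite, 'n::finite) vstate \<Rightarrow> ('d, 'z, 'n) vstate \<Rightarrow> real" where
  "dist2 v v' = dist1 v v' + infnorm (vs2 v - vs2 v')"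

lemma dist_nonneg: "0 \<le> dist0 v v'" "0 \<le> dist1 v v'" "0 \<le> dist2 v v'"
  by (simp_all add: dist0_def dist1_def dist2_def infnorm_pos_le)

lemma infnorm_component2: "\<bar>(x::real^'n^'e) $ a $ k\<bar> \<le> infnorm x"
  using infnorm_vec_component_le[of x a] component_le_infnorm_cart[of "x $ a" k] by linarith

lemma infnorm_component3: "\<bar>(x::real^'n^'e^'e) $ a $ b $ k\<bar> \<le> infnorm x"
  using infnorm_vec_component_le[of x a] infnorm_component2[of "x $ a" b k] by linarith

lemma infnorm_fst_le: "infnorm (fst p) \<le> infnorm p" and infnorm_snd_le: "infnorm (snd p) \<le> infnorm p"
  using infnorm_Pair_le_iff[of "fst p" "snd p" "infnorm p"] by simp_all

lemma ubl_vx: "ubl S dist0 (\<lambda>p v. vx v $ j)" for S :: "('d::finite, 'z::finite, 'n::finite) vstate set"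
proof (rule ubl_projection[OF dist_nonneg(1)])
  fix v v' :: "('d, 'z, 'n) vstate"
  show "\<bar>vx v $ j\<bar> \<le> 1" by (rule clamp1_bound)
  show "\<bar>vx v $ j - vx v' $ j\<bar> \<le> dist0 v v'"
    using clamp1_lipschitz[of "fst (fst v)" j "fst (fst v')"] infnorm_fst_le[of "fst v - fst v'"]
      infnorm_pos_le[of "vs v - vs v'"]
    by (simp add: dist0_def)
qed

lemma ubl_vs: "ubl (region1 R1 :: ('d::finite, 'z::finite, 'n::finite) vstate set) dist0 (\<lambda>p v. vs v $ k)"
proof (rule ubl_projection[OF dist_nonneg(1)])
  fix v v' :: "('d, 'z, 'n) vstate"
  show "\<bar>vs v $ k\<bar> \<le> 1" if "v \<in> region1 R1"
    using that component_le_infnorm_cart[of "vs v" k] by (simp add: region1_def)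
  show "\<bar>vs v $ k - vs v' $ k\<bar> \<le> dist0 v v'"
    using component_le_infnorm_cart[of "vs v - vs v'" k] infnorm_pos_le[of "fst v - fst v'"]
    by (simp add: dist0_def)
qed

lemma ubl_vs1: "ubl (region1 R1 :: ('d::finite, 'z::finite, 'n::finite) vstate set) dist1 (\<lambda>p v. vs1 v $ a $ k)"
proof (rule ubl_projection[OF dist_nonneg(2)])
  fix v v' :: "('d, 'z, 'n) vstate"
  show "\<bar>vs1 v $ a $ k\<bar> \<le> R1" if "v \<in> region1 R1"
    using that infnorm_component2[of "vs1 v" a k] by (simp add: region1_def)
  show "\<bar>vs1 v $ a $ k - vs1 v' $ a $ k\<bar> \<le> dist1 v v'"
    using infnorm_component2[of "vs1 v - vs1 v'" a k] dist_nonneg(1)[of v v'] by (simp add: dist1_def)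
qed

lemma ubl_vs2: "ubl (region R1 R2 :: ('d::finite, 'z::finite, 'n::finite) vstate set) dist2 (\<lambda>p v. vs2 v $ a $ b $ k)"
proof (rule ubl_projection[OF dist_nonneg(3)])
  fix v v' :: "('d, 'z, 'n) vstate"
  show "\<bar>vs2 v $ a $ b $ k\<bar> \<le> R2" if "v \<in> region R1 R2"
    using that infnorm_component3[of "vs2 v" a b k] by (simp add: region_def)
  show "\<bar>vs2 v $ a $ b $ k - vs2 v' $ a $ b $ k\<bar> \<le> dist2 v v'"
    using infnorm_component3[of "vs2 v - vs2 v'" a b k] dist_nonneg(2)[of v v'] by (simp add: dist2_def)
qed

lemma ubl_dist0_dist1: "ubl S dist0 G \<Longrightarrow> ubl S dist1 G"
  by (erule ubl_mono) (auto simp: dist1_def infnorm_pos_le)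

lemma ubl_dist1_dist2: "ubl S dist1 G \<Longrightarrow> ubl S dist2 G"
  by (erule ubl_mono) (auto simp: dist2_def infnorm_pos_le)

text \<open>For a finite family the individual constants are nonnegative, so their sum dominates
  each of them.\<close>

lemma ubl_uniform:
  assumes "finite I" "\<And>i. i \<in> I \<Longrightarrow> ubl S \<delta> (G i)" and \<delta>: "\<And>v v'. 0 \<le> \<delta> v v'"
  obtains C where "0 \<le> C" "\<And>i p v. i \<in> I \<Longrightarrow> v \<in> S \<Longrightarrow> \<bar>G i p v\<bar> \<le> C"
    "\<And>i p v v'. i \<in> I \<Longrightarrow> v \<in> S \<Longrightarrow> v' \<in> S \<Longrightarrow> \<bar>G i p v - G i p v'\<bar> \<le> C * \<delta> v v'"
proof -
  have "\<forall>i\<in>I. \<exists>C\<ge>0. \<forall>p. \<forall>v\<in>S. \<forall>v'\<in>S. \<bar>G i p v\<bar> \<le> C \<and> \<bar>G i p v - G i p v'\<bar> \<le> C * \<delta> v v'"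
    using assms(2) unfolding ubl_def by blast
  from bchoice[OF this] obtain C where
    C: "\<And>i. i \<in> I \<Longrightarrow> C i \<ge> 0" "\<And>i p v v'. i \<in> I \<Longrightarrow> v \<in> S \<Longrightarrow> v' \<in> S \<Longrightarrow> \<bar>G i p v\<bar> \<le> C i \<and> \<bar>G i p v - G i p v'\<bar> \<le> C i * \<delta> v v'"
    by blast
  have le: "C i \<le> sum C I" if "i \<in> I" for i by (rule member_le_sum) (use that C(1) assms(1) in auto)
  show ?thesis
  proof (rule that[of "sum C I"])
    show "0 \<le> sum C I" using C(1) by (rule sum_nonneg)
    show "\<bar>G i p v\<bar> \<le> sum C I" if "i \<in> I" "v \<in> S" for i p v
      using C(2)[of i v v p] le[of i] that by linarith
    show "\<bar>G i p v - G i p v'\<bar> \<le> sum C I * \<delta> v v'" if "i \<in> I" "v \<in> S" "v' \<in> S" for i p v v'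
      using C(2)[OF that, of p] mult_right_mono[OF le[OF that(1)] \<delta>[of v v']] by linarith
  qed
qed

lemma ubl_if: "ubl S \<delta> G \<Longrightarrow> ubl S \<delta> H \<Longrightarrow> ubl S \<delta> (\<lambda>p v. if P then G p v else H p v)"
  by (cases P) simp_all

lemma ubl_bounded: "(\<And>y. \<bar>u y\<bar> \<le> C) \<Longrightarrow> (\<And>v v'. 0 \<le> \<delta> v v') \<Longrightarrow> ubl S \<delta> (\<lambda>p v. u (h p))"
  by (rule ubl_param) auto

text \<open>Closure rules specialised to one distance each, so that the proof of a bound follows the
  syntax of the expression.\<close>

lemmas ubl_dist0 = ubl_add[OF dist_nonneg(1)] ubl_mult[OF dist_nonneg(1)] ubl_const[OF dist_nonneg(1)]
  ubl_sum[OF dist_nonneg(1) finite_class.finite_UNIV] ubl_diff[OF dist_nonneg(1)]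
lemmas ubl_dist1 = ubl_add[OF dist_nonneg(2)] ubl_mult[OF dist_nonneg(2)] ubl_const[OF dist_nonneg(2)]
  ubl_sum[OF dist_nonneg(2) finite_class.finite_UNIV] ubl_diff[OF dist_nonneg(2)]
lemmas ubl_dist2 = ubl_add[OF dist_nonneg(3)] ubl_mult[OF dist_nonneg(3)] ubl_const[OF dist_nonneg(3)]
  ubl_sum[OF dist_nonneg(3) finite_class.finite_UNIV] ubl_diff[OF dist_nonneg(3)]

lemma abs_average_le:
  fixes c y :: "'n::finite \<Rightarrow> real"
  assumes "\<And>l. \<bar>c l\<bar> \<le> C" "\<And>l. \<bar>y l\<bar> \<le> m" "0 \<le> m"
  shows "\<bar>1 / real CARD('n) * (\<Sum>l\<in>UNIV. c l * y l)\<bar> \<le> C * m"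
proof -
  have C: "0 \<le> C" using assms(1)[of undefined] by linarith
  have "\<bar>\<Sum>l\<in>UNIV. c l * y l\<bar> \<le> (\<Sum>l\<in>(UNIV::'n set). C * m)"
    by (rule order_trans[OF sum_abs sum_mono]) (use assms C in \<open>auto simp: abs_mult intro!: mult_mono\<close>)
  then show ?thesis by (simp add: abs_mult divide_le_eq mult.commute)
qed

text \<open>The difference splits into one gain applied to two states and two gains applied to one
  state. The first part carries the contraction \<open>C / 4\<close>; in the applications
  \<open>e\<close> involves only the input and the hidden state, so the second part is of lower
  order.\<close>

lemma damped_average_diff:
  fixes c y y' :: "'n::finite \<Rightarrow> real"
  assumes c: "\<And>l. \<bar>c l\<bar> \<le> C" and \<alpha>: "\<bar>\<alpha>\<bar> \<le> 1/4" and d: "\<bar>\<alpha> - \<alpha>'\<bar> \<le> e"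
    and y: "\<And>l. \<bar>y l - y' l\<bar> \<le> m" "\<And>l. \<bar>y' l\<bar> \<le> R" "0 \<le> m" "0 \<le> R"
  shows "\<bar>\<alpha> * (1 / real CARD('n) * (\<Sum>l\<in>UNIV. c l * y l)) - \<alpha>' * (1 / real CARD('n) * (\<Sum>l\<in>UNIV. c l * y' l))\<bar>
    \<le> C / 4 * m + e * (C * R)"
proof -
  have C: "0 \<le> C" using c[of undefined] by linarith
  have "\<alpha> * (1 / real CARD('n) * (\<Sum>l\<in>UNIV. c l * y l)) - \<alpha>' * (1 / real CARD('n) * (\<Sum>l\<in>UNIV. c l * y' l))
      = \<alpha> * (1 / real CARD('n) * (\<Sum>l\<in>UNIV. c l * (y l - y' l)))
        + (\<alpha> - \<alpha>') * (1 / real CARD('n) * (\<Sum>l\<in>UNIV. c l * y' l))"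
    by (simp add: right_diff_distrib left_diff_distrib sum_subtractf diff_divide_distrib)
  also have "\<bar>\<dots>\<bar> \<le> \<bar>\<alpha>\<bar> * \<bar>1 / real CARD('n) * (\<Sum>l\<in>UNIV. c l * (y l - y' l))\<bar>
        + \<bar>\<alpha> - \<alpha>'\<bar> * \<bar>1 / real CARD('n) * (\<Sum>l\<in>UNIV. c l * y' l)\<bar>"
    by (rule order_trans[OF abs_triangle_ineq]) (simp only: abs_mult order_refl)
  also have "\<dots> \<le> 1/4 * (C * m) + e * (C * R)"
    by (intro add_mono mult_mono abs_average_le c y \<alpha> d) (use d in auto)
  finally show ?thesis by simp
qed

section \<open>Diagonal and lower-order parts of the recursion\<close>

definition step_at ::
  "(real \<Rightarrow> real) \<Rightarrow> ('d::finite, 'n::finite) param \<Rightarrow> ('d, 'z::finite, 'n) vstate \<Rightarrow>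
   ('d, 'n) ustate" where
  "step_at \<phi> \<theta> v = net_step \<phi> \<theta> (vx v) (snd v)"

locale bounded_activation =
  fixes \<phi> :: "real \<Rightarrow> real" and C0 C1 C2 :: real
  assumes C0: "\<And>y. \<bar>\<phi> y\<bar> \<le> C0" and C1: "\<And>y. \<bar>deriv \<phi> y\<bar> \<le> C1" and C2: "\<And>y. \<bar>deriv (deriv \<phi>) y\<bar> \<le> C2"
    and C0_small: "C0 < 4"
begin

lemma C_nonneg: "0 \<le> C0" "0 \<le> C1"
  using C0[of 0] C1[of 0] by linarith+

text \<open>The part of \<open>dpreact\<close> that comes from differentiating the weight itself;
  the rest is feedback through the first derivatives of the state.\<close>

definition direct :: "('d, 'n) entry \<Rightarrow> 'n \<Rightarrow> ('d::finite, 'n::finite) param \<Rightarrow> ('d, 'z::finite, 'n) vstate \<Rightarrow> real" where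
  "direct a k \<theta> v = (case a of
        EntA i j \<Rightarrow> if i = k then 1 / real CARD('d) * deriv \<phi> (parA \<theta> k j) * vx v $ j else 0
      | EntW i j \<Rightarrow> if i = k then 1 / real CARD('n) * deriv \<phi> (parW \<theta> k j) * vs v $ j else 0)"

lemma ubl_preact:
  "ubl (region1 R1 :: ('d::finite, 'z::finite, 'n::finite) vstate set) dist0 (\<lambda>\<theta> v. preact \<phi> \<theta> (vx v) (vs v) k)"
  unfolding preact_def
  by (intro ubl_dist0 ubl_vx ubl_vs ubl_bounded[OF C0 dist_nonneg(1)])

lemma ubl_direct:
  "ubl (region1 R1 :: ('d::finite, 'z::finite, 'n::finite) vstate set) dist0 (direct a k)"
proof (cases a)
  case (EntA i j)
  have Z: "ubl (region1 R1 :: ('d, 'z, 'n) vstate set) dist0 (\<lambda>\<theta> v. 0)" by (rule ubl_dist0)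
  have "ubl (region1 R1 :: ('d, 'z, 'n) vstate set) dist0 (\<lambda>\<theta> v. 1 / real CARD('d) * deriv \<phi> (parA \<theta> k j) * vx v $ j)"
    by (intro ubl_dist0 ubl_vx ubl_bounded[OF C1 dist_nonneg(1)])
  then show ?thesis
    using Z by (cases "i = k") (simp_all add: direct_def[abs_def] EntA)
next
  case (EntW i j)
  have Z: "ubl (region1 R1 :: ('d, 'z, 'n) vstate set) dist0 (\<lambda>\<theta> v. 0)" by (rule ubl_dist0)
  have "ubl (region1 R1 :: ('d, 'z, 'n) vstate set) dist0 (\<lambda>\<theta> v. 1 / real CARD('n) * deriv \<phi> (parW \<theta> k j) * vs v $ j)"
    by (intro ubl_dist0 ubl_vs ubl_bounded[OF C1 dist_nonneg(1)])
  then show ?thesis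
    using Z by (cases "i = k") (simp_all add: direct_def[abs_def] EntW)
qed

lemma dpreact_eq_direct:
  "dpreact \<phi> \<theta> (vx v) (vs v) s1 a k = direct a k \<theta> v + 1 / real CARD('n) * (\<Sum>l\<in>UNIV. \<phi> (parW \<theta> k l) * s1 $ a $ l)"
  for \<theta> :: "('d::finite, 'n::finite) param"
  by (simp add: dpreact_def direct_def)

lemma ubl_dpreact:
  "ubl (region1 R1 :: ('d::finite, 'z::finite, 'n::finite) vstate set) dist1 (\<lambda>\<theta> v. dpreact \<phi> \<theta> (vx v) (vs v) (vs1 v) a k)"
  unfolding dpreact_eq_direct
  by (intro ubl_dist1 ubl_vs1 ubl_bounded[OF C0 dist_nonneg(2)] ubl_dist0_dist1[OF ubl_direct])

text \<open>What remains of \<open>ddpreact\<close> once the feedback through the second derivatives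
  of the state is removed.\<close>

definition mixed :: "('d, 'n) entry \<Rightarrow> ('d, 'n) entry \<Rightarrow> 'n \<Rightarrow> ('d::finite, 'n::finite) param \<Rightarrow> ('d, 'z::finite, 'n) vstate \<Rightarrow> real" where
  "mixed a b k \<theta> v =
     (if a = b then
        (case a of
           EntA i j \<Rightarrow> if i = k then 1 / real CARD('d) * deriv (deriv \<phi>) (parA \<theta> k j) * vx v $ j else 0
         | EntW i j \<Rightarrow> if i = k then 1 / real CARD('n) * deriv (deriv \<phi>) (parW \<theta> k j) * vs v $ j else 0)
      else 0)
   + (case a of
        EntA i j \<Rightarrow> 0
      | EntW i j \<Rightarrow> if i = k then 1 / real CARD('n) * deriv \<phi> (parW \<theta> k j) * vs1 v $ b $ j else 0)
   + (case b of
        EntA i j \<Rightarrow> 0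
      | EntW i j \<Rightarrow> if i = k then 1 / real CARD('n) * deriv \<phi> (parW \<theta> k j) * vs1 v $ a $ j else 0)"

lemma ddpreact_eq_mixed:
  "ddpreact \<phi> \<theta> (vx v) (vs v) (vs1 v) s2 a b k
    = mixed a b k \<theta> v + 1 / real CARD('n) * (\<Sum>l\<in>UNIV. \<phi> (parW \<theta> k l) * s2 $ a $ b $ l)"
  for \<theta> :: "('d::finite, 'n::finite) param"
  by (simp add: ddpreact_def mixed_def)

lemma ubl_mixed:
  "ubl (region1 R1 :: ('d::finite, 'z::finite, 'n::finite) vstate set) dist1 (mixed a b k)"
proof -
  let ?S = "region1 R1 :: ('d, 'z, 'n) vstate set"
  have A: "ubl ?S dist1 (\<lambda>\<theta> v. 1 / real CARD('d) * deriv (deriv \<phi>) (parA \<theta> k j) * vx v $ j)" for j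
    by (intro ubl_dist1 ubl_dist0_dist1[OF ubl_vx] ubl_bounded[OF C2 dist_nonneg(2)])
  have W: "ubl ?S dist1 (\<lambda>\<theta> v. 1 / real CARD('n) * deriv (deriv \<phi>) (parW \<theta> k j) * vs v $ j)" for j
    by (intro ubl_dist1 ubl_dist0_dist1[OF ubl_vs] ubl_bounded[OF C2 dist_nonneg(2)])
  have W1: "ubl ?S dist1 (\<lambda>\<theta> v. 1 / real CARD('n) * deriv \<phi> (parW \<theta> k j) * vs1 v $ b $ j)" for j b
    by (intro ubl_dist1 ubl_vs1 ubl_bounded[OF C1 dist_nonneg(2)])
  have Z: "ubl ?S dist1 (\<lambda>\<theta> v. 0)" by (rule ubl_dist1)
  have "ubl ?S dist1 (\<lambda>\<theta> v. case e of
           EntA i j \<Rightarrow> if i = k then 1 / real CARD('d) * deriv (deriv \<phi>) (parA \<theta> k j) * vx v $ j else 0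
         | EntW i j \<Rightarrow> if i = k then 1 / real CARD('n) * deriv (deriv \<phi>) (parW \<theta> k j) * vs v $ j else 0)" for e
    by (cases e) (simp_all only: entry.case ubl_if A W Z)
  then have 1: "ubl ?S dist1 (\<lambda>\<theta> v. if a = b then
        (case a of
           EntA i j \<Rightarrow> if i = k then 1 / real CARD('d) * deriv (deriv \<phi>) (parA \<theta> k j) * vx v $ j else 0
         | EntW i j \<Rightarrow> if i = k then 1 / real CARD('n) * deriv (deriv \<phi>) (parW \<theta> k j) * vs v $ j else 0)
      else 0)"
    by (intro ubl_if Z)
  have 2: "ubl ?S dist1 (\<lambda>\<theta> v. case a of
        EntA i j \<Rightarrow> 0
      | EntW i j \<Rightarrow> if i = k then 1 / real CARD('n) * deriv \<phi> (parW \<theta> k j) * vs1 v $ b $ j else 0)" for a b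
    by (cases a) (simp_all only: entry.case ubl_if W1 Z)
  show ?thesis unfolding mixed_def[abs_def] by (intro ubl_dist1 1 2)
qed

text \<open>The second-order recursion without its diagonal term. The omitted term is linear in the
  second derivatives with factor at most \<open>C0 / 4\<close>.\<close>

definition curvature :: "('d, 'n) entry \<Rightarrow> ('d, 'n) entry \<Rightarrow> 'n \<Rightarrow> ('d::finite, 'n::finite) param \<Rightarrow> ('d, 'z::finite, 'n) vstate \<Rightarrow> real" where
  "curvature a b k \<theta> v =
     deriv (deriv sigmoid) (preact \<phi> \<theta> (vx v) (vs v) k) * dpreact \<phi> \<theta> (vx v) (vs v) (vs1 v) a k * dpreact \<phi> \<theta> (vx v) (vs v) (vs1 v) b k
     + deriv sigmoid (preact \<phi> \<theta> (vx v) (vs v) k) * mixed a b k \<theta> v"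

lemma ubl_curvature:
  "ubl (region1 R1 :: ('d::finite, 'z::finite, 'n::finite) vstate set) dist1 (curvature a b k)"
  unfolding curvature_def[abs_def]
  by (intro ubl_dist1 ubl_mixed ubl_dpreact ubl_dist0_dist1[OF ubl_deriv_sigmoid(1)[OF dist_nonneg(1) ubl_preact]]
      ubl_dist0_dist1[OF ubl_deriv_sigmoid(2)[OF dist_nonneg(1) ubl_preact]])

lemma step_at_components:
  fixes \<theta> :: "('d::finite, 'n::finite) param" and v :: "('d, 'z::finite, 'n) vstate"
  shows "fst (step_at \<phi> \<theta> v) $ k = sigmoid (preact \<phi> \<theta> (vx v) (vs v) k)"
    "fst (snd (step_at \<phi> \<theta> v)) $ a $ k = deriv sigmoid (preact \<phi> \<theta> (vx v) (vs v) k) * direct a k \<theta> v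
      + deriv sigmoid (preact \<phi> \<theta> (vx v) (vs v) k) * (1 / real CARD('n) * (\<Sum>l\<in>UNIV. \<phi> (parW \<theta> k l) * vs1 v $ a $ l))"
    "snd (snd (step_at \<phi> \<theta> v)) $ a $ b $ k = curvature a b k \<theta> v
      + deriv sigmoid (preact \<phi> \<theta> (vx v) (vs v) k) * (1 / real CARD('n) * (\<Sum>l\<in>UNIV. \<phi> (parW \<theta> k l) * vs2 v $ a $ b $ l))"
proof -
  show "fst (step_at \<phi> \<theta> v) $ k = sigmoid (preact \<phi> \<theta> (vx v) (vs v) k)"
    by (simp only: step_at_def net_step_def case_prod_beta fst_conv snd_conv vec_lambda_beta)
  show "fst (snd (step_at \<phi> \<theta> v)) $ a $ k = deriv sigmoid (preact \<phi> \<theta> (vx v) (vs v) k) * direct a k \<theta> v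
      + deriv sigmoid (preact \<phi> \<theta> (vx v) (vs v) k) * (1 / real CARD('n) * (\<Sum>l\<in>UNIV. \<phi> (parW \<theta> k l) * vs1 v $ a $ l))"
    by (simp only: step_at_def net_step_def case_prod_beta fst_conv snd_conv vec_lambda_beta dpreact_eq_direct distrib_left)
  show "snd (snd (step_at \<phi> \<theta> v)) $ a $ b $ k = curvature a b k \<theta> v
      + deriv sigmoid (preact \<phi> \<theta> (vx v) (vs v) k) * (1 / real CARD('n) * (\<Sum>l\<in>UNIV. \<phi> (parW \<theta> k l) * vs2 v $ a $ b $ l))"
    by (simp only: step_at_def net_step_def case_prod_beta fst_conv snd_conv vec_lambda_beta ddpreact_eq_mixed curvature_def distrib_left add.assoc)
qed

end

lemma abs_diff_add_le: "\<bar>p - p'\<bar> \<le> a \<Longrightarrow> \<bar>x - x'\<bar> \<le> b \<Longrightarrow> \<bar>(p + x) - (p' + x')\<bar> \<le> a + (b::real)"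
  by linarith

context bounded_activation
begin

lemma preact_lipschitz:
  fixes \<theta> :: "('d::finite, 'n::finite) param" and v v' :: "('d, 'z::finite, 'n) vstate"
  shows "\<bar>preact \<phi> \<theta> (vx v) (vs v) k - preact \<phi> \<theta> (vx v') (vs v') k\<bar> \<le> C0 * dist0 v v'"
proof -
  have "preact \<phi> \<theta> (vx v) (vs v) k - preact \<phi> \<theta> (vx v') (vs v') k
      = 1 / real CARD('d) * (\<Sum>j\<in>UNIV. \<phi> (parA \<theta> k j) * (vx v $ j - vx v' $ j))
      + 1 / real CARD('n) * (\<Sum>j\<in>UNIV. \<phi> (parW \<theta> k j) * (vs v $ j - vs v' $ j))"
    by (simp add: preact_def right_diff_distrib sum_subtractf diff_divide_distrib)
  also have "\<bar>\<dots>\<bar> \<le> C0 * infnorm (fst v - fst v') + C0 * infnorm (vs v - vs v')"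
  proof (intro order_trans[OF abs_triangle_ineq] add_mono abs_average_le C0 infnorm_pos_le)
    show "\<bar>vx v $ l - vx v' $ l\<bar> \<le> infnorm (fst v - fst v')" for l
      using clamp1_lipschitz[of "fst (fst v)" l "fst (fst v')"] infnorm_fst_le[of "fst v - fst v'"] by simp
    show "\<bar>vs v $ l - vs v' $ l\<bar> \<le> infnorm (vs v - vs v')" for l
      using component_le_infnorm_cart[of "vs v - vs v'" l] by simp
  qed
  finally show ?thesis by (simp add: dist0_def distrib_left)
qed

lemma direct_bound:
  fixes v :: "('d::finite, 'z::finite, 'n::finite) vstate"
  assumes "v \<in> region1 R1"
  shows "\<bar>direct a k \<theta> v\<bar> \<le> C1"
proof -
  have prod: "\<bar>1 / real (CARD('e::finite)) * c * y\<bar> \<le> C1" if "\<bar>c\<bar> \<le> C1" "\<bar>y\<bar> \<le> 1" for c y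
  proof -
    have "\<bar>1 / real CARD('e)\<bar> \<le> 1" by simp
    then have "\<bar>1 / real CARD('e)\<bar> * \<bar>c\<bar> * \<bar>y\<bar> \<le> 1 * C1 * 1"
      using that by (intro mult_mono) auto
    then show ?thesis by (simp add: abs_mult)
  qed
  have "\<bar>vs v $ j\<bar> \<le> 1" for j
    using assms component_le_infnorm_cart[of "vs v" j] by (simp add: region1_def)
  then show ?thesis
    unfolding direct_def using C_nonneg(2)
    by (auto split: entry.split simp del: times_divide_eq_left times_divide_eq_right mult_1_left intro!: prod C1 clamp1_bound)
qed

definition gain :: "'n::finite \<Rightarrow> ('d::finite, 'n) param \<Rightarrow> ('d, 'z::finite, 'n) vstate \<Rightarrow> real" where
  "gain k \<theta> v = deriv sigmoid (preact \<phi> \<theta> (vx v) (vs v) k)"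

lemma ubl_gain:
  "ubl (region1 R1 :: ('d::finite, 'z::finite, 'n::finite) vstate set) dist0 (gain k)"
  unfolding gain_def[abs_def] by (rule ubl_deriv_sigmoid(1)[OF dist_nonneg(1) ubl_preact])

lemma gain_bound: "\<bar>gain k \<theta> v\<bar> \<le> 1/4"
  unfolding gain_def by (rule deriv_sigmoid_bound)

lemma step_at_gain:
  fixes \<theta> :: "('d::finite, 'n::finite) param" and v :: "('d, 'z::finite, 'n) vstate"
  shows "fst (step_at \<phi> \<theta> v) $ k = sigmoid (preact \<phi> \<theta> (vx v) (vs v) k)"
    "fst (snd (step_at \<phi> \<theta> v)) $ a $ k = gain k \<theta> v * direct a k \<theta> v
      + gain k \<theta> v * (1 / real CARD('n) * (\<Sum>l\<in>UNIV. \<phi> (parW \<theta> k l) * vs1 v $ a $ l))"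
    "snd (snd (step_at \<phi> \<theta> v)) $ a $ b $ k = curvature a b k \<theta> v
      + gain k \<theta> v * (1 / real CARD('n) * (\<Sum>l\<in>UNIV. \<phi> (parW \<theta> k l) * vs2 v $ a $ b $ l))"
  unfolding gain_def by (rule step_at_components)+

text \<open>A ball is mapped into itself when its radius solves
  \<open>lower-order bound + C0 / 4 * R = R\<close>, and each order contracts by
  \<open>C0 / 4\<close> up to differences of lower orders. The radii are chosen in succession, since
  the bound on \<open>curvature\<close> depends on \<open>R1\<close>.\<close>

lemma step_estimates:
  obtains R1 R2 c where "0 \<le> R1" "0 \<le> R2" "0 \<le> c"
    "\<And>\<theta> v :: ('d::finite, 'z::finite, 'n::finite) vstate. v \<in> region R1 R2 \<Longrightarrow>
       infnorm (fst (step_at \<phi> \<theta> v)) \<le> 1 \<and> infnorm (fst (snd (step_at \<phi> \<theta> v))) \<le> R1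
       \<and> infnorm (snd (snd (step_at \<phi> \<theta> v))) \<le> R2"
    "\<And>\<theta> v v' :: ('d, 'z, 'n) vstate.
       infnorm (fst (step_at \<phi> \<theta> v) - fst (step_at \<phi> \<theta> v')) \<le> C0 / 4 * dist0 v v'"
    "\<And>\<theta> v v' :: ('d, 'z, 'n) vstate. v \<in> region R1 R2 \<Longrightarrow> v' \<in> region R1 R2 \<Longrightarrow>
       infnorm (fst (snd (step_at \<phi> \<theta> v)) - fst (snd (step_at \<phi> \<theta> v')))
         \<le> C0 / 4 * infnorm (vs1 v - vs1 v') + c * dist0 v v'"
    "\<And>\<theta> v v' :: ('d, 'z, 'n) vstate. v \<in> region R1 R2 \<Longrightarrow> v' \<in> region R1 R2 \<Longrightarrow>
       infnorm (snd (snd (step_at \<phi> \<theta> v)) - snd (snd (step_at \<phi> \<theta> v')))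
         \<le> C0 / 4 * infnorm (vs2 v - vs2 v') + c * dist1 v v'"
proof -
  \<comment> \<open>The fixed point of \<open>R = C1 / 4 + C0 / 4 * R\<close>: the direct term is at
    most \<open>C1\<close>, and the gain is at most 1/4.\<close>
  define R1 where "R1 = C1 / (4 - C0)"
  have R1: "0 \<le> R1" "C1 / 4 + C0 / 4 * R1 = R1"
    using C0_small C_nonneg by (auto simp: R1_def field_simps)
  let ?S1 = "region1 R1 :: ('d, 'z, 'n) vstate set"
  obtain Ca where Ca: "0 \<le> Ca"
    "\<And>k \<theta> v v'. v \<in> ?S1 \<Longrightarrow> v' \<in> ?S1 \<Longrightarrow> \<bar>gain k \<theta> v - gain k \<theta> v'\<bar> \<le> Ca * dist0 v v'"
    by (rule ubl_uniform[of UNIV ?S1 dist0 gain, OF finite_class.finite_UNIV ubl_gain dist_nonneg(1)])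
      (rule that, assumption, simp_all)
  have mult_ubl: "ubl ?S1 dist0 (\<lambda>\<theta> v. gain (snd i) \<theta> v * direct (fst i) (snd i) \<theta> v)" for i
    by (rule ubl_mult[OF dist_nonneg(1) ubl_gain ubl_direct])
  obtain Cb where Cb_nn: "0 \<le> Cb"
    and Cb': "\<And>i \<theta> v v'. v \<in> ?S1 \<Longrightarrow> v' \<in> ?S1 \<Longrightarrow>
      \<bar>gain (snd i) \<theta> v * direct (fst i) (snd i) \<theta> v - gain (snd i) \<theta> v' * direct (fst i) (snd i) \<theta> v'\<bar> \<le> Cb * dist0 v v'"
    by (rule ubl_uniform[of UNIV ?S1 dist0 "\<lambda>i \<theta> v. gain (snd i) \<theta> v * direct (fst i) (snd i) \<theta> v",
          OF finite_class.finite_UNIV mult_ubl dist_nonneg(1)])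
      (rule that, assumption, simp_all)
  have Cb: "\<bar>gain k \<theta> v * direct a k \<theta> v - gain k \<theta> v' * direct a k \<theta> v'\<bar> \<le> Cb * dist0 v v'"
    if "v \<in> ?S1" "v' \<in> ?S1" for a k \<theta> v v'
    using Cb'[OF that, of "(a, k)" \<theta>] by simp
  have curv_ubl: "ubl ?S1 dist1 (curvature (fst i) (fst (snd i)) (snd (snd i)))" for i
    by (rule ubl_curvature)
  obtain Cc where Cc_nn: "0 \<le> Cc"
    and Cc1: "\<And>i \<theta> v. v \<in> ?S1 \<Longrightarrow> \<bar>curvature (fst i) (fst (snd i)) (snd (snd i)) \<theta> v\<bar> \<le> Cc"
    and Cc2: "\<And>i \<theta> v v'. v \<in> ?S1 \<Longrightarrow> v' \<in> ?S1 \<Longrightarrow>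
      \<bar>curvature (fst i) (fst (snd i)) (snd (snd i)) \<theta> v - curvature (fst i) (fst (snd i)) (snd (snd i)) \<theta> v'\<bar> \<le> Cc * dist1 v v'"
    by (rule ubl_uniform[of UNIV ?S1 dist1 "\<lambda>i. curvature (fst i) (fst (snd i)) (snd (snd i))",
          OF finite_class.finite_UNIV curv_ubl dist_nonneg(2)])
      (rule that, assumption, simp_all)
  have Cc_bd: "\<bar>curvature a b k \<theta> v\<bar> \<le> Cc" if "v \<in> ?S1" for a b k \<theta> v
    using Cc1[OF that, of "(a, b, k)" \<theta>] by simp
  have Cc_lip: "\<bar>curvature a b k \<theta> v - curvature a b k \<theta> v'\<bar> \<le> Cc * dist1 v v'"
    if "v \<in> ?S1" "v' \<in> ?S1" for a b k \<theta> v v'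
    using Cc2[OF that, of "(a, b, k)" \<theta>] by simp
  \<comment> \<open>The fixed point of \<open>R = Cc + C0 / 4 * R\<close>, where \<open>Cc\<close>
    bounds \<open>curvature\<close> on \<open>region1 R1\<close>.\<close>
  define R2 where "R2 = Cc / (1 - C0 / 4)"
  have R2: "0 \<le> R2" "Cc + C0 / 4 * R2 = R2"
    using C0_small C_nonneg Cc_nn by (auto simp: R2_def field_simps)
  \<comment> \<open>Serves both orders of derivatives. The terms with \<open>Ca\<close> stem from
    the variation of the gain, multiplied by the size of the averaged derivatives.\<close>
  define c where "c = max (Cb + Ca * (C0 * R1)) (Cc + Ca * (C0 * R2))"
  have c: "0 \<le> c" "Cb + Ca * (C0 * R1) \<le> c" "Cc + Ca * (C0 * R2) \<le> c"
    using Cb_nn Ca(1) C_nonneg R1(1) by (auto simp: c_def le_max_iff_disj)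
  have in1: "v \<in> ?S1" if "v \<in> region R1 R2" for v using that by (simp add: region_def)
  have s1: "\<bar>vs1 v $ a $ l\<bar> \<le> R1" if "v \<in> region R1 R2" for v :: "('d, 'z, 'n) vstate" and a l
    using that infnorm_component2[of "vs1 v" a l] by (simp add: region_def region1_def)
  have s2: "\<bar>vs2 v $ a $ b $ l\<bar> \<le> R2" if "v \<in> region R1 R2" for v :: "('d, 'z, 'n) vstate" and a b l
    using that infnorm_component3[of "vs2 v" a b l] by (simp add: region_def)
  show ?thesis
  proof (rule that[of R1 R2 c])
    fix \<theta> and v :: "('d, 'z, 'n) vstate" assume v: "v \<in> region R1 R2"
    have damp: "\<bar>gain k \<theta> v * (1 / real CARD('n) * (\<Sum>l\<in>UNIV. \<phi> (parW \<theta> k l) * y l))\<bar> \<le> C0 / 4 * R"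
      if "\<And>l. \<bar>y l\<bar> \<le> R" "0 \<le> R" for k y R
    proof -
      have "\<bar>gain k \<theta> v\<bar> * \<bar>1 / real CARD('n) * (\<Sum>l\<in>UNIV. \<phi> (parW \<theta> k l) * y l)\<bar> \<le> 1/4 * (C0 * R)"
        by (intro mult_mono gain_bound abs_average_le C0 that) auto
      then show ?thesis by (simp add: abs_mult)
    qed
    have "infnorm (fst (step_at \<phi> \<theta> v)) \<le> 1"
      using sigmoid_bounds by (simp add: infnorm_vec_le_iff step_at_gain(1) abs_le_iff less_imp_le)
    moreover have "\<bar>fst (snd (step_at \<phi> \<theta> v)) $ a $ k\<bar> \<le> R1" for a k
    proof -
      have "\<bar>gain k \<theta> v\<bar> * \<bar>direct a k \<theta> v\<bar> \<le> 1/4 * C1"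
        by (intro mult_mono gain_bound direct_bound[OF in1[OF v]]) auto
      then have "\<bar>gain k \<theta> v * direct a k \<theta> v\<bar> \<le> C1 / 4" by (simp add: abs_mult)
      from order_trans[OF abs_triangle_ineq add_mono[OF this damp[OF s1[OF v] R1(1)]]]
      show ?thesis unfolding step_at_gain(2) R1(2) .
    qed
    moreover have "\<bar>snd (snd (step_at \<phi> \<theta> v)) $ a $ b $ k\<bar> \<le> R2" for a b k
      using order_trans[OF abs_triangle_ineq add_mono[OF Cc_bd[OF in1[OF v]] damp[OF s2[OF v] R2(1)]]]
      unfolding step_at_gain(3) R2(2) .
    ultimately show "infnorm (fst (step_at \<phi> \<theta> v)) \<le> 1 \<and> infnorm (fst (snd (step_at \<phi> \<theta> v))) \<le> R1
       \<and> infnorm (snd (snd (step_at \<phi> \<theta> v))) \<le> R2"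
      by (simp add: infnorm_vec_le_iff)
  next
    fix \<theta> and v v' :: "('d, 'z, 'n) vstate"
    have "\<bar>fst (step_at \<phi> \<theta> v) $ k - fst (step_at \<phi> \<theta> v') $ k\<bar> \<le> C0 / 4 * dist0 v v'" for k
      using order_trans[OF sigmoid_lipschitz mult_left_mono[OF preact_lipschitz[of \<theta> v k v'], of "1/4"]]
      by (simp add: step_at_gain(1))
    then show "infnorm (fst (step_at \<phi> \<theta> v) - fst (step_at \<phi> \<theta> v')) \<le> C0 / 4 * dist0 v v'"
      unfolding infnorm_vec_le_iff by simp
  next
    fix \<theta> and v v' :: "('d, 'z, 'n) vstate" assume v: "v \<in> region R1 R2" "v' \<in> region R1 R2"
    note in1' = in1[OF v(1)] in1[OF v(2)]
    have d: "\<bar>vs1 v $ a $ l - vs1 v' $ a $ l\<bar> \<le> infnorm (vs1 v - vs1 v')" for a l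
      using infnorm_component2[of "vs1 v - vs1 v'" a l] by simp
    have "\<bar>fst (snd (step_at \<phi> \<theta> v)) $ a $ k - fst (snd (step_at \<phi> \<theta> v')) $ a $ k\<bar>
        \<le> C0 / 4 * infnorm (vs1 v - vs1 v') + c * dist0 v v'" for a k
    proof -
      have "\<bar>fst (snd (step_at \<phi> \<theta> v)) $ a $ k - fst (snd (step_at \<phi> \<theta> v')) $ a $ k\<bar>
        \<le> Cb * dist0 v v' + (C0 / 4 * infnorm (vs1 v - vs1 v') + Ca * dist0 v v' * (C0 * R1))"
        unfolding step_at_gain(2)
        by (rule abs_diff_add_le[OF Cb[OF in1']], rule damped_average_diff)
          (rule C0 gain_bound Ca(2)[OF in1'] d s1[OF v(2)] infnorm_pos_le R1(1))+
      also have "\<dots> = C0 / 4 * infnorm (vs1 v - vs1 v') + (Cb + Ca * (C0 * R1)) * dist0 v v'"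
        by (simp add: algebra_simps)
      also have "\<dots> \<le> C0 / 4 * infnorm (vs1 v - vs1 v') + c * dist0 v v'"
        by (intro add_left_mono mult_right_mono c dist_nonneg)
      finally show ?thesis .
    qed
    then show "infnorm (fst (snd (step_at \<phi> \<theta> v)) - fst (snd (step_at \<phi> \<theta> v')))
         \<le> C0 / 4 * infnorm (vs1 v - vs1 v') + c * dist0 v v'"
      by (simp add: infnorm_vec_le_iff)
  next
    fix \<theta> and v v' :: "('d, 'z, 'n) vstate" assume v: "v \<in> region R1 R2" "v' \<in> region R1 R2"
    note in1' = in1[OF v(1)] in1[OF v(2)]
    have d: "\<bar>vs2 v $ a $ b $ l - vs2 v' $ a $ b $ l\<bar> \<le> infnorm (vs2 v - vs2 v')" for a b l
      using infnorm_component3[of "vs2 v - vs2 v'" a b l] by simp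
    have "\<bar>snd (snd (step_at \<phi> \<theta> v)) $ a $ b $ k - snd (snd (step_at \<phi> \<theta> v')) $ a $ b $ k\<bar>
        \<le> C0 / 4 * infnorm (vs2 v - vs2 v') + c * dist1 v v'" for a b k
    proof -
      have "\<bar>snd (snd (step_at \<phi> \<theta> v)) $ a $ b $ k - snd (snd (step_at \<phi> \<theta> v')) $ a $ b $ k\<bar>
        \<le> Cc * dist1 v v' + (C0 / 4 * infnorm (vs2 v - vs2 v') + Ca * dist0 v v' * (C0 * R2))"
        unfolding step_at_gain(3)
        by (rule abs_diff_add_le[OF Cc_lip[OF in1']], rule damped_average_diff)
          (rule C0 gain_bound Ca(2)[OF in1'] d s2[OF v(2)] infnorm_pos_le R2(1))+
      \<comment> \<open>The variation of the gain is measured by \<open>dist0\<close>; enlarging it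
        to \<open>dist1\<close> puts all lower-order terms under one distance.\<close>
      also have "\<dots> \<le> Cc * dist1 v v' + (C0 / 4 * infnorm (vs2 v - vs2 v') + Ca * dist1 v v' * (C0 * R2))"
        using Ca(1) C_nonneg R2(1)
        by (intro add_left_mono mult_right_mono mult_left_mono) (auto simp: dist1_def infnorm_pos_le)
      also have "\<dots> = C0 / 4 * infnorm (vs2 v - vs2 v') + (Cc + Ca * (C0 * R2)) * dist1 v v'"
        by (simp add: algebra_simps)
      also have "\<dots> \<le> C0 / 4 * infnorm (vs2 v - vs2 v') + c * dist1 v v'"
        by (intro add_left_mono mult_right_mono c dist_nonneg)
      finally show ?thesis .
    qed
    then show "infnorm (snd (snd (step_at \<phi> \<theta> v)) - snd (snd (step_at \<phi> \<theta> v')))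
         \<le> C0 / 4 * infnorm (vs2 v - vs2 v') + c * dist1 v v'"
      by (simp add: infnorm_vec_le_iff)
  qed (rule R1(1) R2(1) c(1))+
qed

end

section \<open>Weighted contraction and the choice of weights\<close>

definition u_region ::
  "real \<Rightarrow> real \<Rightarrow> ('d::finite, 'n::finite) ustate set" where
  "u_region R1 R2 = {u. infnorm (fst u) \<le> 1 \<and> infnorm (fst (snd u)) \<le> R1 \<and> infnorm (snd (snd u)) \<le> R2}"

text \<open>A lower order gets a weight large enough to pay for its influence on the higher
  orders.\<close>

definition u_dist ::
  "real \<Rightarrow> real \<Rightarrow> ('d::finite, 'n::finite) ustate \<Rightarrow>
   ('d, 'n) ustate \<Rightarrow> real" where
  "u_dist b0 b1 u u' = b0 * infnorm (fst u - fst u') + b1 * infnorm (fst (snd u) - fst (snd u'))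
     + infnorm (snd (snd u) - snd (snd u'))"

lemma region_iff: "v \<in> region R1 R2 \<longleftrightarrow> snd v \<in> u_region R1 R2"
  by (simp add: region_def region1_def u_region_def)

text \<open>A triangular system with diagonal \<open>q\<close> contracts at any rate above
  \<open>q\<close> once the weights grow fast enough from the highest order to the lowest. They are
  fixed in that direction: \<open>b1\<close> absorbs the effect of the first derivatives on the
  second, \<open>b0\<close> that of the state on both, and \<open>A\<close> that of the input on
  everything.\<close>

lemma (in bounded_activation) contraction_constants:
  assumes Lp: "0 \<le> Lp" "Lp < 1"
  obtains R1 R2 b0 b1 c r A where "0 \<le> R1" "0 \<le> R2" "1 \<le> b0" "1 \<le> b1" "0 < r" "r < 1" "0 < A" "A * Lp + c \<le> r * A"
    "\<And>\<theta> (w :: (real^'d::finite) \<times> (real^'z::finite)) (u :: (real^'n::finite) \<times> _).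
       u \<in> u_region R1 R2 \<Longrightarrow> step_at \<phi> \<theta> (w, u) \<in> u_region R1 R2"
    "\<And>\<theta> (w :: (real^'d) \<times> (real^'z)) w' (u :: (real^'n) \<times> _) u'. u \<in> u_region R1 R2 \<Longrightarrow> u' \<in> u_region R1 R2 \<Longrightarrow>
       u_dist b0 b1 (step_at \<phi> \<theta> (w, u)) (step_at \<phi> \<theta> (w', u')) \<le> r * u_dist b0 b1 u u' + c * infnorm (w - w')"
proof -
  obtain R1 R2 c' where R: "0 \<le> R1" "0 \<le> R2" "0 \<le> c'"
    and inv: "\<And>\<theta> v :: ('d, 'z, 'n) vstate. v \<in> region R1 R2 \<Longrightarrow>
       infnorm (fst (step_at \<phi> \<theta> v)) \<le> 1 \<and> infnorm (fst (snd (step_at \<phi> \<theta> v))) \<le> R1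
       \<and> infnorm (snd (snd (step_at \<phi> \<theta> v))) \<le> R2"
    and e0: "\<And>\<theta> v v' :: ('d, 'z, 'n) vstate.
       infnorm (fst (step_at \<phi> \<theta> v) - fst (step_at \<phi> \<theta> v')) \<le> C0 / 4 * dist0 v v'"
    and e1: "\<And>\<theta> v v' :: ('d, 'z, 'n) vstate. v \<in> region R1 R2 \<Longrightarrow> v' \<in> region R1 R2 \<Longrightarrow>
       infnorm (fst (snd (step_at \<phi> \<theta> v)) - fst (snd (step_at \<phi> \<theta> v')))
         \<le> C0 / 4 * infnorm (vs1 v - vs1 v') + c' * dist0 v v'"
    and e2: "\<And>\<theta> v v' :: ('d, 'z, 'n) vstate. v \<in> region R1 R2 \<Longrightarrow> v' \<in> region R1 R2 \<Longrightarrow>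
       infnorm (snd (snd (step_at \<phi> \<theta> v)) - snd (snd (step_at \<phi> \<theta> v')))
         \<le> C0 / 4 * infnorm (vs2 v - vs2 v') + c' * dist1 v v'"
    by (rule step_estimates) (rule that)
  define q where "q = C0 / 4"
  have q: "0 \<le> q" "q < 1" using C_nonneg C0_small by (auto simp: q_def)
  \<comment> \<open>Halfway between 1 and the larger of the two intrinsic rates, so that
    \<open>r - q\<close> and \<open>r - Lp\<close> are both positive.\<close>
  define r where "r = (max q Lp + 1) / 2"
  have r: "q < r" "Lp < r" "r < 1" "0 < r" using q Lp by (auto simp: r_def)
  \<comment> \<open>Chosen so that \<open>(r - q) * b1\<close> exceeds the coefficient
    \<open>c'\<close> to be absorbed; the summand 1 secures \<open>1 \<le> b1\<close>. The
    definition of \<open>b0\<close> follows the same pattern, with the coefficient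
    \<open>b1 * c' + c'\<close>.\<close>
  define b1 where "b1 = c' / (r - q) + 1"
  define b0 where "b0 = (b1 * c' + c') / (r - q) + 1"
  define c where "c = b0 * q + b1 * c' + c'"
  \<comment> \<open>Solves \<open>(r - Lp) * A = c + 1\<close>, which implies the inequality that
    \<open>driven_chain\<close> imposes on \<open>A\<close>.\<close>
  define A where "A = (c + 1) / (r - Lp)"
  have b: "1 \<le> b1" "1 \<le> b0" using R(3) r by (auto simp: b1_def b0_def)
  have b1: "b1 * q + c' \<le> r * b1"
  proof -
    have "(r - q) * b1 = c' + (r - q)" using r by (simp add: b1_def field_simps)
    then show ?thesis using r by (simp add: algebra_simps)
  qed
  have b0: "b0 * q + b1 * c' + c' \<le> r * b0"
  proof -
    have "(r - q) * b0 = (b1 * c' + c') + (r - q)" using r by (simp add: b0_def field_simps)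
    then show ?thesis using r by (simp add: algebra_simps)
  qed
  have c: "0 \<le> c" using b q R(3) by (simp add: c_def)
  then have A: "0 < A" using r by (simp add: A_def)
  have "(r - Lp) * A = c + 1" using r by (simp add: A_def)
  then have A2: "A * Lp + c \<le> r * A" by (simp add: algebra_simps)
  show ?thesis
  proof (rule that[of R1 R2 b0 b1 r A c])
    fix \<theta> and w :: "(real^'d) \<times> (real^'z)" and u :: "('d, 'n) ustate"
    assume "u \<in> u_region R1 R2"
    then show "step_at \<phi> \<theta> (w, u) \<in> u_region R1 R2"
      using inv[of "(w, u)" \<theta>] by (simp add: region_iff u_region_def)
  next
    fix \<theta> and w w' :: "(real^'d) \<times> (real^'z)"
      and u u' :: "('d, 'n) ustate"
    assume u: "u \<in> u_region R1 R2" "u' \<in> u_region R1 R2"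
    define W where "W = infnorm (w - w')"
    define s where "s = infnorm (fst u - fst u')"
    define s1 where "s1 = infnorm (fst (snd u) - fst (snd u'))"
    define s2 where "s2 = infnorm (snd (snd u) - snd (snd u'))"
    have nn: "0 \<le> W" "0 \<le> s" "0 \<le> s1" "0 \<le> s2" by (simp_all add: W_def s_def s1_def s2_def infnorm_pos_le)
    let ?F = "step_at \<phi> \<theta> (w, u)" and ?F' = "step_at \<phi> \<theta> (w', u')"
    have rg: "(w, u) \<in> region R1 R2" "(w', u') \<in> region R1 R2" using u by (simp_all add: region_iff)
    have f0: "infnorm (fst ?F - fst ?F') \<le> q * (W + s)"
      using e0[of \<theta> "(w, u)" "(w', u')"] by (simp add: q_def W_def s_def dist0_def)
    have f1: "infnorm (fst (snd ?F) - fst (snd ?F')) \<le> q * s1 + c' * (W + s)"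
      using e1[OF rg, of \<theta>] by (simp add: q_def W_def s_def s1_def dist0_def)
    have f2: "infnorm (snd (snd ?F) - snd (snd ?F')) \<le> q * s2 + c' * (W + s + s1)"
      using e2[OF rg, of \<theta>] by (simp add: q_def W_def s_def s1_def s2_def dist0_def dist1_def)
    have "u_dist b0 b1 ?F ?F' \<le> b0 * (q * (W + s)) + b1 * (q * s1 + c' * (W + s)) + (q * s2 + c' * (W + s + s1))"
      unfolding u_dist_def using b by (intro add_mono mult_left_mono f0 f1 f2) auto
    \<comment> \<open>Sorted by input, state, first and second derivatives. For each of the three
      orders the coefficient is at most \<open>r\<close> times its weight by the choices
      above.\<close>
    also have "\<dots> = (b0 * q + b1 * c' + c') * W + (b0 * q + b1 * c' + c') * s + (b1 * q + c') * s1 + q * s2"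
      by (simp add: algebra_simps)
    also have "\<dots> \<le> c * W + (r * b0) * s + (r * b1) * s1 + r * s2"
      using r by (intro add_mono mult_right_mono b0 b1 nn) (simp_all add: c_def)
    also have "\<dots> = r * u_dist b0 b1 u u' + c * infnorm (w - w')"
      by (simp add: u_dist_def W_def s_def s1_def s2_def algebra_simps)
    finally show "u_dist b0 b1 ?F ?F' \<le> r * u_dist b0 b1 u u' + c * infnorm (w - w')" .
  qed (rule R b r A A2)+
qed

lemma continuous_on_sigmoid:
  assumes "continuous_on S g"
  shows "continuous_on S (\<lambda>x. sigmoid (g x))" "continuous_on S (\<lambda>x. deriv sigmoid (g x))"
    "continuous_on S (\<lambda>x. deriv (deriv sigmoid) (g x))"
proof -
  have "continuous_on UNIV sigmoid"
    using sigmoid_has_derivative by (meson DERIV_isCont continuous_at_imp_continuous_on)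
  then have s: "continuous_on S (\<lambda>x. sigmoid (g x))"
    by (rule continuous_on_compose2[OF _ assms]) simp
  show "continuous_on S (\<lambda>x. sigmoid (g x))" by (rule s)
  show "continuous_on S (\<lambda>x. deriv sigmoid (g x))"
    unfolding deriv_sigmoid by (intro continuous_intros s)
  show "continuous_on S (\<lambda>x. deriv (deriv sigmoid) (g x))"
    unfolding deriv2_sigmoid by (intro continuous_intros s)
qed

lemma net_step_continuous:
  fixes \<theta> :: "('d::finite, 'n::finite) param"
  shows "continuous_on UNIV (\<lambda>p :: ('d, 'z::finite, 'n) vstate. net_step \<phi> \<theta> (fst (fst p)) (snd p))"
proof -
  have pre: "continuous_on UNIV (\<lambda>p :: ('d, 'z, 'n) vstate. preact \<phi> \<theta> (fst (fst p)) (fst (snd p)) k)" for k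
    unfolding preact_def by (intro continuous_intros)
  have dpre: "continuous_on UNIV (\<lambda>p :: ('d, 'z, 'n) vstate. dpreact \<phi> \<theta> (fst (fst p)) (fst (snd p)) (fst (snd (snd p))) a k)" for a k
    unfolding dpreact_def by (cases a; cases "case a of EntA i j \<Rightarrow> i = k | EntW i j \<Rightarrow> i = k"; simp; intro continuous_intros; simp)
  have cond: "continuous_on UNIV (\<lambda>p :: ('d, 'z, 'n) vstate. if P then g p else 0)"
    if "continuous_on UNIV g" for P and g :: "_ \<Rightarrow> real" using that by (cases P) auto
  have ddpre: "continuous_on UNIV (\<lambda>p :: ('d, 'z, 'n) vstate. ddpreact \<phi> \<theta> (fst (fst p)) (fst (snd p)) (fst (snd (snd p))) (snd (snd (snd p))) a b k)" for a b k
    unfolding ddpreact_def by (cases a; cases b; simp only: entry.case; intro continuous_intros cond)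
  show ?thesis
    unfolding net_step_def case_prod_beta
    by (intro continuous_on_Pair continuous_on_vec_lambda continuous_intros continuous_on_sigmoid pre dpre ddpre)
qed

lemma step_at_continuous:
  fixes \<theta> :: "('d::finite, 'n::finite) param"
  shows "continuous_on UNIV (step_at \<phi> \<theta> :: ('d, 'z::finite, 'n) vstate \<Rightarrow> _)"
proof -
  have "continuous_on UNIV (\<lambda>v :: ('d, 'z, 'n) vstate. ((clamp1 (fst (fst v)), snd (fst v)), snd v))"
    unfolding clamp1_def by (intro continuous_intros continuous_on_vec_lambda)
  from continuous_on_compose2[OF net_step_continuous[of \<phi> \<theta>] this] show ?thesis
    by (simp add: step_at_def[abs_def])
qed

section \<open>Ergodicity of the joint process\<close>

text \<open>Only the bracketing changes; it links the abstract chain with noise to the tuple in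
  which the joint process is stated.\<close>

definition embed ::
  "(((real^'d::finite) \<times> (real^'z::finite)) \<times> ('d, 'n::finite) ustate) \<times> real
   \<Rightarrow> ('d, 'z, 'n) jstate" where
  "embed = (\<lambda>(((x, z), (s, s1, s2)), y). (x, z, s, s1, s2, y))"

definition unembed ::
  "('d::finite, 'z::finite, 'n::finite) jstate \<Rightarrow>
   (((real^'d) \<times> (real^'z)) \<times> ('d, 'n) ustate) \<times> real" where
  "unembed = (\<lambda>(x, z, s, s1, s2, y). (((x, z), (s, s1, s2)), y))"

lemma unembed_embed: "unembed (embed q) = q"
  by (simp add: embed_def unembed_def split: prod.split)

lemma embed_lipschitz: "dist (embed p) (embed q) \<le> 1 * dist p q"
  by (simp add: embed_def case_prod_beta dist_prod_def add.assoc)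

lemma unembed_measurable:
  "(unembed :: ('d::finite, 'z::finite, 'n::finite) jstate \<Rightarrow> _) \<in> borel_measurable borel"
proof -
  have "continuous_on UNIV (unembed :: ('d, 'z, 'n) jstate \<Rightarrow> _)"
    unfolding unembed_def case_prod_beta by (intro continuous_intros)
  then show "(unembed :: ('d, 'z, 'n) jstate \<Rightarrow> _) \<in> borel_measurable borel"
    by (rule borel_measurable_continuous_onI)
qed

lemma infnorm_diff_le: "infnorm (x - y) \<le> infnorm x + infnorm y"
  using infnorm_triangle[of x "- y"] by (simp add: infnorm_neg)

lemma closed_u_region: "closed (u_region R1 R2)"
  unfolding u_region_def by (intro closed_Collect_conj closed_Collect_le continuous_intros)

lemma infnorm_convex_le:
  assumes "infnorm x \<le> R" "infnorm y \<le> R" "0 \<le> a" "0 \<le> b" "a + b = 1"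
  shows "infnorm (a *\<^sub>R x + b *\<^sub>R y) \<le> R"
proof -
  have "infnorm (a *\<^sub>R x + b *\<^sub>R y) \<le> a * infnorm x + b * infnorm y"
    using infnorm_triangle[of "a *\<^sub>R x" "b *\<^sub>R y"] assms(3,4) by (simp add: infnorm_mul)
  also have "\<dots> \<le> a * R + b * R" by (intro add_mono mult_left_mono assms)
  also have "\<dots> = R" using assms(5) by (simp add: distrib_right[symmetric])
  finally show ?thesis .
qed

lemma convex_u_region: "convex (u_region R1 R2)"
  unfolding convex_def u_region_def by (simp add: infnorm_convex_le)

lemma u_dist_bounds:
  fixes e e' :: "('d::finite, 'n::finite) ustate"
  assumes b: "1 \<le> b0" "1 \<le> b1"
  shows "infnorm (fst e - fst e') + infnorm (fst (snd e) - fst (snd e')) + infnorm (snd (snd e) - snd (snd e')) \<le> u_dist b0 b1 e e'"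
    and "e \<in> u_region R1 R2 \<Longrightarrow> e' \<in> u_region R1 R2 \<Longrightarrow> u_dist b0 b1 e e' \<le> b0 * 2 + b1 * (R1 + R1) + (R2 + R2)"
proof -
  have "1 * infnorm (fst e - fst e') \<le> b0 * infnorm (fst e - fst e')"
    "1 * infnorm (fst (snd e) - fst (snd e')) \<le> b1 * infnorm (fst (snd e) - fst (snd e'))"
    by (rule mult_right_mono[OF b(1) infnorm_pos_le] mult_right_mono[OF b(2) infnorm_pos_le])+
  then show "infnorm (fst e - fst e') + infnorm (fst (snd e) - fst (snd e')) + infnorm (snd (snd e) - snd (snd e')) \<le> u_dist b0 b1 e e'"
    by (simp add: u_dist_def)
  assume "e \<in> u_region R1 R2" "e' \<in> u_region R1 R2"
  then have "infnorm (fst e - fst e') \<le> 2" "infnorm (fst (snd e) - fst (snd e')) \<le> R1 + R1"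
    "infnorm (snd (snd e) - snd (snd e')) \<le> R2 + R2"
    using infnorm_diff_le[of "fst e" "fst e'"] infnorm_diff_le[of "fst (snd e)" "fst (snd e')"]
      infnorm_diff_le[of "snd (snd e)" "snd (snd e')"] unfolding u_region_def mem_Collect_eq by linarith+
  then show "u_dist b0 b1 e e' \<le> b0 * 2 + b1 * (R1 + R1) + (R2 + R2)"
    unfolding u_dist_def using b by (intro add_mono mult_left_mono) auto
qed

text \<open>Weights of at least 1 make \<open>u_dist\<close> dominate the sum of the three maximum
  norms, hence the maximum norm of the whole difference; the square root of the dimension leads to
  the Euclidean norm.\<close>

lemma dist_le_u_dist:
  fixes e e' :: "('d::finite, 'n::finite) ustate"
  assumes b: "1 \<le> b0" "1 \<le> b1"
  shows "1 / sqrt DIM(('d, 'n) ustate) * dist e e' \<le> u_dist b0 b1 e e'"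
proof -
  have "norm (e - e') \<le> sqrt DIM(('d, 'n) ustate) * infnorm (e - e')"
    by (rule norm_le_infnorm)
  moreover have "infnorm (e - e') \<le> u_dist b0 b1 e e'"
  proof -
    have "infnorm (fst e - fst e', fst (snd e) - fst (snd e'), snd (snd e) - snd (snd e'))
        \<le> infnorm (fst e - fst e') + infnorm (fst (snd e) - fst (snd e')) + infnorm (snd (snd e) - snd (snd e'))"
      unfolding infnorm_Pair_le_iff by (simp add: infnorm_pos_le add_nonneg_nonneg)
    also have "(fst e - fst e', fst (snd e) - fst (snd e'), snd (snd e) - snd (snd e')) = e - e'"
      by (simp add: prod_eq_iff)
    finally show ?thesis by (rule order_trans[OF _ u_dist_bounds(1)[OF b]])
  qed
  moreover have pos: "0 < sqrt DIM(('d, 'n) ustate)"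
    by (simp add: DIM_positive del: DIM_prod DIM_cart)
  ultimately have "dist e e' \<le> sqrt DIM(('d, 'n) ustate) * u_dist b0 b1 e e'"
    unfolding dist_norm by (meson less_imp_le mult_left_mono order_trans)
  then show ?thesis using pos by (simp add: divide_le_eq mult.commute del: DIM_prod DIM_cart)
qed

text \<open>The constants are fixed once for all parameters. There is one instance of the abstract
  chain per \<theta>, and all instances share the rate \<open>r\<close>, the weight \<open>A\<close>
  and the diameter. The dummy \<open>n_type\<close> fixes the type that encodes the number of hidden
  units.\<close>

locale rnn_setting = prob_space M for M :: "'w measure" +
  fixes X :: "nat \<Rightarrow> 'w \<Rightarrow> real^'d::finite" and Z :: "nat \<Rightarrow> 'w \<Rightarrow> real^'z::finite" and \<eta> :: "nat \<Rightarrow> 'w \<Rightarrow> real"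
    and \<kappa> :: "(real^'d) \<times> (real^'z) \<Rightarrow> ((real^'d) \<times> (real^'z)) measure" and \<mu>\<eta> :: "real measure"
    and f :: "real^'d \<Rightarrow> real^'z \<Rightarrow> real \<Rightarrow> real" and \<phi> lam :: "real \<Rightarrow> real" and Lp Lf :: real
    and n_type :: "'n::finite itself" and R1 R2 b0 b1 c r A :: real
  assumes data: "data_assumption M X Z \<eta> \<kappa> \<mu>\<eta> f Lp Lf"
    and smooth: "smooth_bounded \<phi>" "smooth_bounded lam"
    and R: "0 \<le> R1" "0 \<le> R2" and b: "1 \<le> b0" "1 \<le> b1" and r: "0 < r" "r < 1"
    and A: "0 < A" "A * Lp + c \<le> r * A"
    and step_region: "\<And>\<theta> (w :: (real^'d) \<times> (real^'z)) (u :: (real^'n) \<times> _).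
       u \<in> u_region R1 R2 \<Longrightarrow> step_at \<phi> \<theta> (w, u) \<in> u_region R1 R2"
    and step_contr: "\<And>\<theta> (w :: (real^'d) \<times> (real^'z)) w' (u :: (real^'n) \<times> _) u'.
       u \<in> u_region R1 R2 \<Longrightarrow> u' \<in> u_region R1 R2 \<Longrightarrow>
       u_dist b0 b1 (step_at \<phi> \<theta> (w, u)) (step_at \<phi> \<theta> (w', u')) \<le> r * u_dist b0 b1 u u' + c * infnorm (w - w')"
begin

lemmas \<phi>_deriv = smooth_bounded_has_derivative(1,2)[OF smooth(1)]
lemmas lam_deriv = smooth_bounded_has_derivative(1,2)[OF smooth(2)]

abbreviation V :: "nat \<Rightarrow> 'w \<Rightarrow> (real^'d) \<times> (real^'z)" where "V \<equiv> \<lambda>t \<omega>. (X t \<omega>, Z t \<omega>)"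

abbreviation net_state ::
  "('d, 'n) param \<Rightarrow> nat \<Rightarrow> 'w \<Rightarrow> ('d, 'n) ustate" where
  "net_state \<theta> \<equiv> \<lambda>t \<omega>. (hidden \<phi> (\<lambda>i. X i \<omega>) t \<theta>, hidden1 \<phi> (\<lambda>i. X i \<omega>) t \<theta>, hidden2 \<phi> (\<lambda>i. X i \<omega>) t \<theta>)"

definition diam :: real where "diam = b0 * 2 + b1 * (R1 + R1) + (R2 + R2)"

lemma zero_in_region: "0 \<in> u_region R1 R2"
  using R by (simp add: u_region_def infnorm_0)

lemma noisy_chain:
  "noisy_driven_chain M V \<kappa> Lp (\<lambda>w. net_step \<phi> \<theta> (fst w)) (net_state \<theta>) 0 (u_region R1 R2)
     (u_dist b0 b1) (\<lambda>w e. step_at \<phi> \<theta> (w, e)) A r c diam (1 / sqrt DIM(('d, 'n) ustate)) \<eta> \<mu>\<eta>"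
proof unfold_locales
  show "markov_chain M V \<kappa>" "0 \<le> Lp" "\<And>w w'. wass2 (\<kappa> w) (\<kappa> w') \<le> ennreal (Lp * infnorm (w - w'))"
    "\<And>t. AE \<omega> in M. infnorm (V t \<omega>) \<le> 1"
    "\<And>t. distr M borel (\<eta> t) = \<mu>\<eta>"
    "indep_set (sets (vimage_algebra (space M) (\<lambda>\<omega> t. V t \<omega>) (\<Pi>\<^sub>M t\<in>UNIV. borel)))
       (sets (vimage_algebra (space M) (\<lambda>\<omega> t. \<eta> t \<omega>) (\<Pi>\<^sub>M t\<in>UNIV. borel)))"
    using data unfolding data_assumption_def by blast+
  have "indep_vars (\<lambda>_. borel) \<eta> UNIV" using data by (simp add: data_assumption_def)
  then show "\<And>t. \<eta> t \<in> borel_measurable M" by (simp add: indep_vars_def)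
  show "continuous_on UNIV (\<lambda>p :: ('d, 'z, 'n) vstate. net_step \<phi> \<theta> (fst (fst p)) (snd p))"
    by (rule net_step_continuous)
  show "net_state \<theta> 0 \<omega> = 0" for \<omega>
    by (simp add: hidden1_0[OF \<phi>_deriv] hidden2_0[OF \<phi>_deriv] zero_prod_def)
  show "net_state \<theta> (Suc t) \<omega> = net_step \<phi> \<theta> (fst (V t \<omega>)) (net_state \<theta> t \<omega>)" for t \<omega>
    using hidden_net_step[OF \<phi>_deriv, of "\<lambda>i. X i \<omega>" t \<theta>] by simp
  show "0 \<in> u_region R1 R2" by (rule zero_in_region)
  show "closed (u_region R1 R2)" by (rule closed_u_region)
  show "convex (u_region R1 R2)" by (rule convex_u_region)
  show "step_at \<phi> \<theta> (w, e) = net_step \<phi> \<theta> (fst w) e" if "infnorm w \<le> 1" for w :: "(real^'d) \<times> (real^'z)" and e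
    using clamp1_id[of "fst w"] infnorm_fst_le[of w] that by (simp add: step_at_def)
  show "step_at \<phi> \<theta> (w, e) \<in> u_region R1 R2" if "e \<in> u_region R1 R2" for w :: "(real^'d) \<times> (real^'z)" and e
    using that by (rule step_region)
  show "(\<lambda>p :: ('d, 'z, 'n) vstate. step_at \<phi> \<theta> (fst p, snd p)) \<in> borel_measurable borel"
    using borel_measurable_continuous_onI[OF step_at_continuous[of \<phi> \<theta>]] by simp
  show "u_dist b0 b1 e e' \<le> diam" if "e \<in> u_region R1 R2" "e' \<in> u_region R1 R2" for e e' :: "('d, 'n) ustate"
    unfolding diam_def by (rule u_dist_bounds(2)[OF b that])
  show "1 / sqrt DIM(('d, 'n) ustate) * dist e e' \<le> u_dist b0 b1 e e'" for e e' :: "('d, 'n) ustate"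
    by (rule dist_le_u_dist[OF b])
  show "0 < (1 / sqrt DIM(('d, 'n) ustate))"
    by (simp add: DIM_positive del: DIM_prod DIM_cart)
  show "u_dist b0 b1 e e = 0" for e :: "('d, 'n) ustate" by (simp add: u_dist_def infnorm_0)
  show "u_dist b0 b1 (step_at \<phi> \<theta> (w, e)) (step_at \<phi> \<theta> (w', e')) \<le> r * u_dist b0 b1 e e' + c * infnorm (w - w')"
    if "e \<in> u_region R1 R2" "e' \<in> u_region R1 R2" for w w' :: "(real^'d) \<times> (real^'z)" and e e'
    using that by (rule step_contr)
qed (rule r A)+

lemma joint_embed: "joint \<phi> X Z \<eta> \<theta> t \<omega> = embed ((V t \<omega>, net_state \<theta> t \<omega>), \<eta> t \<omega>)"
  by (simp add: joint_eq_path_state path_state_def embed_def)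

lemma joint_kernel_embed:
  fixes \<theta> :: "('d, 'n) param" and h :: "('d, 'z, 'n) jstate"
  shows
  "joint_kernel \<kappa> \<mu>\<eta> \<phi> \<theta> h = noisy_driven_chain.noisy_kernel \<kappa> (\<lambda>w. net_step \<phi> \<theta> (fst w)) \<mu>\<eta> embed unembed h"
proof -
  obtain x z s s1 s2 y where h: "h = (x, z, s, s1, s2, y)" by (cases h) auto
  interpret C: noisy_driven_chain M V \<kappa> Lp "\<lambda>w. net_step \<phi> \<theta> (fst w)" "net_state \<theta>" 0 "u_region R1 R2"
     "u_dist b0 b1" "\<lambda>w e. step_at \<phi> \<theta> (w, e)" A r c diam "1 / sqrt DIM(('d, 'n) ustate)" \<eta> \<mu>\<eta>
    by (rule noisy_chain)
  show ?thesis
    unfolding C.noisy_kernel_def h joint_kernel_def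
    by (simp add: unembed_def net_step_def embed_def case_prod_unfold)
qed

definition limit_measure :: "('d, 'n) param \<Rightarrow> ('d, 'z, 'n) jstate measure" where
  "limit_measure \<theta> = distr (driven_chain.limit_law M V (net_state \<theta>) \<Otimes>\<^sub>M \<mu>\<eta>) borel embed"

lemma limit_measure_stationary: "is_stationary_law M X Z \<eta> \<kappa> \<mu>\<eta> \<phi> \<theta> (limit_measure \<theta>)"
proof -
  interpret C: noisy_driven_chain M V \<kappa> Lp "\<lambda>w. net_step \<phi> \<theta> (fst w)" "net_state \<theta>" 0 "u_region R1 R2"
     "u_dist b0 b1" "\<lambda>w e. step_at \<phi> \<theta> (w, e)" A r c diam "1 / sqrt DIM(('d, 'n) ustate)" \<eta> \<mu>\<eta>
    by (rule noisy_chain)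
  note emb = embed_lipschitz unembed_measurable unembed_embed
  have eq: "limit_measure \<theta> = C.noisy_limit embed"
    unfolding limit_measure_def C.noisy_limit_def[OF emb] ..
  show ?thesis
    unfolding is_stationary_law_def eq joint_embed[abs_def] joint_kernel_embed
    using C.noisy_limit_prob[OF emb] C.noisy_limit_sets[OF emb] C.noisy_limit_stationary[OF emb]
      C.noisy_limit_weak[OF emb]
    by blast
qed

text \<open>The description by \<open>THE\<close> is justified by the convergence clause of
  \<open>is_stationary_law\<close>: weak limits among Borel probability measures are unique.\<close>

lemma stationary_law_eq: "stationary_law M X Z \<eta> \<kappa> \<mu>\<eta> \<phi> \<theta> = limit_measure \<theta>"
  unfolding stationary_law_def
proof (rule the_equality)
  show "is_stationary_law M X Z \<eta> \<kappa> \<mu>\<eta> \<phi> \<theta> (limit_measure \<theta>)" by (rule limit_measure_stationary)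
  fix \<mu> assume "is_stationary_law M X Z \<eta> \<kappa> \<mu>\<eta> \<phi> \<theta> \<mu>"
  with limit_measure_stationary[of \<theta>] show "\<mu> = limit_measure \<theta>"
    unfolding is_stationary_law_def using weakly_converges_unique by blast
qed

end

lemma ubl_region: "ubl (region1 R1) \<delta> G \<Longrightarrow> ubl (region R1 R2) \<delta> G"
  by (erule ubl_mono) (auto simp: region_def)

section \<open>Ergodicity with constants uniform in the parameter\<close>

context rnn_setting
begin

text \<open>Only the data can leave their box, on a null set for each of countably many times. Once
  they stay inside, the recursion remains in the region deterministically for every \<theta>. Thus
  one null set serves uncountably many parameters.\<close>

lemma state_in_region: "AE \<omega> in M. \<forall>t (\<theta> :: ('d, 'n) param). net_state \<theta> t \<omega> \<in> u_region R1 R2"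
proof -
  have "AE \<omega> in M. \<forall>t. infnorm (V t \<omega>) \<le> 1"
    using data by (simp add: AE_all_countable data_assumption_def)
  then show ?thesis
  proof eventually_elim
    case (elim \<omega>)
    show ?case
    proof (intro allI)
      fix t and \<theta> :: "('d, 'n) param"
      show "net_state \<theta> t \<omega> \<in> u_region R1 R2"
      proof (induction t)
        case 0
        have "net_state \<theta> 0 \<omega> = 0"
          by (simp add: hidden1_0[OF \<phi>_deriv] hidden2_0[OF \<phi>_deriv] zero_prod_def)
        then show ?case using zero_in_region by simp
      next
        case (Suc t)
        have "infnorm (X t \<omega>) \<le> 1" using elim[rule_format, of t] by (simp add: infnorm_Pair_le_iff)
        then have "net_state \<theta> (Suc t) \<omega> = step_at \<phi> \<theta> (V t \<omega>, net_state \<theta> t \<omega>)"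
          using hidden_net_step[OF \<phi>_deriv, of "\<lambda>i. X i \<omega>" t \<theta>] by (simp add: step_at_def clamp1_id)
        then show ?case using step_region[OF Suc] by simp
      qed
    qed
  qed
qed

text \<open>Leads from the unweighted distance of the \<open>ubl\<close> bounds to the weighted one
  of the contraction: \<open>1 / A\<close> pays for the input, and 1 for the network part because
  \<open>b0\<close> and \<open>b1\<close> are at least 1.\<close>

lemma dist2_le:
  fixes w w' :: "(real^'d) \<times> (real^'z)" and e e' :: "('d, 'n) ustate"
  shows "dist2 (w, e) (w', e') \<le> (1 / A + 1) * (A * infnorm (w - w') + u_dist b0 b1 e e')"
proof -
  have "dist2 (w, e) (w', e') \<le> infnorm (w - w') + u_dist b0 b1 e e'"
    using u_dist_bounds(1)[OF b, of e e'] by (simp add: dist2_def dist1_def dist0_def)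
  also have "\<dots> \<le> (1 / A + 1) * (A * infnorm (w - w') + u_dist b0 b1 e e')"
  proof -
    have "0 \<le> u_dist b0 b1 e e'" using b by (simp add: u_dist_def infnorm_pos_le)
    then have "0 \<le> u_dist b0 b1 e e' / A" "0 \<le> A * infnorm (w - w')" using A by (simp_all add: infnorm_pos_le)
    moreover have "(1 / A + 1) * (A * infnorm (w - w') + u_dist b0 b1 e e')
      = infnorm (w - w') + u_dist b0 b1 e e' + (u_dist b0 b1 e e' / A + A * infnorm (w - w'))"
      using A by (simp add: distrib_left distrib_right)
    ultimately show ?thesis by linarith
  qed
  finally show ?thesis .
qed

text \<open>The parameter of \<open>ubl\<close> is the pair of \<theta> and the noise value. The
  resulting constants are uniform in both, so \<open>noisy_mixing\<close> yields the same
  \<open>K\<close> for every \<theta>.\<close>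

lemma uniform_ergodicity:
  fixes h :: "('d, 'n) param \<Rightarrow> ('d, 'z, 'n) jstate \<Rightarrow> real"
  assumes cont: "\<And>\<theta>. continuous_on UNIV (h \<theta>)"
    and ubl: "ubl (region R1 R2) dist2 (\<lambda>p v. h (fst p) (embed (v, snd p)))"
  obtains B K where "0 \<le> K" "\<And>\<theta> t. integrable M (\<lambda>\<omega>. h \<theta> (joint \<phi> X Z \<eta> \<theta> t \<omega>))"
    "\<And>\<theta>. integrable (limit_measure \<theta>) (h \<theta>)"
    "\<And>\<theta> t. \<bar>(\<integral>\<omega>. h \<theta> (joint \<phi> X Z \<eta> \<theta> t \<omega>) \<partial>M) - (\<integral>x. h \<theta> x \<partial>limit_measure \<theta>)\<bar> \<le> K * r ^ t"
    "AE \<omega> in M. \<forall>t \<theta>. \<bar>h \<theta> (joint \<phi> X Z \<eta> \<theta> t \<omega>)\<bar> \<le> B"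
proof -
  obtain B where B: "0 \<le> B" "\<And>p v v'. v \<in> region R1 R2 \<Longrightarrow> v' \<in> region R1 R2 \<Longrightarrow>
      \<bar>h (fst p) (embed (v, snd p))\<bar> \<le> B \<and> \<bar>h (fst p) (embed (v, snd p)) - h (fst p) (embed (v', snd p))\<bar> \<le> B * dist2 v v'"
    using ubl unfolding ubl_def by blast
  define l where "l = B * (1 / A + 1)"
  have l0: "0 \<le> l" using B(1) A by (simp add: l_def)
  have bd: "\<bar>h \<theta> (embed ((w, e), y))\<bar> \<le> B" if "e \<in> u_region R1 R2" for \<theta> w e y
    using B(2)[of "(w, e)" "(w, e)" "(\<theta>, y)"] that by (simp add: region_iff)
  have lip: "\<bar>h \<theta> (embed ((w, e), y)) - h \<theta> (embed ((w', e'), y))\<bar> \<le> l * (A * infnorm (w - w') + u_dist b0 b1 e e')"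
    if "e \<in> u_region R1 R2" "e' \<in> u_region R1 R2" for \<theta> w w' e e' y
  proof -
    have "\<bar>h \<theta> (embed ((w, e), y)) - h \<theta> (embed ((w', e'), y))\<bar> \<le> B * dist2 (w, e) (w', e')"
      using B(2)[of "(w, e)" "(w', e')" "(\<theta>, y)"] that by (simp add: region_iff)
    also have "\<dots> \<le> B * ((1 / A + 1) * (A * infnorm (w - w') + u_dist b0 b1 e e'))"
      by (intro mult_left_mono dist2_le B(1))
    finally show ?thesis by (simp add: l_def mult.assoc)
  qed
  have ec: "continuous_on UNIV (embed :: (((real^'d) \<times> (real^'z)) \<times> ('d, 'n) ustate) \<times> real \<Rightarrow> _)"
    unfolding embed_def case_prod_beta by (intro continuous_intros)
  have main: "integrable M (\<lambda>\<omega>. h \<theta> (joint \<phi> X Z \<eta> \<theta> t \<omega>)) \<and> integrable (limit_measure \<theta>) (h \<theta>) \<and>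
    \<bar>(\<integral>\<omega>. h \<theta> (joint \<phi> X Z \<eta> \<theta> t \<omega>) \<partial>M) - (\<integral>x. h \<theta> x \<partial>limit_measure \<theta>)\<bar> \<le> 2 * l * (A + diam) * r ^ t" for \<theta> t
  proof -
    interpret C: noisy_driven_chain M V \<kappa> Lp "\<lambda>w. net_step \<phi> \<theta> (fst w)" "net_state \<theta>" 0 "u_region R1 R2"
       "u_dist b0 b1" "\<lambda>w e. step_at \<phi> \<theta> (w, e)" A r c diam "1 / sqrt DIM(('d, 'n) ustate)" \<eta> \<mu>\<eta>
      by (rule noisy_chain)
    have gc: "continuous_on UNIV (\<lambda>q. h \<theta> (embed q))"
      using continuous_on_compose2[OF cont ec] by simp
    note mix = C.noisy_mixing[OF gc bd lip l0]
    have em: "embed \<in> borel_measurable (C.limit_law \<Otimes>\<^sub>M \<mu>\<eta>)"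
      by (rule C.J_meas_limit[OF embed_lipschitz unembed_measurable unembed_embed])
    have hm: "h \<theta> \<in> borel_measurable borel" by (rule borel_measurable_continuous_onI[OF cont])
    have "integrable (limit_measure \<theta>) (h \<theta>)"
      unfolding limit_measure_def by (subst integrable_distr_eq[OF em hm]) (rule mix(2))
    moreover have "(\<integral>x. h \<theta> x \<partial>limit_measure \<theta>) = (\<integral>q. h \<theta> (embed q) \<partial>(C.limit_law \<Otimes>\<^sub>M \<mu>\<eta>))"
      unfolding limit_measure_def by (rule integral_distr[OF em hm])
    ultimately show ?thesis using mix(1,3) by (simp add: joint_embed)
  qed
  have "0 \<le> diam" using b R by (simp add: diam_def)
  then have "0 \<le> 2 * l * (A + diam)" using l0 A by simp
  moreover have "AE \<omega> in M. \<forall>t \<theta>. \<bar>h \<theta> (joint \<phi> X Z \<eta> \<theta> t \<omega>)\<bar> \<le> B"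
    using state_in_region
  proof eventually_elim
    case (elim \<omega>)
    then show ?case using bd by (simp add: joint_embed)
  qed
  ultimately show ?thesis using main by (intro that[of "2 * l * (A + diam)" B]) auto
qed

lemma uniform_ergodicity_family:
  fixes h :: "'i::finite \<Rightarrow> ('d, 'n) param \<Rightarrow> ('d, 'z, 'n) jstate \<Rightarrow> real"
  assumes cont: "\<And>i \<theta>. continuous_on UNIV (h i \<theta>)"
    and ubl: "\<And>i. ubl (region R1 R2) dist2 (\<lambda>p v. h i (fst p) (embed (v, snd p)))"
  obtains B K where "\<And>i \<theta> t. integrable M (\<lambda>\<omega>. h i \<theta> (joint \<phi> X Z \<eta> \<theta> t \<omega>))"
    "\<And>i \<theta>. integrable (limit_measure \<theta>) (h i \<theta>)"
    "\<And>i \<theta> t. \<bar>(\<integral>\<omega>. h i \<theta> (joint \<phi> X Z \<eta> \<theta> t \<omega>) \<partial>M) - (\<integral>x. h i \<theta> x \<partial>limit_measure \<theta>)\<bar> \<le> K * r ^ t"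
    "AE \<omega> in M. \<forall>t \<theta> i. \<bar>h i \<theta> (joint \<phi> X Z \<eta> \<theta> t \<omega>)\<bar> \<le> B"
proof -
  define Q where "Q i B K \<longleftrightarrow> 0 \<le> K \<and> (\<forall>\<theta> t. integrable M (\<lambda>\<omega>. h i \<theta> (joint \<phi> X Z \<eta> \<theta> t \<omega>))) \<and>
    (\<forall>\<theta>. integrable (limit_measure \<theta>) (h i \<theta>)) \<and>
    (\<forall>\<theta> t. \<bar>(\<integral>\<omega>. h i \<theta> (joint \<phi> X Z \<eta> \<theta> t \<omega>) \<partial>M) - (\<integral>x. h i \<theta> x \<partial>limit_measure \<theta>)\<bar> \<le> K * r ^ t) \<and>
    (AE \<omega> in M. \<forall>t \<theta>. \<bar>h i \<theta> (joint \<phi> X Z \<eta> \<theta> t \<omega>)\<bar> \<le> B)" for i B K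
  have "\<exists>B K. Q i B K" for i
    unfolding Q_def by (rule uniform_ergodicity[OF cont ubl, of i]) blast
  then obtain B K where Q: "\<And>i. Q i (B i) (K i)" by metis
  have K: "0 \<le> K i"
    and 1: "integrable M (\<lambda>\<omega>. h i \<theta> (joint \<phi> X Z \<eta> \<theta> t \<omega>))"
    and 2: "integrable (limit_measure \<theta>) (h i \<theta>)"
    and 3: "\<bar>(\<integral>\<omega>. h i \<theta> (joint \<phi> X Z \<eta> \<theta> t \<omega>) \<partial>M) - (\<integral>x. h i \<theta> x \<partial>limit_measure \<theta>)\<bar> \<le> K i * r ^ t"
    and 4: "AE \<omega> in M. \<forall>t \<theta>. \<bar>h i \<theta> (joint \<phi> X Z \<eta> \<theta> t \<omega>)\<bar> \<le> B i" for i \<theta> t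
    using Q[of i] unfolding Q_def by blast+
  have Kle: "K i * r ^ t \<le> (\<Sum>i\<in>UNIV. K i) * r ^ t" for i t
    using r by (intro mult_right_mono member_le_sum) (auto simp: K)
  have Ble: "B i \<le> (\<Sum>i\<in>UNIV. \<bar>B i\<bar>)" for i
    by (rule order_trans[OF abs_ge_self]) (rule member_le_sum; simp)
  have "AE \<omega> in M. \<forall>i\<in>UNIV. \<forall>t \<theta>. \<bar>h i \<theta> (joint \<phi> X Z \<eta> \<theta> t \<omega>)\<bar> \<le> B i"
    by (rule eventually_ball_finite) (auto intro: 4)
  then have "AE \<omega> in M. \<forall>t \<theta> i. \<bar>h i \<theta> (joint \<phi> X Z \<eta> \<theta> t \<omega>)\<bar> \<le> (\<Sum>i\<in>UNIV. \<bar>B i\<bar>)"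
    by eventually_elim (blast intro: order_trans[OF _ Ble])
  then show ?thesis
    by (rule that[OF 1 2 order_trans[OF 3 Kle]])
qed

lemma lam_bound: obtains C where "\<And>y. \<bar>lam y\<bar> \<le> C" "\<And>y. \<bar>deriv lam y\<bar> \<le> C" "\<And>y. \<bar>deriv (deriv lam) y\<bar> \<le> C"
  using smooth_bounded_bounds[OF smooth(2)] by metis

lemma f_lipschitz: "\<bar>f x z y - f x' z' y'\<bar> \<le> Lf * infnorm ((x, z, y) - (x', z', y'))"
  and f_bounded: "\<bar>f x z y\<bar> \<le> Lf"
  using data unfolding data_assumption_def by blast+

lemma Lf_nonneg: "0 \<le> Lf"
  using f_bounded abs_ge_zero order_trans by blast

lemmas ubl2_vs = ubl_dist1_dist2[OF ubl_dist0_dist1[OF ubl_region[OF ubl_vs]]]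
lemmas ubl2_vs1 = ubl_dist1_dist2[OF ubl_region[OF ubl_vs1]]

text \<open>The target \<open>f\<close> receives the input unclamped, but it is globally bounded and
  Lipschitz by assumption. Both states are compared at the same noise value, which belongs to the
  parameter \<open>p\<close>.\<close>

lemma ubl_err:
  "ubl (region R1 R2 :: ('d, 'z, 'n) vstate set) dist2 (\<lambda>p v. err_fun f lam (fst p) (embed (v, snd p)))"
proof -
  obtain C where C: "\<And>y. \<bar>lam y\<bar> \<le> C" "\<And>y. \<bar>deriv lam y\<bar> \<le> C" "\<And>y. \<bar>deriv (deriv lam) y\<bar> \<le> C"
    by (rule lam_bound) (rule that)
  have F: "ubl (region R1 R2 :: ('d, 'z, 'n) vstate set) dist2 (\<lambda>p v. f (fst (fst v)) (snd (fst v)) (snd p))"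
    unfolding ubl_def
  proof (intro exI[of _ Lf] conjI allI ballI)
    fix p :: "'q \<times> real" and v v' :: "('d, 'z, 'n) vstate"
    show "\<bar>f (fst (fst v)) (snd (fst v)) (snd p)\<bar> \<le> Lf" by (rule f_bounded)
    have "infnorm ((fst (fst v), snd (fst v), snd p) - (fst (fst v'), snd (fst v'), snd p)) \<le> infnorm (fst v - fst v')"
      using infnorm_fst_le[of "fst v - fst v'"] infnorm_snd_le[of "fst v - fst v'"]
      by (simp add: infnorm_Pair_le_iff infnorm_pos_le)
    also have "\<dots> \<le> dist2 v v'" by (simp add: dist2_def dist1_def dist0_def infnorm_pos_le)
    finally show "\<bar>f (fst (fst v)) (snd (fst v)) (snd p) - f (fst (fst v')) (snd (fst v')) (snd p)\<bar> \<le> Lf * dist2 v v'"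
      by (intro order_trans[OF f_lipschitz] mult_left_mono Lf_nonneg)
  qed (rule Lf_nonneg)
  show ?thesis
    unfolding err_fun_def embed_def case_prod_beta fst_conv snd_conv
    by (intro ubl_dist2 F ubl2_vs ubl_bounded[OF C(1) dist_nonneg(3)])
qed

lemma ubl_D:
  "ubl (region R1 R2 :: ('d, 'z, 'n) vstate set) dist2 (\<lambda>p v. D_fun lam (fst p) (embed (v, snd p)) $ i)"
proof -
  obtain C where C: "\<And>y. \<bar>lam y\<bar> \<le> C" "\<And>y. \<bar>deriv lam y\<bar> \<le> C" "\<And>y. \<bar>deriv (deriv lam) y\<bar> \<le> C"
    by (rule lam_bound) (rule that)
  show ?thesis
    unfolding D_fun_def embed_def case_prod_beta fst_conv snd_conv vec_lambda_beta
    by (cases i; simp only: coord.case; intro ubl_dist2 ubl2_vs ubl2_vs1 ubl_bounded[OF C(1) dist_nonneg(3)]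
        ubl_bounded[OF C(2) dist_nonneg(3)])
qed

lemma ubl_K:
  "ubl (region R1 R2 :: ('d, 'z, 'n) vstate set) dist2 (\<lambda>p v. K_fun lam (fst p) (embed (v, snd p)) $ i $ j)"
proof -
  obtain C where C: "\<And>y. \<bar>lam y\<bar> \<le> C" "\<And>y. \<bar>deriv lam y\<bar> \<le> C" "\<And>y. \<bar>deriv (deriv lam) y\<bar> \<le> C"
    by (rule lam_bound) (rule that)
  show ?thesis
    unfolding K_fun_def embed_def case_prod_beta fst_conv snd_conv vec_lambda_beta
    by (cases i; cases j; simp only: coord.case; intro ubl_if ubl_dist2 ubl2_vs ubl2_vs1 ubl_vs2 ubl_bounded[OF C(1) dist_nonneg(3)]
        ubl_bounded[OF C(2) dist_nonneg(3)] ubl_bounded[OF C(3) dist_nonneg(3)])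
qed

lemma continuous_err: "continuous_on UNIV (err_fun f lam \<theta> :: ('d, 'z, 'n) jstate \<Rightarrow> real)"
proof -
  have "\<bar>f (fst q) (fst (snd q)) (snd (snd q)) - f (fst q') (fst (snd q')) (snd (snd q'))\<bar> \<le> Lf * dist q q'"
    for q q' :: "(real^'d) \<times> (real^'z) \<times> real"
  proof -
    have "infnorm ((fst q, fst (snd q), snd (snd q)) - (fst q', fst (snd q'), snd (snd q'))) \<le> dist q q'"
      using infnorm_le_norm[of "q - q'"] by (simp add: dist_norm)
    then show ?thesis by (intro order_trans[OF f_lipschitz] mult_left_mono Lf_nonneg)
  qed
  then have F: "continuous_on UNIV (\<lambda>q. f (fst q) (fst (snd q)) (snd (snd q)))"
    by (rule lipschitz_continuous_on_UNIV)
  have "continuous_on UNIV (\<lambda>h :: ('d, 'z, 'n) jstate. (fst h, fst (snd h), snd (snd (snd (snd (snd h))))))"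
    by (intro continuous_intros)
  from continuous_on_compose2[OF F this]
  have "continuous_on UNIV (\<lambda>h :: ('d, 'z, 'n) jstate. f (fst h) (fst (snd h)) (snd (snd (snd (snd (snd h))))))"
    by simp
  then show ?thesis unfolding err_fun_def case_prod_beta by (intro continuous_intros)
qed

lemma continuous_D: "continuous_on UNIV (\<lambda>h :: ('d, 'z, 'n) jstate. D_fun lam \<theta> h $ i)"
  unfolding D_fun_def case_prod_beta vec_lambda_beta
  by (cases i; simp only: coord.case; intro continuous_intros)

lemma continuous_K: "continuous_on UNIV (\<lambda>h :: ('d, 'z, 'n) jstate. K_fun lam \<theta> h $ i $ j)"
proof -
  have cond: "continuous_on UNIV (\<lambda>h :: ('d, 'z, 'n) jstate. if P then g h else 0)"
    if "continuous_on UNIV g" for P and g :: "_ \<Rightarrow> real" using that by (cases P) auto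
  show ?thesis
    unfolding K_fun_def case_prod_beta vec_lambda_beta fst_conv snd_conv
    by (cases i; cases j; simp only: coord.case; intro continuous_intros cond)
qed

lemma loss_ergodicity:
  obtains K where
    "\<And>(\<theta> :: ('d, 'n) param) t. integrable M (\<lambda>\<omega>. (err_fun f lam \<theta> (joint \<phi> X Z \<eta> \<theta> t \<omega>))\<^sup>2 / 2)"
    "\<And>(\<theta> :: ('d, 'n) param) t. \<bar>(\<integral>\<omega>. (err_fun f lam \<theta> (joint \<phi> X Z \<eta> \<theta> t \<omega>))\<^sup>2 / 2 \<partial>M)
        - (\<integral>x. (err_fun f lam \<theta> x)\<^sup>2 / 2 \<partial>limit_measure \<theta>)\<bar> \<le> K * r ^ t"
proof (rule uniform_ergodicity[where h="\<lambda>\<theta> x. (err_fun f lam \<theta> x)\<^sup>2 / 2"])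
  show "continuous_on UNIV (\<lambda>x :: ('d, 'z, 'n) jstate. (err_fun f lam \<theta> x)\<^sup>2 / 2)" for \<theta> :: "('d, 'n) param"
    by (intro continuous_intros continuous_err) simp
  show "ubl (region R1 R2 :: ('d, 'z, 'n) vstate set) dist2 (\<lambda>p v. (err_fun f lam (fst p) (embed (v, snd p)))\<^sup>2 / 2)"
    unfolding power2_eq_square divide_inverse by (intro ubl_dist2 ubl_err)
qed (rule that, assumption+)

lemma gradient_ergodicity:
  obtains B K where
    "\<And>i (\<theta> :: ('d, 'n) param) t. integrable M (\<lambda>\<omega>. g_fun f lam \<theta> (joint \<phi> X Z \<eta> \<theta> t \<omega>) $ i)"
    "\<And>i (\<theta> :: ('d, 'n) param). integrable (limit_measure \<theta>) (\<lambda>x. g_fun f lam \<theta> x $ i)"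
    "\<And>i (\<theta> :: ('d, 'n) param) t. \<bar>(\<integral>\<omega>. g_fun f lam \<theta> (joint \<phi> X Z \<eta> \<theta> t \<omega>) $ i \<partial>M)
        - (\<integral>x. g_fun f lam \<theta> x $ i \<partial>limit_measure \<theta>)\<bar> \<le> K * r ^ t"
    "AE \<omega> in M. \<forall>t (\<theta> :: ('d, 'n) param) i. \<bar>g_fun f lam \<theta> (joint \<phi> X Z \<eta> \<theta> t \<omega>) $ i\<bar> \<le> B"
proof (rule uniform_ergodicity_family[where h="\<lambda>i \<theta> x. g_fun f lam \<theta> x $ i"])
  show "continuous_on UNIV (\<lambda>x :: ('d, 'z, 'n) jstate. g_fun f lam \<theta> x $ i)" for i and \<theta> :: "('d, 'n) param"
    unfolding g_fun_def vector_scaleR_component real_scaleR_def by (intro continuous_intros continuous_err continuous_D)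
  show "ubl (region R1 R2 :: ('d, 'z, 'n) vstate set) dist2 (\<lambda>p v. g_fun f lam (fst p) (embed (v, snd p)) $ i)" for i
    unfolding g_fun_def vector_scaleR_component real_scaleR_def
    by (intro ubl_dist2 ubl_minus[OF dist_nonneg(3)] ubl_err ubl_D)
qed (rule that, assumption+)

text \<open>One column \<open>j\<close> at a time: the family over \<open>i\<close> consists of the
  partial derivatives of a single gradient component.\<close>

lemma hessian_ergodicity:
  obtains B K where
    "\<And>i (\<theta> :: ('d, 'n) param) t. integrable M (\<lambda>\<omega>. he_fun f lam \<theta> (joint \<phi> X Z \<eta> \<theta> t \<omega>) $ i $ j)"
    "\<And>i (\<theta> :: ('d, 'n) param). integrable (limit_measure \<theta>) (\<lambda>x. he_fun f lam \<theta> x $ i $ j)"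
    "\<And>i (\<theta> :: ('d, 'n) param) t. \<bar>(\<integral>\<omega>. he_fun f lam \<theta> (joint \<phi> X Z \<eta> \<theta> t \<omega>) $ i $ j \<partial>M)
        - (\<integral>x. he_fun f lam \<theta> x $ i $ j \<partial>limit_measure \<theta>)\<bar> \<le> K * r ^ t"
    "AE \<omega> in M. \<forall>t (\<theta> :: ('d, 'n) param) i. \<bar>he_fun f lam \<theta> (joint \<phi> X Z \<eta> \<theta> t \<omega>) $ i $ j\<bar> \<le> B"
proof (rule uniform_ergodicity_family[where h="\<lambda>i \<theta> x. he_fun f lam \<theta> x $ i $ j"])
  have he: "he_fun f lam \<theta> x $ i $ j = D_fun lam \<theta> x $ i * D_fun lam \<theta> x $ j - err_fun f lam \<theta> x * K_fun lam \<theta> x $ i $ j"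
    for i and \<theta> :: "('d, 'n) param" and x :: "('d, 'z, 'n) jstate"
    by (simp add: he_fun_def)
  show "continuous_on UNIV (\<lambda>x :: ('d, 'z, 'n) jstate. he_fun f lam \<theta> x $ i $ j)" for i and \<theta> :: "('d, 'n) param"
    unfolding he by (intro continuous_intros continuous_err continuous_D continuous_K)
  show "ubl (region R1 R2 :: ('d, 'z, 'n) vstate set) dist2 (\<lambda>p v. he_fun f lam (fst p) (embed (v, snd p)) $ i $ j)" for i
    unfolding he by (intro ubl_dist2 ubl_err ubl_D ubl_K)
qed (rule that, assumption+)

end

section \<open>Exchange of limits and derivatives\<close>

text \<open>A vector is the finite sum of its axis embeddings. Components in a Euclidean space allow
  the lemma to be applied twice, giving integrability of matrices.\<close>

lemma integrable_vec:
  fixes F :: "'w \<Rightarrow> 'b::euclidean_space^'i::finite"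
  assumes "\<And>i. integrable M (\<lambda>x. F x $ i)"
  shows "integrable M F"
proof -
  have lin: "bounded_linear (axis i :: 'b \<Rightarrow> 'b^'i)" for i
    by (simp add: linear_conv_bounded_linear[symmetric]) (rule linearI; simp add: vec_eq_iff axis_def)
  have "F = (\<lambda>x. \<Sum>i\<in>UNIV. axis i (F x $ i))"
    by (rule ext) (simp add: vec_eq_iff axis_def)
  moreover have "integrable M (\<lambda>x. \<Sum>i\<in>UNIV. axis i (F x $ i))"
    by (intro Bochner_Integration.integrable_sum integrable_bounded_linear[OF lin] assms)
  ultimately show ?thesis by simp
qed

lemma integral_vec_nth:
  fixes F :: "'w \<Rightarrow> 'b::euclidean_space^'i::finite"
  assumes "integrable M F"
  shows "(\<integral>x. F x \<partial>M) $ i = (\<integral>x. F x $ i \<partial>M)"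
  using integral_bounded_linear[OF bounded_linear_vec_nth assms, of i] by simp

lemma differentiable_vec:
  fixes F :: "'a::real_normed_vector \<Rightarrow> real^'i::finite"
  assumes "\<And>i. (\<lambda>p. F p $ i) differentiable (at \<theta>)"
  shows "F differentiable (at \<theta>)"
proof -
  have "(\<lambda>p. \<Sum>i\<in>UNIV. F p $ i *\<^sub>R axis i 1) differentiable (at \<theta>)"
    by (rule differentiable_sum) (auto intro!: differentiable_scaleR assms)
  also have "(\<lambda>p. \<Sum>i\<in>UNIV. F p $ i *\<^sub>R axis i 1) = F"
  proof
    show "(\<Sum>i\<in>UNIV. F p $ i *\<^sub>R axis i 1) = F p" for p
      using basis_expansion[of "F p"] by (simp add: scalar_mult_eq_scaleR)
  qed
  finally show ?thesis .
qed

text \<open>Geometrically decaying errors have a total of at most \<open>K / (1 - r)\<close>, which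
  the average divides by the number of terms. Counting by \<open>Suc n\<close> leaves out the empty
  average.\<close>

lemma cesaro_error:
  fixes a :: "nat \<Rightarrow> real"
  assumes a: "\<And>t. \<bar>a t - l\<bar> \<le> K * r ^ t" and r: "0 < r" "r < 1"
  shows "\<bar>1 / real (Suc n) * (\<Sum>t=1..Suc n. a t) - l\<bar> \<le> K / (1 - r) / real (Suc n)"
proof -
  have K: "0 \<le> K" using a[of 0] by simp
  have "(\<Sum>t=1..Suc n. a t) - real (Suc n) * l = (\<Sum>t=1..Suc n. a t - l)"
    by (simp add: sum_subtractf del: sum.cl_ivl_Suc)
  moreover have "\<bar>\<Sum>t=1..Suc n. a t - l\<bar> \<le> (\<Sum>t=1..Suc n. K * r ^ t)"
    by (rule order_trans[OF sum_abs sum_mono]) (rule a)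
  \<comment> \<open>The nonnegative term at \<open>t = 0\<close> is added to reach the closed form
    of the geometric sum.\<close>
  moreover have "(\<Sum>t=1..Suc n. K * r ^ t) \<le> (\<Sum>t<Suc (Suc n). K * r ^ t)"
    by (rule sum_mono2) (use K r in auto)
  moreover have "(\<Sum>t<Suc (Suc n). K * r ^ t) = K * ((1 - r ^ Suc (Suc n)) / (1 - r))"
    using r by (simp only: sum_distrib_left[symmetric]) (subst sum_gp_strict, auto)
  moreover have "K * ((1 - r ^ Suc (Suc n)) / (1 - r)) \<le> K * (1 / (1 - r))"
    using K r by (intro mult_left_mono divide_right_mono) auto
  moreover have "K * (1 / (1 - r)) = K / (1 - r)" by simp
  ultimately have "\<bar>(\<Sum>t=1..Suc n. a t) - real (Suc n) * l\<bar> \<le> K / (1 - r)" by linarith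
  then have "\<bar>(\<Sum>t=1..Suc n. a t) - real (Suc n) * l\<bar> / real (Suc n) \<le> K / (1 - r) / real (Suc n)"
    by (intro divide_right_mono) auto
  moreover have "\<bar>(\<Sum>t=1..Suc n. a t) - real (Suc n) * l\<bar> / real (Suc n)
      = \<bar>1 / real (Suc n) * (\<Sum>t=1..Suc n. a t) - l\<bar>"
  proof -
    have "1 / real (Suc n) * (\<Sum>t=1..Suc n. a t) - l = ((\<Sum>t=1..Suc n. a t) - real (Suc n) * l) / real (Suc n)"
      by (simp add: diff_divide_distrib del: sum.cl_ivl_Suc of_nat_Suc)
    then show ?thesis by (simp only: abs_divide abs_of_nat)
  qed
  ultimately show ?thesis by simp
qed

lemma reciprocal_Suc_tendsto_zero: "(\<lambda>n. C / real (Suc n)) \<longlonglongrightarrow> 0"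
  using LIMSEQ_Suc[OF lim_const_over_n[of C]] by simp

lemma cesaro_tendsto:
  fixes a :: "nat \<Rightarrow> real"
  assumes a: "\<And>t. \<bar>a t - l\<bar> \<le> K * r ^ t" and r: "0 < r" "r < 1"
  shows "(\<lambda>T. 1 / real T * (\<Sum>t=1..T. a t)) \<longlonglongrightarrow> l"
proof (rule LIMSEQ_imp_Suc)
  have "(\<lambda>n. 1 / real (Suc n) * (\<Sum>t=1..Suc n. a t) - l) \<longlonglongrightarrow> 0"
    by (rule Lim_null_comparison[OF _ reciprocal_Suc_tendsto_zero[of "K / (1 - r)"]])
      (use cesaro_error[OF a r] in \<open>simp only: real_norm_def eventually_True\<close>)
  then show "(\<lambda>n. 1 / real (Suc n) * (\<Sum>t=1..Suc n. a t)) \<longlonglongrightarrow> l" by (rule LIM_zero_cancel)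
qed

lemma average_has_derivative:
  fixes F :: "nat \<Rightarrow> real^'i::finite \<Rightarrow> real"
  assumes "\<And>t. (F t has_derivative (\<lambda>h. \<Sum>i\<in>UNIV. G i t * h $ i)) (at \<theta>)"
  shows "((\<lambda>\<theta>. 1 / real T * (\<Sum>t=1..T. F t \<theta>)) has_derivative
     (\<lambda>h. \<Sum>i\<in>UNIV. (1 / real T * (\<Sum>t=1..T. G i t)) * h $ i)) (at \<theta>)"
proof -
  have "((\<lambda>\<theta>. 1 / real T * (\<Sum>t=1..T. F t \<theta>)) has_derivative
     (\<lambda>h. 1 / real T * (\<Sum>t=1..T. \<Sum>i\<in>UNIV. G i t * h $ i))) (at \<theta>)"
    by (intro has_derivative_mult_right has_derivative_sum assms)
  also have "(\<lambda>h. 1 / real T * (\<Sum>t=1..T. \<Sum>i\<in>UNIV. G i t * h $ i))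
      = (\<lambda>h. \<Sum>i\<in>UNIV. (1 / real T * (\<Sum>t=1..T. G i t)) * h $ i)"
    by (rule ext, subst sum.swap) (simp add: sum_distrib_left sum_distrib_right mult.assoc)
  finally show ?thesis .
qed

section \<open>The expected loss, its gradient and its Hessian in the limit\<close>

context rnn_setting
begin

text \<open>The Cesaro errors for the partials of first and second order are free of \<theta>. The
  theorem on uniform limits is therefore applied twice: to the expected losses, and to their partial
  derivatives, whose limit is identified by the first application.\<close>

lemma loss_limit:
  fixes EL :: "nat \<Rightarrow> ('d, 'n) param \<Rightarrow> real" and L :: "('d, 'n) param \<Rightarrow> real"
  assumes EL: "\<And>T \<theta>. EL T \<theta> = (\<integral>\<omega>. loss f \<phi> lam X Z \<eta> T \<theta> \<omega> \<partial>M)"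
    and L: "\<And>\<theta>. L \<theta> = lim (\<lambda>T. EL T \<theta>)"
  shows "integrable M (loss f \<phi> lam X Z \<eta> T \<theta>)"
    "(\<lambda>T. EL T \<theta>) \<longlonglongrightarrow> L \<theta>"
    "integrable (limit_measure \<theta>) (g_fun f lam \<theta>)"
    "integrable (limit_measure \<theta>) (he_fun f lam \<theta>)"
    "EL T differentiable (at \<theta>)" "grad (EL T) differentiable (at \<theta>)"
    "L differentiable (at \<theta>)" "grad L differentiable (at \<theta>)"
    "grad L \<theta> = (\<integral>h. g_fun f lam \<theta> h \<partial>limit_measure \<theta>)"
    "(\<lambda>T. grad (EL T) \<theta>) \<longlonglongrightarrow> (\<integral>h. g_fun f lam \<theta> h \<partial>limit_measure \<theta>)"
    "hess L \<theta> = (\<integral>h. he_fun f lam \<theta> h \<partial>limit_measure \<theta>)"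
    "(\<lambda>T. hess (EL T) \<theta>) \<longlonglongrightarrow> (\<integral>h. he_fun f lam \<theta> h \<partial>limit_measure \<theta>)"
proof -
  let ?J = "\<lambda>\<theta> t \<omega>. joint \<phi> X Z \<eta> \<theta> t \<omega>"
  define ell where "ell t \<theta> = (\<integral>\<omega>. (err_fun f lam \<theta> (?J \<theta> t \<omega>))\<^sup>2 / 2 \<partial>M)" for t and \<theta> :: "('d, 'n) param"
  define G where "G i t \<theta> = (\<integral>\<omega>. g_fun f lam \<theta> (?J \<theta> t \<omega>) $ i \<partial>M)" for i t and \<theta> :: "('d, 'n) param"
  define H where "H i j t \<theta> = (\<integral>\<omega>. he_fun f lam \<theta> (?J \<theta> t \<omega>) $ i $ j \<partial>M)" for i j t and \<theta> :: "('d, 'n) param"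
  define ell' where "ell' \<theta> = (\<integral>x. (err_fun f lam \<theta> x)\<^sup>2 / 2 \<partial>limit_measure \<theta>)" for \<theta> :: "('d, 'n) param"
  define G' where "G' i \<theta> = (\<integral>x. g_fun f lam \<theta> x $ i \<partial>limit_measure \<theta>)" for i and \<theta> :: "('d, 'n) param"
  define H' where "H' i j \<theta> = (\<integral>x. he_fun f lam \<theta> x $ i $ j \<partial>limit_measure \<theta>)" for i j and \<theta> :: "('d, 'n) param"
  obtain K0 where e_int: "\<And>(\<theta> :: ('d, 'n) param) t. integrable M (\<lambda>\<omega>. (err_fun f lam \<theta> (?J \<theta> t \<omega>))\<^sup>2 / 2)"
    and e_rate': "\<And>t (\<theta> :: ('d, 'n) param). \<bar>(\<integral>\<omega>. (err_fun f lam \<theta> (?J \<theta> t \<omega>))\<^sup>2 / 2 \<partial>M)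
        - (\<integral>x. (err_fun f lam \<theta> x)\<^sup>2 / 2 \<partial>limit_measure \<theta>)\<bar> \<le> K0 * r ^ t"
    by (rule loss_ergodicity) (rule that, assumption+)
  note e_rate = e_rate'[folded ell_def ell'_def]
  obtain B1 K1 where g_int: "\<And>i (\<theta> :: ('d, 'n) param) t. integrable M (\<lambda>\<omega>. g_fun f lam \<theta> (?J \<theta> t \<omega>) $ i)"
    and g_lim_int: "\<And>i (\<theta> :: ('d, 'n) param). integrable (limit_measure \<theta>) (\<lambda>x. g_fun f lam \<theta> x $ i)"
    and g_rate': "\<And>i t (\<theta> :: ('d, 'n) param). \<bar>(\<integral>\<omega>. g_fun f lam \<theta> (?J \<theta> t \<omega>) $ i \<partial>M)
        - (\<integral>x. g_fun f lam \<theta> x $ i \<partial>limit_measure \<theta>)\<bar> \<le> K1 * r ^ t"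
    and g_bdd: "AE \<omega> in M. \<forall>t (\<theta> :: ('d, 'n) param) i. \<bar>g_fun f lam \<theta> (?J \<theta> t \<omega>) $ i\<bar> \<le> B1"
    by (rule gradient_ergodicity) (rule that, assumption+)
  note g_rate = g_rate'[folded G_def G'_def]
  \<comment> \<open>Bundles all facts about column \<open>j\<close>, so that the constants can be
    chosen as functions \<open>B2\<close> and \<open>K2\<close> of \<open>j\<close>.\<close>
  define Q where "Q j B K \<longleftrightarrow> (\<forall>i (\<theta> :: ('d, 'n) param) t. integrable M (\<lambda>\<omega>. he_fun f lam \<theta> (?J \<theta> t \<omega>) $ i $ j)) \<and>
    (\<forall>i (\<theta> :: ('d, 'n) param). integrable (limit_measure \<theta>) (\<lambda>x. he_fun f lam \<theta> x $ i $ j)) \<and>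
    (\<forall>i t \<theta>. \<bar>H i j t \<theta> - H' i j \<theta>\<bar> \<le> K * r ^ t) \<and>
    (AE \<omega> in M. \<forall>t (\<theta> :: ('d, 'n) param) i. \<bar>he_fun f lam \<theta> (?J \<theta> t \<omega>) $ i $ j\<bar> \<le> B)" for j B K
  have "\<exists>B K. Q j B K" for j
    unfolding Q_def H_def H'_def by (rule hessian_ergodicity[of j]) blast
  then obtain B2 K2 where Q: "\<And>j. Q j (B2 j) (K2 j)" by metis
  have h_int: "integrable M (\<lambda>\<omega>. he_fun f lam \<theta> (?J \<theta> t \<omega>) $ i $ j)"
    and h_lim_int: "integrable (limit_measure \<theta>) (\<lambda>x. he_fun f lam \<theta> x $ i $ j)"
    and h_rate: "\<bar>H i j t \<theta> - H' i j \<theta>\<bar> \<le> K2 j * r ^ t"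
    and h_bdd: "AE \<omega> in M. \<forall>t (\<theta> :: ('d, 'n) param) i. \<bar>he_fun f lam \<theta> (?J \<theta> t \<omega>) $ i $ j\<bar> \<le> B2 j"
    for i j t and \<theta> :: "('d, 'n) param"
    using Q[of j] unfolding Q_def by blast+
  note path = square_err_partial[OF \<phi>_deriv lam_deriv] g_partial[OF \<phi>_deriv lam_deriv]
  \<comment> \<open>The pathwise partial derivatives are the components of \<open>g_fun\<close>,
    bounded by \<open>B1\<close> off a null set common to all parameters.\<close>
  have ell_deriv: "(ell t has_derivative (\<lambda>h. \<Sum>i\<in>UNIV. G i t \<theta> * h $ i)) (at \<theta>)" for t \<theta>
  proof -
    have "((\<lambda>\<theta>. \<integral>\<omega>. (err_fun f lam \<theta> (?J \<theta> t \<omega>))\<^sup>2 / 2 \<partial>M) has_derivative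
       (\<lambda>h. \<Sum>i\<in>UNIV. (\<integral>\<omega>. partial i (\<lambda>\<theta>. (err_fun f lam \<theta> (?J \<theta> t \<omega>))\<^sup>2 / 2) \<theta> \<partial>M) * h $ i)) (at \<theta>)"
    proof (rule has_derivative_integral_partials[OF e_int])
      show "(\<lambda>\<omega>. partial i (\<lambda>\<theta>. (err_fun f lam \<theta> (?J \<theta> t \<omega>))\<^sup>2 / 2) \<theta>) \<in> borel_measurable M" for i
        using borel_measurable_integrable[OF g_int[of \<theta> t i]] by (simp only: joint_eq_path_state path)
      show "(\<lambda>\<theta>. (err_fun f lam \<theta> (?J \<theta> t \<omega>))\<^sup>2 / 2) differentiable (at \<theta>)" for \<omega> and \<theta> :: "('d, 'n) param"
        by (simp only: joint_eq_path_state path)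
      show "AE \<omega> in M. \<forall>(\<theta> :: ('d, 'n) param) i. \<bar>partial i (\<lambda>\<theta>. (err_fun f lam \<theta> (?J \<theta> t \<omega>))\<^sup>2 / 2) \<theta>\<bar> \<le> B1"
        using g_bdd
      proof eventually_elim
        case (elim \<omega>)
        then have "\<bar>g_fun f lam \<theta> (?J \<theta> t \<omega>) $ i\<bar> \<le> B1" for \<theta> :: "('d, 'n) param" and i by blast
        then show ?case by (intro allI) (simp only: joint_eq_path_state path)
      qed
    qed
    then show ?thesis unfolding ell_def[abs_def] G_def by (simp only: joint_eq_path_state path)
  qed
  have G_deriv: "(G j t has_derivative (\<lambda>h. \<Sum>i\<in>UNIV. H i j t \<theta> * h $ i)) (at \<theta>)" for j t \<theta>
  proof -
    have "((\<lambda>\<theta>. \<integral>\<omega>. g_fun f lam \<theta> (?J \<theta> t \<omega>) $ j \<partial>M) has_derivative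
       (\<lambda>h. \<Sum>i\<in>UNIV. (\<integral>\<omega>. partial i (\<lambda>\<theta>. g_fun f lam \<theta> (?J \<theta> t \<omega>) $ j) \<theta> \<partial>M) * h $ i)) (at \<theta>)"
    proof (rule has_derivative_integral_partials[OF g_int])
      show "(\<lambda>\<omega>. partial i (\<lambda>\<theta>. g_fun f lam \<theta> (?J \<theta> t \<omega>) $ j) \<theta>) \<in> borel_measurable M" for i
        using borel_measurable_integrable[OF h_int[of \<theta> t i j]] by (simp only: joint_eq_path_state path)
      show "(\<lambda>\<theta>. g_fun f lam \<theta> (?J \<theta> t \<omega>) $ j) differentiable (at \<theta>)" for \<omega> and \<theta> :: "('d, 'n) param"
        by (simp only: joint_eq_path_state path)
      show "AE \<omega> in M. \<forall>(\<theta> :: ('d, 'n) param) i. \<bar>partial i (\<lambda>\<theta>. g_fun f lam \<theta> (?J \<theta> t \<omega>) $ j) \<theta>\<bar> \<le> B2 j"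
        using h_bdd[of j]
      proof eventually_elim
        case (elim \<omega>)
        then have "\<bar>he_fun f lam \<theta> (?J \<theta> t \<omega>) $ i $ j\<bar> \<le> B2 j" for \<theta> :: "('d, 'n) param" and i by blast
        then show ?case by (intro allI) (simp only: joint_eq_path_state path)
      qed
    qed
    then show ?thesis unfolding G_def[abs_def] H_def by (simp only: joint_eq_path_state path)
  qed
  \<comment> \<open>For \<open>T = 0\<close> the sums are empty and both sides are 0, so the formula
    holds for every \<open>T\<close>.\<close>
  have EL_eq: "EL T = (\<lambda>\<theta>. 1 / real T * (\<Sum>t=1..T. ell t \<theta>))" for T
    by (rule ext) (simp add: EL loss_eq_err ell_def Bochner_Integration.integral_sum e_int)
  have EL_deriv: "(EL T has_derivative (\<lambda>h. \<Sum>i\<in>UNIV. (1 / real T * (\<Sum>t=1..T. G i t \<theta>)) * h $ i)) (at \<theta>)" for T \<theta>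
    unfolding EL_eq by (rule average_has_derivative[OF ell_deriv])
  have pEL: "partial i (EL T) = (\<lambda>\<theta>. 1 / real T * (\<Sum>t=1..T. G i t \<theta>))" for i T
    by (rule ext) (rule partial_linear_form[OF EL_deriv])
  have pEL_deriv: "(partial j (EL T) has_derivative (\<lambda>h. \<Sum>i\<in>UNIV. (1 / real T * (\<Sum>t=1..T. H i j t \<theta>)) * h $ i)) (at \<theta>)" for j T \<theta>
    unfolding pEL by (rule average_has_derivative[OF G_deriv])
  have ppEL: "partial i (partial j (EL T)) \<theta> = 1 / real T * (\<Sum>t=1..T. H i j t \<theta>)" for i j T \<theta>
    by (rule partial_linear_form[OF pEL_deriv])
  have lim: "(\<lambda>T. EL T \<theta>) \<longlonglongrightarrow> ell' \<theta>" for \<theta>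
    unfolding EL_eq by (rule cesaro_tendsto[OF e_rate r])
  have L_eq: "L = ell'" by (rule ext) (simp add: L limI[OF lim])
  \<comment> \<open>The shift to \<open>Suc n\<close> discards the empty average at
    \<open>T = 0\<close>, which the error bound does not cover.\<close>
  have L_deriv: "(L has_derivative (\<lambda>h. \<Sum>i\<in>UNIV. G' i \<theta> * h $ i)) (at \<theta>)" for \<theta>
  proof (rule has_derivative_uniform_limit[where F="\<lambda>n. EL (Suc n)"])
    show "EL (Suc n) differentiable (at \<theta>)" for n \<theta> using EL_deriv by (rule differentiableI)
    show "\<bar>partial i (EL (Suc n)) \<theta> - G' i \<theta>\<bar> \<le> K1 / (1 - r) / real (Suc n)" for n \<theta> i
      unfolding pEL by (rule cesaro_error[OF g_rate r])
    show "(\<lambda>n. K1 / (1 - r) / real (Suc n)) \<longlonglongrightarrow> 0" by (rule reciprocal_Suc_tendsto_zero)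
    show "(\<lambda>n. EL (Suc n) \<theta>) \<longlonglongrightarrow> L \<theta>" for \<theta> unfolding L_eq by (rule LIMSEQ_Suc[OF lim])
  qed
  have pL: "partial j L = G' j" for j
    by (rule ext) (rule partial_linear_form[OF L_deriv])
  \<comment> \<open>Now the partial derivatives play the role of the functions; their pointwise
    limit is \<open>G' j\<close>, which has just been identified with
    \<open>partial j L\<close>.\<close>
  have pL_deriv: "(partial j L has_derivative (\<lambda>h. \<Sum>i\<in>UNIV. H' i j \<theta> * h $ i)) (at \<theta>)" for j \<theta>
  proof (rule has_derivative_uniform_limit[where F="\<lambda>n. partial j (EL (Suc n))"])
    show "partial j (EL (Suc n)) differentiable (at \<theta>)" for n \<theta> using pEL_deriv by (rule differentiableI)
    show "\<bar>partial i (partial j (EL (Suc n))) \<theta> - H' i j \<theta>\<bar> \<le> K2 j / (1 - r) / real (Suc n)" for n \<theta> i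
      unfolding ppEL by (rule cesaro_error[OF h_rate r])
    show "(\<lambda>n. K2 j / (1 - r) / real (Suc n)) \<longlonglongrightarrow> 0" by (rule reciprocal_Suc_tendsto_zero)
    show "(\<lambda>n. partial j (EL (Suc n)) \<theta>) \<longlonglongrightarrow> partial j L \<theta>" for \<theta>
      unfolding pL pEL by (rule LIMSEQ_Suc[OF cesaro_tendsto[OF g_rate r]])
  qed
  have ppL: "partial i (partial j L) \<theta> = H' i j \<theta>" for i j \<theta>
    by (rule partial_linear_form[OF pL_deriv])
  show "integrable M (loss f \<phi> lam X Z \<eta> T \<theta>)"
    unfolding loss_eq_err[abs_def] by (intro integrable_mult_right Bochner_Integration.integrable_sum e_int)
  show "(\<lambda>T. EL T \<theta>) \<longlonglongrightarrow> L \<theta>" unfolding L_eq by (rule lim)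
  show ig: "integrable (limit_measure \<theta>) (g_fun f lam \<theta>)" by (rule integrable_vec[OF g_lim_int])
  have ih': "integrable (limit_measure \<theta>) (\<lambda>x. he_fun f lam \<theta> x $ i)" for i by (rule integrable_vec[OF h_lim_int])
  show ih: "integrable (limit_measure \<theta>) (he_fun f lam \<theta>)" by (rule integrable_vec[OF ih'])
  show "EL T differentiable (at \<theta>)" using EL_deriv by (rule differentiableI)
  show "grad (EL T) differentiable (at \<theta>)"
    by (rule differentiable_vec) (simp add: grad_def differentiableI[OF pEL_deriv])
  show "L differentiable (at \<theta>)" using L_deriv by (rule differentiableI)
  show "grad L differentiable (at \<theta>)"
    by (rule differentiable_vec) (simp add: grad_def differentiableI[OF pL_deriv])
  have gI: "(\<integral>h. g_fun f lam \<theta> h \<partial>limit_measure \<theta>) $ i = G' i \<theta>" for i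
    unfolding G'_def by (rule integral_vec_nth[OF ig])
  have hI: "(\<integral>h. he_fun f lam \<theta> h \<partial>limit_measure \<theta>) $ i $ j = H' i j \<theta>" for i j
    unfolding H'_def integral_vec_nth[OF ih] by (rule integral_vec_nth[OF ih'])
  show "grad L \<theta> = (\<integral>h. g_fun f lam \<theta> h \<partial>limit_measure \<theta>)"
    by (simp add: vec_eq_iff gI grad_def pL)
  show "(\<lambda>T. grad (EL T) \<theta>) \<longlonglongrightarrow> (\<integral>h. g_fun f lam \<theta> h \<partial>limit_measure \<theta>)"
    by (rule vec_tendstoI) (simp only: gI grad_def vec_lambda_beta pEL cesaro_tendsto[OF g_rate r])
  show "hess L \<theta> = (\<integral>h. he_fun f lam \<theta> h \<partial>limit_measure \<theta>)"
    by (simp add: vec_eq_iff hI hess_def ppL)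
  show "(\<lambda>T. hess (EL T) \<theta>) \<longlonglongrightarrow> (\<integral>h. he_fun f lam \<theta> h \<partial>limit_measure \<theta>)"
    by (rule vec_tendstoI, rule vec_tendstoI) (simp only: hI hess_def vec_lambda_beta ppEL cesaro_tendsto[OF h_rate r])
qed

end

theorem theorem3p16:
  fixes M :: "'w measure"
    and X :: "nat \<Rightarrow> 'w \<Rightarrow> real^'d"
    and Z :: "nat \<Rightarrow> 'w \<Rightarrow> real^'z"
    and \<eta> :: "nat \<Rightarrow> 'w \<Rightarrow> real"
    and \<kappa> :: "(real^'d) \<times> (real^'z) \<Rightarrow> ((real^'d) \<times> (real^'z)) measure"
    and \<mu>\<eta> :: "real measure"
    and f :: "real^'d \<Rightarrow> real^'z \<Rightarrow> real \<Rightarrow> real"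
    and \<phi> lam :: "real \<Rightarrow> real"
    and Lp Lf C0 C1 C2 :: real
    and EL :: "nat \<Rightarrow> ('d, 'n::finite) param \<Rightarrow> real"
    and L :: "('d, 'n) param \<Rightarrow> real"
    and \<mu> :: "('d, 'n) param \<Rightarrow> ('d, 'z, 'n) jstate measure"
  assumes data: "data_assumption M X Z \<eta> \<kappa> \<mu>\<eta> f Lp Lf"
    and smooth: "smooth_bounded \<phi>" "smooth_bounded lam"
    and C0: "\<And>y. \<bar>\<phi> y\<bar> \<le> C0"
    and C1: "\<And>y. \<bar>deriv \<phi> y\<bar> \<le> C1"
    and C2: "\<And>y. \<bar>deriv (deriv \<phi>) y\<bar> \<le> C2"
    and small: "smallness_assumption CARD('n) CARD('d) C0 C1 C2 Lp"
    and EL: "\<And>T \<theta>. EL T \<theta> = (\<integral>\<omega>. loss f \<phi> lam X Z \<eta> T \<theta> \<omega> \<partial>M)"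
    and L: "\<And>\<theta>. L \<theta> = lim (\<lambda>T. EL T \<theta>)"
    and \<mu>: "\<And>\<theta>. \<mu> \<theta> = stationary_law M X Z \<eta> \<kappa> \<mu>\<eta> \<phi> \<theta>"
  shows "\<forall>\<theta>.
    (\<forall>T. integrable M (loss f \<phi> lam X Z \<eta> T \<theta>)) \<and>
    (\<lambda>T. EL T \<theta>) \<longlonglongrightarrow> L \<theta> \<and>
    is_stationary_law M X Z \<eta> \<kappa> \<mu>\<eta> \<phi> \<theta> (\<mu> \<theta>) \<and>
    integrable (\<mu> \<theta>) (g_fun f lam \<theta>) \<and>
    integrable (\<mu> \<theta>) (he_fun f lam \<theta>) \<and>
    (\<forall>T. EL T differentiable (at \<theta>)) \<and>
    (\<forall>T. grad (EL T) differentiable (at \<theta>)) \<and>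
    L differentiable (at \<theta>) \<and>
    grad L differentiable (at \<theta>) \<and>
    grad L \<theta> = (\<integral>h. g_fun f lam \<theta> h \<partial>\<mu> \<theta>) \<and>
    (\<lambda>T. grad (EL T) \<theta>) \<longlonglongrightarrow> (\<integral>h. g_fun f lam \<theta> h \<partial>\<mu> \<theta>) \<and>
    hess L \<theta> = (\<integral>h. he_fun f lam \<theta> h \<partial>\<mu> \<theta>) \<and>
    (\<lambda>T. hess (EL T) \<theta>) \<longlonglongrightarrow> (\<integral>h. he_fun f lam \<theta> h \<partial>\<mu> \<theta>)"
proof -
  \<comment> \<open>The smallness assumption supplies \<open>C0 < 4\<close>, so that the diagonal
    factor \<open>C0 / 4\<close> is below 1.\<close>
  interpret act: bounded_activation \<phi> C0 C1 C2
    by unfold_locales (use C0 C1 C2 small in \<open>simp_all add: smallness_assumption_def\<close>)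
  have Lp: "0 \<le> Lp" "Lp < 1" using data by (simp_all add: data_assumption_def)
  \<comment> \<open>The constants are obtained before any \<theta> is fixed; the uniformity of all
    later estimates rests on this order of quantifiers.\<close>
  obtain R1 R2 b0 b1 c r A where *: "0 \<le> R1" "0 \<le> R2" "1 \<le> b0" "1 \<le> b1" "0 < r" "r < 1" "0 < A" "A * Lp + c \<le> r * A"
    "\<And>\<theta> (w :: (real^'d) \<times> (real^'z)) (u :: (real^'n) \<times> _).
       u \<in> u_region R1 R2 \<Longrightarrow> step_at \<phi> \<theta> (w, u) \<in> u_region R1 R2"
    "\<And>\<theta> (w :: (real^'d) \<times> (real^'z)) w' (u :: (real^'n) \<times> _) u'. u \<in> u_region R1 R2 \<Longrightarrow> u' \<in> u_region R1 R2 \<Longrightarrow>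
       u_dist b0 b1 (step_at \<phi> \<theta> (w, u)) (step_at \<phi> \<theta> (w', u')) \<le> r * u_dist b0 b1 u u' + c * infnorm (w - w')"
    by (rule act.contraction_constants[OF Lp]) (rule that, assumption+)
  interpret prob_space M using data by (simp add: data_assumption_def)
  interpret S: rnn_setting M X Z \<eta> \<kappa> \<mu>\<eta> f \<phi> lam Lp Lf "TYPE('n)" R1 R2 b0 b1 c r A
    by unfold_locales (rule data smooth *; assumption?)+
  have \<mu>_eq: "\<mu> \<theta> = S.limit_measure \<theta>" for \<theta> by (simp add: \<mu> S.stationary_law_eq)
  show ?thesis
    unfolding \<mu>_eq using S.loss_limit[OF EL L] S.limit_measure_stationary by blast
qed

end
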